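(* For every integer $d\ge4$, the maximally entangled state $$|\Phi_d\rangle=\frac1{\sqrt d}\sum_{j=0}^{d-1}|j\rangle\otimes|j\rangle\in\mathbb C^d\otimes\mathbb C^d$$ does not admit an exact classical simulation (of its local measurement statistics) with any finite message dimension $d_C\in\mathbb N$.
   Context: Notation: $[n]=\{1,\dots,n\}$; $\mathbb{1}_d$ is the identity on $\mathbb C^d$; $\{|j\rangle\}$ is the computational (standard) basis. The set of $n$-outcome POVMs in dimension $d$ is $\mathcal M_{d,n}=\{(M_1,\dots,M_n): M_b=M_b^\dagger\in\mathbb C^{d\times d},\ M_b\succeq0,\ \sum_{b=1}^nM_b=\mathbb{1}_d\}$, with its Borel $\sigma$-algebra $\mathcal B(\mathcal M_{d,n})$. Definition (classical simulation of the local measurement statistics of a bipartite state). Fix $d_A,d_B,d_C\in\mathbb N$ and a state (positive semidefinite, trace one) $\rho_{AB}$ on $\mathbb C^{d_A}\otimes\mathbb C^{d_B}$. The local measurement statistics of $\rho_{AB}$ admit an (exact) classical simulation with classical message dimension $d_C$ if there exist: (1) a probability space $(\Lambda,\Sigma_\Lambda,\mu)$; (2) for every $n_A\ge1$, numbers $p_A(a,c\mid M^A,\lambda)\ge0$ for $a\in[n_A]$, $c\in[d_C]$, $M^A\in\mathcal M_{d_A,n_A}$, $\lambda\in\Lambda$, with $\sum_{a}\sum_{c}p_A(a,c\mid M^A,\lambda)=1$; and for every $n_B\ge1$, numbers $p_B(b\mid M^B,c,\lambda)\ge0$ for $b\in[n_B]$, $M^B\in\mathcal M_{d_B,n_B}$,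 $c\in[d_C]$, $\lambda\in\Lambda$, with $\sum_bp_B(b\mid M^B,c,\lambda)=1$; (3) such that all maps $(M^A,\lambda)\mapsto p_A(a,c\mid M^A,\lambda)$ are $\mathcal B(\mathcal M_{d_A,n_A})\otimes\Sigma_\Lambda$-measurable and all maps $(M^B,\lambda)\mapsto p_B(b\mid M^B,c,\lambda)$ are $\mathcal B(\mathcal M_{d_B,n_B})\otimes\Sigma_\Lambda$-measurable; (4) and such that for all $n_A,n_B\ge1$, $M^A\in\mathcal M_{d_A,n_A}$, $M^B\in\mathcal M_{d_B,n_B}$, $a\in[n_A]$, $b\in[n_B]$, $$\operatorname{tr}[\rho_{AB}(M^A_a\otimes M^B_b)]=\int_\Lambda\sum_{c=1}^{d_C}p_A(a,c\mid M^A,\lambda)\,p_B(b\mid M^B,c,\lambda)\,d\mu(\lambda).$$ A unit vector $|\psi\rangle$ stands for the state $|\psi\rangle\langle\psi|$; here $d_A=d_B=d$. *)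

theory Defs
  imports "HOL-Probability.Probability"
begin

text \<open>
  An operator on a Hilbert space of dimension d is a matrix of type
  \<open>complex^'d^'d\<close> with \<open>CARD('d) = d\<close>; the entry in row i and column j is \<open>A $ i $ j\<close>.
  The tensor product of two such spaces is indexed by the product of the index types.
\<close>

definition conj_transpose :: "complex^'n^'m \<Rightarrow> complex^'m^'n" where
  "conj_transpose A = (\<chi> i j. cnj (A $ j $ i))"

definition hermitian :: "complex^'d^'d \<Rightarrow> bool" where
  "hermitian A \<longleftrightarrow> conj_transpose A = A"

text \<open>The quadratic form of a Hermitian matrix is real, so only its real part is constrained.\<close>

definition pos_semidef :: "complex^'d^'d \<Rightarrow> bool" where
  "pos_semidef A \<longleftrightarrow>
     hermitian A \<and> (\<forall>v. 0 \<le> Re (\<Sum>i\<in>UNIV. cnj (v $ i) * (A *v v) $ i))"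

definition quantum_state :: "complex^'d^'d \<Rightarrow> bool" where
  "quantum_state \<rho> \<longleftrightarrow> pos_semidef \<rho> \<and> trace \<rho> = 1"

definition tensor_vec :: "complex^'a \<Rightarrow> complex^'b \<Rightarrow> complex^('a \<times> 'b)" where
  "tensor_vec u v = (\<chi> p. u $ fst p * v $ snd p)"

definition tensor_mat ::
    "complex^'a^'a \<Rightarrow> complex^'b^'b \<Rightarrow> complex^('a \<times> 'b)^('a \<times> 'b)" where
  "tensor_mat A B = (\<chi> p q. A $ fst p $ fst q * B $ snd p $ snd q)"

definition pure_state :: "complex^'d \<Rightarrow> complex^'d^'d" where
  "pure_state \<psi> = (\<chi> i j. \<psi> $ i * cnj (\<psi> $ j))"

definition max_entangled :: "complex^('d::finite \<times> 'd)" where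
  "max_entangled =
     (1 / sqrt (real CARD('d))) *\<^sub>R (\<Sum>j\<in>UNIV. tensor_vec (axis j 1) (axis j 1))"

text \<open>
  A tuple \<open>(M\<^sub>1, \<dots>, M\<^sub>n)\<close> is a function on \<open>nat\<close> that vanishes outside \<open>{1..n}\<close>,
  so that tuples and functions of this kind correspond bijectively.
\<close>

definition povms :: "nat \<Rightarrow> (nat \<Rightarrow> complex^'d^'d) set" where
  "povms n = {M. (\<forall>b\<in>{1..n}. pos_semidef (M b)) \<and> (\<Sum>b\<in>{1..n}. M b) = mat 1 \<and>
                 (\<forall>b. b \<notin> {1..n} \<longrightarrow> M b = 0)}"

text \<open>
  The Borel sets of the subspace topology. The ambient topology on \<open>nat \<Rightarrow> complex^'d^'d\<close> is
  the product topology; on functions vanishing outside \<open>{1..n}\<close> it is the usual topology of the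
  n-fold product of the matrix space.
\<close>

definition povm_borel :: "nat \<Rightarrow> (nat \<Rightarrow> complex^'d^'d) measure" where
  "povm_borel n = restrict_space borel (povms n)"

text \<open>
  \<open>p\<^sub>A n M l a c\<close> and \<open>p\<^sub>B n M c l b\<close> are the response functions for POVMs with n outcomes.
  HOL cannot quantify existentially over types, so the type of hidden variables is a parameter;
  the hidden-variable space itself is \<open>space \<mu>\<close>, which may be a proper subset of that type.
\<close>

definition admits_classical_simulation ::
    "'l itself \<Rightarrow> nat \<Rightarrow> complex^('a::finite \<times> 'b::finite)^('a \<times> 'b) \<Rightarrow> bool" where
  "admits_classical_simulation _ d\<^sub>C \<rho> \<longleftrightarrow>
    (\<exists>(\<mu> :: 'l measure)
      (p\<^sub>A :: nat \<Rightarrow> (nat \<Rightarrow> complex^'a^'a) \<Rightarrow> 'l \<Rightarrow> nat \<Rightarrow> nat \<Rightarrow> real)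
      (p\<^sub>B :: nat \<Rightarrow> (nat \<Rightarrow> complex^'b^'b) \<Rightarrow> nat \<Rightarrow> 'l \<Rightarrow> nat \<Rightarrow> real).
      prob_space \<mu> \<and>
      (\<forall>n\<ge>1. \<forall>M\<in>povms n. \<forall>l\<in>space \<mu>.
         (\<forall>a\<in>{1..n}. \<forall>c\<in>{1..d\<^sub>C}. 0 \<le> p\<^sub>A n M l a c) \<and>
         (\<Sum>a\<in>{1..n}. \<Sum>c\<in>{1..d\<^sub>C}. p\<^sub>A n M l a c) = 1) \<and>
      (\<forall>n\<ge>1. \<forall>M\<in>povms n. \<forall>c\<in>{1..d\<^sub>C}. \<forall>l\<in>space \<mu>.
         (\<forall>b\<in>{1..n}. 0 \<le> p\<^sub>B n M c l b) \<and>
         (\<Sum>b\<in>{1..n}. p\<^sub>B n M c l b) = 1) \<and>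
      (\<forall>n\<ge>1. \<forall>a\<in>{1..n}. \<forall>c\<in>{1..d\<^sub>C}.
         (\<lambda>(M, l). p\<^sub>A n M l a c) \<in> borel_measurable (povm_borel n \<Otimes>\<^sub>M \<mu>)) \<and>
      (\<forall>n\<ge>1. \<forall>b\<in>{1..n}. \<forall>c\<in>{1..d\<^sub>C}.
         (\<lambda>(M, l). p\<^sub>B n M c l b) \<in> borel_measurable (povm_borel n \<Otimes>\<^sub>M \<mu>)) \<and>
      (\<forall>n\<^sub>A\<ge>1. \<forall>n\<^sub>B\<ge>1. \<forall>M\<in>povms n\<^sub>A. \<forall>N\<in>povms n\<^sub>B. \<forall>a\<in>{1..n\<^sub>A}. \<forall>b\<in>{1..n\<^sub>B}.
         trace (\<rho> ** tensor_mat (M a) (N b)) =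
         complex_of_real
           (\<integral>l. (\<Sum>c\<in>{1..d\<^sub>C}. p\<^sub>A n\<^sub>A M l a c * p\<^sub>B n\<^sub>B N c l b) \<partial>\<mu>)))"

lemma max_entangled_nth:
  "(max_entangled :: complex^('d::finite \<times> 'd)) $ p =
     (if fst p = snd p then complex_of_real (1 / sqrt (real CARD('d))) else 0)"
proof -
  have "(\<Sum>j\<in>UNIV. tensor_vec (axis j 1) (axis j 1) $ p :: complex) =
      (\<Sum>j\<in>UNIV. if j = fst p then (if fst p = snd p then 1 else 0) else 0)"
    by (rule sum.cong) (auto simp: tensor_vec_def axis_def)
  then show ?thesis
    unfolding max_entangled_def vector_scaleR_component sum_component
    by (simp add: scaleR_conv_of_real)
qed

lemma pos_semidef_pure_state: "pos_semidef (pure_state \<psi>)"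
proof -
  have "(\<Sum>i\<in>UNIV. cnj (v $ i) * (pure_state \<psi> *v v) $ i) =
      (\<Sum>i\<in>UNIV. cnj (v $ i) * \<psi> $ i) * cnj (\<Sum>i\<in>UNIV. cnj (v $ i) * \<psi> $ i)" for v
    unfolding cnj_sum sum_product
    by (simp add: pure_state_def matrix_vector_mult_def sum_distrib_left mult_ac)
  then have "0 \<le> Re (\<Sum>i\<in>UNIV. cnj (v $ i) * (pure_state \<psi> *v v) $ i)" for v
    by (simp only: complex_norm_square[symmetric]) simp
  moreover have "hermitian (pure_state \<psi>)"
    by (simp add: hermitian_def conj_transpose_def pure_state_def vec_eq_iff mult.commute)
  ultimately show ?thesis
    by (simp add: pos_semidef_def)
qed

lemma quantum_state_max_entangled:
  "quantum_state (pure_state (max_entangled :: complex^('d::finite \<times> 'd)))"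
proof -
  have "trace (pure_state (max_entangled :: complex^('d \<times> 'd))) =
      (\<Sum>p\<in>(UNIV :: ('d \<times> 'd) set).
        if fst p = snd p then complex_of_real (1 / real CARD('d)) else 0)"
    unfolding trace_def
    by (intro sum.cong refl) (simp add: pure_state_def max_entangled_nth flip: of_real_mult)
  also have "\<dots> = (\<Sum>i\<in>(UNIV :: 'd set). \<Sum>j\<in>UNIV.
      if i = j then complex_of_real (1 / real CARD('d)) else 0)"
    unfolding sum.cartesian_product UNIV_Times_UNIV case_prod_unfold ..
  also have "\<dots> = 1"
    by simp
  finally show ?thesis
    by (simp add: quantum_state_def pos_semidef_pure_state)
qed

end

theory Submission imports Defs begin

text \<open>
  Only two-outcome measurements on four basis vectors are needed. Let Alice project onto
  \<open>(1, v\<^sub>1, v\<^sub>2, c)\<close> and Bob onto \<open>(c', w\<^sub>1, w\<^sub>2, 1)\<close>; both projections succeed with probability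
  proportional to \<open>\<bar>z\<bar>\<^sup>2\<close>, where \<open>z = c + v \<bullet> w + c'\<close> is the bilinear product of the vectors.
  Fix the hidden variable and the message, and let \<open>E\<close> be the set of Alice's vectors that may be
  answered with success and this message, and \<open>h\<close> Bob's success probability.
  Let \<open>b(z)\<close> be the integral of \<open>1\<^sub>E(x) h(y)\<close> over the pairs with bilinear product \<open>z\<close>.
  Exactness forces \<open>b(0) = 0\<close> almost surely, and the claim is that then \<open>b(s) = o(\<bar>s\<bar>\<^sup>2)\<close>, with a
  bound \<open>M \<bar>s\<bar>\<^sup>2\<close> that is uniform in the hidden variable. Summing over finitely many messages and
  integrating, dominated convergence contradicts the quantum probability, which is of exact
  order \<open>\<bar>s\<bar>\<^sup>2\<close>.

  For the claim, only those points of \<open>E\<close> count that leave \<open>E\<close> under the translation by \<open>s\<close> in the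
  last coordinate; their measure tends to 0 with \<open>s\<close>. Let \<open>b'\<close> be the function \<open>b\<close> of this smaller
  set. As \<open>b'(0) = 0\<close> and \<open>b'(- s) \<ge> 0\<close>, \<open>b(s) = b'(s)\<close> is at most the second difference of \<open>b'\<close>.
  The Fourier transform of \<open>b'\<close> at \<open>\<xi>\<close> is a bilinear form in the partial Fourier
  transforms of \<open>1\<^sub>E'\<close> and \<open>h\<close> in the last coordinate, whose kernel is the exponential of
  \<open>v \<bullet> w\<close> scaled by \<open>\<bar>\<xi>\<bar>\<close>. Since \<open>v\<close> and \<open>w\<close> range over a space of real dimension 4, Bessel's inequality
  yields a factor \<open>\<bar>\<xi>\<bar>\<^sup>-\<^sup>2\<close>, exactly what is needed to absorb the factor \<open>\<bar>s\<bar>\<^sup>2\<bar>\<xi>\<bar>\<^sup>2\<close>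
  from the second difference. This is where dimension 4 enters.
\<close>

section \<open>Fourier analysis on Euclidean spaces\<close>

lemma lborel_prod_Basis:
  fixes f :: "'a::euclidean_space \<Rightarrow> real \<Rightarrow> complex"
  assumes "\<And>b. b \<in> Basis \<Longrightarrow> integrable lborel (f b)"
  shows integrable_lborel_prod_Basis: "integrable lborel (\<lambda>x::'a. \<Prod>b\<in>Basis. f b (x \<bullet> b))"
    and integral_lborel_prod_Basis:
      "(\<integral>x. (\<Prod>b\<in>(Basis::'a set). f b (x \<bullet> b)) \<partial>lborel) = (\<Prod>b\<in>Basis. \<integral>t. f b t \<partial>lborel)"
proof -
  interpret P: product_sigma_finite "\<lambda>_::'a. lborel::real measure"
    by standard
  have [measurable]: "b \<in> Basis \<Longrightarrow> f b \<in> borel_measurable borel" for b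
    using borel_measurable_integrable[OF assms] by simp
  \<comment> \<open>\<open>lborel\<close> is the image of the product of one-dimensional Lebesgue
    measures under this coordinate map, so functions that factor over the coordinates integrate
    factor by factor.\<close>
  let ?T = "\<lambda>g. \<Sum>b\<in>Basis. g b *\<^sub>R (b::'a)"
  have T: "(\<Prod>b\<in>Basis. f b (?T g \<bullet> b)) = (\<Prod>b\<in>Basis. f b (g b))" for g
    by simp
  have "integrable (distr (\<Pi>\<^sub>M b\<in>Basis. lborel) borel ?T) (\<lambda>x::'a. \<Prod>b\<in>Basis. f b (x \<bullet> b))"
    by (subst integrable_distr_eq) (use P.product_integrable_prod[of Basis f] assms in simp_all)
  then show "integrable lborel (\<lambda>x::'a. \<Prod>b\<in>Basis. f b (x \<bullet> b))"
    by (simp only: lborel_eq[symmetric])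
  show "(\<integral>x. (\<Prod>b\<in>(Basis::'a set). f b (x \<bullet> b)) \<partial>lborel) = (\<Prod>b\<in>Basis. \<integral>t. f b t \<partial>lborel)"
    by (subst lborel_eq, subst integral_distr)
      (use P.product_integral_prod[of Basis f] assms in simp_all)
qed

text \<open>This is the characteristic function of the standard normal distribution after a change
  of scale.\<close>

lemma gaussian_fourier_real:
  fixes \<delta> t :: real
  assumes "\<delta> > 0"
  shows "has_bochner_integral lborel (\<lambda>x. complex_of_real (exp (- \<delta> * x\<^sup>2 / 2)) * cis (x * t))
           (sqrt (2 * pi / \<delta>) * exp (- t\<^sup>2 / (2 * \<delta>)))"
proof -
  \<comment> \<open>The substitution of \<open>r * x\<close> for \<open>x\<close> turns the standard
    normal density into the Gaussian weight with parameter \<open>\<delta>\<close> and the frequency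
    \<open>t / r\<close> into \<open>t\<close>.\<close>
  define r where "r = sqrt \<delta>"
  have r: "r > 0" "r\<^sup>2 = \<delta>"
    using assms by (auto simp: r_def)
  define g where "g = (\<lambda>x. std_normal_density x *\<^sub>R cis (x * (t / r)))"
  have int: "integrable std_normal_distribution (\<lambda>x. cis (x * (t / r)))"
  proof -
    interpret prob_space std_normal_distribution
      using real_dist_normal_dist real_distribution.axioms(1) by blast
    show ?thesis
      by (rule integrable_const_bound[where B=1]) (auto simp: cis_conv_exp)
  qed
  then have "integrable lborel g"
    unfolding g_def by (subst (asm) integrable_density) (auto simp: cis_conv_exp)
  moreover have "integral\<^sup>L lborel g = exp (- (t / r)\<^sup>2 / 2)"
  proof -
    have "integral\<^sup>L lborel g = (CLINT x|std_normal_distribution. cis (x * (t / r)))"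
      unfolding g_def by (subst integral_density) (auto simp: cis_conv_exp)
    also have "\<dots> = char std_normal_distribution (t / r)"
      unfolding char_def by (simp add: cis_conv_exp mult_ac)
    finally show ?thesis
      by (simp add: char_std_normal_distribution)
  qed
  ultimately have "has_bochner_integral lborel g (exp (- (t / r)\<^sup>2 / 2))"
    by (metis has_bochner_integral_integrable)
  then have "has_bochner_integral lborel (\<lambda>x. g (0 + r * x)) (exp (- (t / r)\<^sup>2 / 2) /\<^sub>R \<bar>r\<bar>)"
    using lborel_has_bochner_integral_real_affine_iff[of r g _ 0] r by (simp add: scaleR_conv_of_real)
  then have "has_bochner_integral lborel (\<lambda>x. complex_of_real (sqrt (2 * pi)) * g (0 + r * x))
     (complex_of_real (sqrt (2 * pi)) * (exp (- (t / r)\<^sup>2 / 2) /\<^sub>R \<bar>r\<bar>))"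
    by (intro has_bochner_integral_mult_right)
  moreover have "complex_of_real (sqrt (2 * pi)) * g (0 + r * x)
      = complex_of_real (exp (- \<delta> * x\<^sup>2 / 2)) * cis (x * t)" for x
    using r by (simp add: g_def std_normal_density_def scaleR_conv_of_real power_mult_distrib mult_ac)
  moreover have "complex_of_real (sqrt (2 * pi)) * (exp (- (t / r)\<^sup>2 / 2) /\<^sub>R \<bar>r\<bar>)
      = sqrt (2 * pi / \<delta>) * exp (- t\<^sup>2 / (2 * \<delta>))"
    using r by (simp add: scaleR_conv_of_real real_sqrt_divide r_def[symmetric] power_divide
        divide_simps mult_ac)
  ultimately show ?thesis
    by simp
qed

lemma cis_sum: "cis (sum f A) = (\<Prod>x\<in>A. cis (f x))"
  by (induction A rule: infinite_finite_induct) (auto simp: cis_mult[symmetric])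

text \<open>Both the Gaussian and the character are products over the coordinates, so the claim
  reduces to one dimension.\<close>

lemma gaussian_fourier:
  fixes z :: "'a::euclidean_space"
  assumes "\<delta> > 0"
  shows "has_bochner_integral lborel
           (\<lambda>x::'a. complex_of_real (exp (- \<delta> * (norm x)\<^sup>2 / 2)) * cis (x \<bullet> z))
           (sqrt (2 * pi / \<delta>) ^ DIM('a) * exp (- (norm z)\<^sup>2 / (2 * \<delta>)))"
proof -
  define f where "f = (\<lambda>b x. complex_of_real (exp (- \<delta> * x\<^sup>2 / 2)) * cis (x * (z \<bullet> b)))"
  have f: "integrable lborel (f b)"
    "integral\<^sup>L lborel (f b) = sqrt (2 * pi / \<delta>) * exp (- (z \<bullet> b)\<^sup>2 / (2 * \<delta>))" for b
    using gaussian_fourier_real[OF assms, of "z \<bullet> b"] by (auto simp: f_def has_bochner_integral_iff)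
  have norm_sq: "(norm x)\<^sup>2 = (\<Sum>b\<in>Basis. (x \<bullet> b)\<^sup>2)" for x :: 'a
    unfolding power2_norm_eq_inner by (subst euclidean_inner) (simp add: power2_eq_square)
  have "(\<Prod>b\<in>Basis. f b (x \<bullet> b)) =
      complex_of_real (exp (- \<delta> * (norm x)\<^sup>2 / 2)) * cis (x \<bullet> z)" for x :: 'a
    unfolding f_def prod.distrib
    by (subst (2) euclidean_inner)
      (simp add: norm_sq cis_sum exp_sum[symmetric] sum_distrib_left sum_negf[symmetric]
        sum_divide_distrib of_real_prod[symmetric])
  moreover have "(\<Prod>b\<in>Basis. integral\<^sup>L lborel (f b)) =
      complex_of_real (sqrt (2 * pi / \<delta>) ^ DIM('a) * exp (- (norm z)\<^sup>2 / (2 * \<delta>)))"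
    by (simp add: f prod.distrib norm_sq of_real_prod[symmetric] exp_sum[symmetric]
        sum_negf[symmetric] sum_divide_distrib)
  ultimately show ?thesis
    using lborel_prod_Basis[of f] f(1) by (simp add: has_bochner_integral_iff)
qed

lemma gaussian_integral:
  assumes "\<delta> > 0"
  shows "has_bochner_integral lborel (\<lambda>x::'a::euclidean_space. exp (- \<delta> * (norm x)\<^sup>2 / 2))
           (sqrt (2 * pi / \<delta>) ^ DIM('a))"
proof -
  have "has_bochner_integral lborel
     (\<lambda>x::'a. Re (complex_of_real (exp (- \<delta> * (norm x)\<^sup>2 / 2)) * cis (x \<bullet> 0)))
     (Re (complex_of_real (sqrt (2 * pi / \<delta>) ^ DIM('a) * exp (- (norm (0::'a))\<^sup>2 / (2 * \<delta>)))))"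
    by (rule has_bochner_integral_bounded_linear[OF bounded_linear_Re gaussian_fourier[OF assms]])
  then show ?thesis
    by (simp del: of_real_mult of_real_power)
qed

section \<open>Measurability, products and translations under the integral\<close>

lemma borel_measurable_cis [measurable (raw)]:
  "f \<in> borel_measurable M \<Longrightarrow> (\<lambda>x. cis (f x)) \<in> borel_measurable M"
  unfolding cis_conv_exp by measurable

lemma borel_measurable_cnj [measurable (raw)]:
  "f \<in> borel_measurable M \<Longrightarrow> (\<lambda>x. cnj (f x)) \<in> borel_measurable M"
  by (simp add: borel_measurable_complex_iff)

text \<open>Such products dominate the integrands in the Fubini arguments below, which differ from
  them only by factors of modulus 1.\<close>

lemma integrable_tensor:
  fixes f :: "'a \<Rightarrow> complex" and g :: "'b \<Rightarrow> complex"
  assumes "sigma_finite_measure M" "sigma_finite_measure N" "integrable M f" "integrable N g"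
  shows "integrable (M \<Otimes>\<^sub>M N) (\<lambda>p. f (fst p) * g (snd p))"
    and "(\<integral>p. f (fst p) * g (snd p) \<partial>(M \<Otimes>\<^sub>M N)) = integral\<^sup>L M f * integral\<^sup>L N g"
proof -
  interpret M: sigma_finite_measure M by fact
  interpret N: sigma_finite_measure N by fact
  interpret P: pair_sigma_finite M N ..
  have [measurable]: "f \<in> borel_measurable M" "g \<in> borel_measurable N"
    using assms by auto
  show *: "integrable (M \<Otimes>\<^sub>M N) (\<lambda>p. f (fst p) * g (snd p))"
    by (rule P.Fubini_integrable) (use assms in \<open>auto simp: norm_mult\<close>)
  show "(\<integral>p. f (fst p) * g (snd p) \<partial>(M \<Otimes>\<^sub>M N)) = integral\<^sup>L M f * integral\<^sup>L N g"
    by (subst P.integral_fst'[OF *, symmetric]) simp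
qed

lemma nn_integral_lborel_shift:
  fixes f :: "'a::euclidean_space \<Rightarrow> ennreal"
  assumes [measurable]: "f \<in> borel_measurable borel"
  shows "(\<integral>\<^sup>+x. f (c + x) \<partial>lborel) = (\<integral>\<^sup>+x. f x \<partial>lborel)"
  by (subst (2) lborel_distr_plus[of c, symmetric]) (simp add: nn_integral_distr)

lemma nn_integral_lborel_uminus:
  fixes f :: "'a::euclidean_space \<Rightarrow> ennreal"
  assumes [measurable]: "f \<in> borel_measurable borel"
  shows "(\<integral>\<^sup>+x. f (- x) \<partial>lborel) = (\<integral>\<^sup>+x. f x \<partial>lborel)"
  by (subst (2) lborel_affine[of "-1" 0]) (simp_all add: nn_integral_density nn_integral_distr)

lemma gaussian_nn_integral:
  assumes "\<delta> > 0"
  shows "(\<integral>\<^sup>+x. ennreal (exp (- \<delta> * (norm (x::'a::euclidean_space))\<^sup>2 / 2)) \<partial>lborel)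
           = ennreal (sqrt (2 * pi / \<delta>) ^ DIM('a))"
  using gaussian_integral[OF assms, where 'a='a]
  by (subst nn_integral_eq_integral) (auto simp: has_bochner_integral_iff)

text \<open>
  The Gaussian weight makes all integrals absolutely convergent; its width cancels in the bound,
  which follows by expanding the square and applying Schur's test to the resulting Gaussian kernel.
\<close>

lemma bessel_gaussian:
  fixes F :: "'a::euclidean_space \<Rightarrow> complex" and T :: "'a \<Rightarrow> 'a"
  assumes F: "integrable lborel F" and T[measurable]: "T \<in> borel_measurable borel"
    and dist: "\<And>x y. norm (T x - T y) = r * norm (x - y)" and r: "r > 0" and \<delta>: "\<delta> > 0"
  shows "(\<integral>\<^sup>+v. ennreal (exp (- \<delta> * (norm v)\<^sup>2 / 2) * (cmod (\<integral>x. F x * cis (v \<bullet> T x) \<partial>lborel))\<^sup>2) \<partial>lborel)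
    \<le> ennreal ((2 * pi / r) ^ DIM('a)) * (\<integral>\<^sup>+x. ennreal ((cmod (F x))\<^sup>2) \<partial>lborel)"
proof -
  have [measurable]: "F \<in> borel_measurable borel"
    using F by auto
  define G where "G = (\<lambda>v::'a. complex_of_real (exp (- \<delta> * (norm v)\<^sup>2 / 2)))"
  \<comment> \<open>Integrated over the pair first, \<open>\<Phi>\<close> gives the weighted square
    in the claim. Integrated over \<open>v\<close> first, it gives a Gaussian in
    \<open>T (fst p) - T (snd p)\<close>, and \<open>dist\<close> makes this a Gaussian in the
    distance of the two points.\<close>
  define \<Phi> where "\<Phi> = (\<lambda>(v::'a) (p::'a \<times> 'a). G v * (F (fst p) * cnj (F (snd p)) *
      cis (v \<bullet> (T (fst p) - T (snd p)))))"
  define c where "c = sqrt (2 * pi / \<delta>) ^ DIM('a)"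
  define A where "A = (\<lambda>v. \<integral>x. F x * cis (v \<bullet> T x) \<partial>lborel)"
  let ?L = "lborel :: 'a measure"
  have sf: "sigma_finite_measure (?L \<Otimes>\<^sub>M ?L)"
    by (simp add: lborel_prod lborel.sigma_finite_measure_axioms)
  interpret Q: pair_sigma_finite ?L "?L \<Otimes>\<^sub>M ?L"
    by (intro pair_sigma_finite.intro sf) (rule lborel.sigma_finite_measure_axioms)
  have G: "integrable ?L G"
    using gaussian_integral[OF \<delta>, where 'a='a]
    unfolding G_def by (intro integrable_of_real) (auto simp: has_bochner_integral_iff)
  have cF: "integrable ?L (\<lambda>x. cnj (F x))"
    using F by simp
  have FF: "integrable (?L \<Otimes>\<^sub>M ?L) (\<lambda>p. F (fst p) * cnj (F (snd p)))"
    by (rule integrable_tensor) (use F cF in \<open>auto intro: lborel.sigma_finite_measure_axioms\<close>)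
  have [measurable]: "case_prod \<Phi> \<in> borel_measurable (?L \<Otimes>\<^sub>M (?L \<Otimes>\<^sub>M ?L))"
    unfolding \<Phi>_def G_def split_beta by measurable
  have \<Phi>: "integrable (?L \<Otimes>\<^sub>M (?L \<Otimes>\<^sub>M ?L)) (case_prod \<Phi>)"
  proof (rule Bochner_Integration.integrable_bound)
    show "integrable (?L \<Otimes>\<^sub>M (?L \<Otimes>\<^sub>M ?L)) (\<lambda>q. G (fst q) * (F (fst (snd q)) * cnj (F (snd (snd q)))))"
      by (rule integrable_tensor(1)[OF lborel.sigma_finite_measure_axioms sf G FF])
  qed (measurable, simp add: \<Phi>_def norm_mult split_beta)
  have shiftF: "integrable ?L (\<lambda>x. F x * cis (v \<bullet> T x))" for v
    by (rule Bochner_Integration.integrable_bound[OF F]) (auto simp: norm_mult)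
  have shiftF': "integrable ?L (\<lambda>x. cnj (F x * cis (v \<bullet> T x)))" for v
    using shiftF[of v] by (subst complex_integrable_cnj)
  have inner: "(\<integral>p. \<Phi> v p \<partial>(?L \<Otimes>\<^sub>M ?L)) = complex_of_real (exp (- \<delta> * (norm v)\<^sup>2 / 2) * (cmod (A v))\<^sup>2)" for v
  proof -
    have "\<Phi> v p = G v * ((F (fst p) * cis (v \<bullet> T (fst p))) * cnj (F (snd p) * cis (v \<bullet> T (snd p))))" for p
    proof -
      have "cis (v \<bullet> (T (fst p) - T (snd p))) = cis (v \<bullet> T (fst p)) * cnj (cis (v \<bullet> T (snd p)))"
        by (simp add: inner_diff_right cis_cnj cis_mult)
      then show ?thesis
        by (simp only: \<Phi>_def complex_cnj_mult mult_ac)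
    qed
    then have "(\<integral>p. \<Phi> v p \<partial>(?L \<Otimes>\<^sub>M ?L)) = G v * (A v * (\<integral>x. cnj (F x * cis (v \<bullet> T x)) \<partial>?L))"
      using integrable_tensor(2)[OF lborel.sigma_finite_measure_axioms lborel.sigma_finite_measure_axioms
          shiftF[of v] shiftF'[of v]]
      by (simp add: A_def del: complex_cnj_mult)
    also have "(\<integral>x. cnj (F x * cis (v \<bullet> T x)) \<partial>?L) = cnj (A v)"
      unfolding A_def by (rule integral_bounded_linear[OF bounded_linear_cnj shiftF])
    finally show ?thesis
      by (simp add: G_def complex_norm_square[symmetric])
  qed
  have int_v: "integrable ?L (\<lambda>v. exp (- \<delta> * (norm v)\<^sup>2 / 2) * (cmod (A v))\<^sup>2)"
    using Q.integrable_fst'[OF \<Phi>]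
    by (simp only: prod.case inner complex_of_real_integrable_eq)
  have gauss: "(\<integral>v. \<Phi> v p \<partial>?L) = c * exp (- (r * norm (fst p - snd p))\<^sup>2 / (2 * \<delta>)) * (F (fst p) * cnj (F (snd p)))" for p
  proof -
    have "(\<integral>v. \<Phi> v p \<partial>?L) = (\<integral>v. (G v * cis (v \<bullet> (T (fst p) - T (snd p)))) * (F (fst p) * cnj (F (snd p))) \<partial>?L)"
      unfolding \<Phi>_def by (simp add: mult_ac)
    also have "\<dots> = (\<integral>v. (G v * cis (v \<bullet> (T (fst p) - T (snd p)))) \<partial>?L) * (F (fst p) * cnj (F (snd p)))"
      by simp
    finally show ?thesis
      using gaussian_fourier[OF \<delta>, of "T (fst p) - T (snd p)"]
      by (simp add: G_def c_def has_bochner_integral_iff dist)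
  qed
  define K where "K = (\<lambda>x y. exp (- (r\<^sup>2 / \<delta>) * (norm (y - x :: 'a))\<^sup>2 / 2))"
  have K0: "0 \<le> K x y" for x y
    by (simp add: K_def)
  have c0: "0 \<le> c"
    using \<delta> by (simp add: c_def)
  have Ky: "(\<integral>\<^sup>+y. ennreal (K x y) \<partial>?L) = ennreal (sqrt (2 * pi * \<delta> / r\<^sup>2) ^ DIM('a))" for x
  proof -
    have "(\<integral>\<^sup>+y. ennreal (K x y) \<partial>?L) = (\<integral>\<^sup>+y. ennreal (K x (x + y)) \<partial>?L)"
      by (rule nn_integral_lborel_shift[symmetric]) (simp add: K_def)
    also have "\<dots> = ennreal (sqrt (2 * pi / (r\<^sup>2 / \<delta>)) ^ DIM('a))"
      unfolding K_def using r \<delta> by (subst gaussian_nn_integral[symmetric]) auto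
    finally show ?thesis
      by simp
  qed
  have K_comm: "K x y = K y x" for x y
    by (simp add: K_def norm_minus_commute)
  have [measurable]: "(\<lambda>p. K (fst p) (snd p)) \<in> borel_measurable (?L \<Otimes>\<^sub>M ?L)"
    unfolding K_def by measurable
  let ?N = "\<integral>\<^sup>+x. ennreal ((cmod (F x))\<^sup>2) \<partial>lborel"
  let ?k = "ennreal (sqrt (2 * pi * \<delta> / r\<^sup>2) ^ DIM('a))"
  have half1: "(\<integral>\<^sup>+p. ennreal (K (fst p) (snd p) * (cmod (F (fst p)))\<^sup>2) \<partial>(?L \<Otimes>\<^sub>M ?L)) = ?k * ?N"
  proof -
    have "(\<integral>\<^sup>+p. ennreal (K (fst p) (snd p) * (cmod (F (fst p)))\<^sup>2) \<partial>(?L \<Otimes>\<^sub>M ?L))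
        = (\<integral>\<^sup>+x. \<integral>\<^sup>+y. ennreal (K x y) * ennreal ((cmod (F x))\<^sup>2) \<partial>?L \<partial>?L)"
      by (subst lborel.nn_integral_fst[symmetric]) (simp_all add: ennreal_mult K0)
    also have "\<dots> = (\<integral>\<^sup>+x. ?k * ennreal ((cmod (F x))\<^sup>2) \<partial>?L)"
      by (intro nn_integral_cong, subst nn_integral_multc) (simp_all add: Ky, simp add: K_def)
    finally show ?thesis
      by (simp add: nn_integral_cmult)
  qed
  have half2: "(\<integral>\<^sup>+p. ennreal (K (fst p) (snd p) * (cmod (F (snd p)))\<^sup>2) \<partial>(?L \<Otimes>\<^sub>M ?L)) = ?k * ?N"
  proof -
    have "(\<integral>\<^sup>+p. ennreal (K (fst p) (snd p) * (cmod (F (snd p)))\<^sup>2) \<partial>(?L \<Otimes>\<^sub>M ?L))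
        = (\<integral>\<^sup>+y. \<integral>\<^sup>+x. ennreal (K y x) * ennreal ((cmod (F y))\<^sup>2) \<partial>?L \<partial>?L)"
      by (subst lborel_pair.nn_integral_snd[symmetric])
        (auto intro!: nn_integral_cong simp: ennreal_mult K0 intro: arg_cong2[OF K_comm refl, of "\<lambda>a b. ennreal a * b"])
    also have "\<dots> = (\<integral>\<^sup>+x. ?k * ennreal ((cmod (F x))\<^sup>2) \<partial>?L)"
      by (intro nn_integral_cong, subst nn_integral_multc) (simp_all add: Ky, simp add: K_def)
    finally show ?thesis
      by (simp add: nn_integral_cmult)
  qed
  have "ennreal (\<integral>v. exp (- \<delta> * (norm v)\<^sup>2 / 2) * (cmod (A v))\<^sup>2 \<partial>?L)
      \<le> ennreal (cmod (\<integral>v. (\<integral>p. \<Phi> v p \<partial>(?L \<Otimes>\<^sub>M ?L)) \<partial>?L))"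
    unfolding inner integral_complex_of_real norm_of_real by (intro ennreal_leI) simp
  also have "(\<integral>v. (\<integral>p. \<Phi> v p \<partial>(?L \<Otimes>\<^sub>M ?L)) \<partial>?L) = (\<integral>p. (\<integral>v. \<Phi> v p \<partial>?L) \<partial>(?L \<Otimes>\<^sub>M ?L))"
    by (rule Q.Fubini_integral[symmetric, OF \<Phi>])
  also have "ennreal (cmod \<dots>) \<le> (\<integral>\<^sup>+p. ennreal (cmod (\<integral>v. \<Phi> v p \<partial>?L)) \<partial>(?L \<Otimes>\<^sub>M ?L))"
    by (rule integral_norm_bound_ennreal) (use Q.integrable_snd[OF \<Phi>] in simp)
  also have "\<dots> \<le> (\<integral>\<^sup>+p. ennreal (c / 2) * (ennreal (K (fst p) (snd p) * (cmod (F (fst p)))\<^sup>2)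
      + ennreal (K (fst p) (snd p) * (cmod (F (snd p)))\<^sup>2)) \<partial>(?L \<Otimes>\<^sub>M ?L))"
  proof (rule nn_integral_mono)
    fix p :: "'a \<times> 'a"
    have "cmod (\<integral>v. \<Phi> v p \<partial>?L) = c * K (fst p) (snd p) * (cmod (F (fst p)) * cmod (F (snd p)))"
      unfolding gauss by (simp add: norm_mult c0 K_def norm_minus_commute power_mult_distrib)
    \<comment> \<open>The inequality of the arithmetic and geometric mean leaves the square of
      \<open>F\<close> in one variable at a time, so the other variable is integrated against the
      kernel \<open>K\<close> alone. By symmetry of \<open>K\<close> both halves are equal.\<close>
    also have "\<dots> \<le> c * K (fst p) (snd p) * (((cmod (F (fst p)))\<^sup>2 + (cmod (F (snd p)))\<^sup>2) / 2)"
    proof (rule mult_left_mono)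
      show "cmod (F (fst p)) * cmod (F (snd p)) \<le> ((cmod (F (fst p)))\<^sup>2 + (cmod (F (snd p)))\<^sup>2) / 2"
        using sum_squares_bound[of "cmod (F (fst p))" "cmod (F (snd p))"] by simp
    qed (simp add: c0 K0)
    also have "\<dots> = (c / 2) * (K (fst p) (snd p) * (cmod (F (fst p)))\<^sup>2 + K (fst p) (snd p) * (cmod (F (snd p)))\<^sup>2)"
      by (simp add: field_simps)
    finally have "cmod (\<integral>v. \<Phi> v p \<partial>?L) \<le> \<dots>" .
    then show "ennreal (cmod (\<integral>v. \<Phi> v p \<partial>?L)) \<le> ennreal (c / 2) * (ennreal (K (fst p) (snd p) * (cmod (F (fst p)))\<^sup>2)
      + ennreal (K (fst p) (snd p) * (cmod (F (snd p)))\<^sup>2))"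
      by (simp add: ennreal_mult[symmetric] ennreal_plus[symmetric] c0 K0 ennreal_leI del: ennreal_plus)
  qed
  also have "\<dots> = ennreal (c / 2) * (?k * ?N + ?k * ?N)"
    by (simp add: nn_integral_cmult nn_integral_add half1 half2)
  also have "\<dots> = ennreal (c * sqrt (2 * pi * \<delta> / r\<^sup>2) ^ DIM('a)) * ?N"
  proof -
    have "ennreal (c / 2) * (?k * ?N + ?k * ?N) = (ennreal (c / 2) * ?k + ennreal (c / 2) * ?k) * ?N"
      by (simp add: algebra_simps)
    also have "ennreal (c / 2) * ?k + ennreal (c / 2) * ?k = ennreal (c * sqrt (2 * pi * \<delta> / r\<^sup>2) ^ DIM('a))"
      using c0 \<delta> by (simp add: ennreal_mult[symmetric] ennreal_plus[symmetric] del: ennreal_plus)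
    finally show ?thesis .
  qed
  \<comment> \<open>The factor \<open>c\<close> carries the power -n/2 of \<open>\<delta>\<close>
    and the integral of the kernel the power n/2, where n is the dimension; this is how the width
    cancels.\<close>
  also have "c * sqrt (2 * pi * \<delta> / r\<^sup>2) ^ DIM('a) = (2 * pi / r) ^ DIM('a)"
    unfolding c_def power_mult_distrib[symmetric] real_sqrt_mult[symmetric]
    using r \<delta> by (simp add: real_sqrt_divide real_sqrt_mult power2_eq_square[symmetric])
  finally show ?thesis
    using int_v by (subst nn_integral_eq_integral) (auto simp: A_def)
qed

section \<open>Fourier inversion by Gaussian smoothing\<close>

lemma integral_lborel_scale:
  fixes f :: "'a::euclidean_space \<Rightarrow> real"
  assumes [measurable]: "f \<in> borel_measurable borel" and "r > 0"
  shows "(\<integral>x. f x \<partial>lborel) = r ^ DIM('a) * (\<integral>x. f (w + r *\<^sub>R x) \<partial>lborel)"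
  using assms(2)
  by (subst lborel_affine[of r w]) (simp_all add: integral_density integral_distr)

text \<open>The Gaussian damping makes the double integral absolutely convergent, so Fubini applies.
  Integrating over \<open>\<xi>\<close> first leaves the average of \<open>b\<close> against a
  Gaussian of width \<open>r\<close> centred at \<open>w\<close>, and the substitution
  \<open>z = w + r *\<^sub>R u\<close> brings it to standard width.\<close>

lemma gaussian_smoothing:
  fixes b :: "'a::euclidean_space \<Rightarrow> real"
  assumes b: "integrable lborel b" and r: "r > 0"
  shows "(\<integral>\<xi>. complex_of_real (exp (- r\<^sup>2 * (norm \<xi>)\<^sup>2 / 2)) * cis (- (\<xi> \<bullet> w)) *
             (\<integral>z. b z * cis (\<xi> \<bullet> z) \<partial>lborel) \<partial>lborel)
       = complex_of_real (sqrt (2 * pi) ^ DIM('a) * (\<integral>u. b (w + r *\<^sub>R u) * exp (- (norm u)\<^sup>2 / 2) \<partial>lborel))"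
    and "integrable lborel (\<lambda>\<xi>. complex_of_real (exp (- r\<^sup>2 * (norm \<xi>)\<^sup>2 / 2)) * cis (- (\<xi> \<bullet> w)) *
             (\<integral>z. b z * cis (\<xi> \<bullet> z) \<partial>lborel))"
proof -
  have [measurable]: "b \<in> borel_measurable borel"
    using b by auto
  have r2: "r\<^sup>2 > 0"
    using r by simp
  define G where "G = (\<lambda>\<xi>::'a. complex_of_real (exp (- r\<^sup>2 * (norm \<xi>)\<^sup>2 / 2)))"
  define \<Phi> where "\<Phi> = (\<lambda>\<xi> z. G \<xi> * cis (\<xi> \<bullet> (z - w)) * complex_of_real (b z))"
  have G: "integrable lborel G"
    using gaussian_integral[OF r2, where 'a='a]
    unfolding G_def by (intro integrable_of_real) (auto simp: has_bochner_integral_iff)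
  have cb: "integrable lborel (\<lambda>z. complex_of_real (b z))"
    using b by simp
  have [measurable]: "case_prod \<Phi> \<in> borel_measurable (lborel \<Otimes>\<^sub>M lborel)"
    unfolding \<Phi>_def G_def split_beta by measurable
  have \<Phi>: "integrable (lborel \<Otimes>\<^sub>M lborel) (case_prod \<Phi>)"
    by (rule Bochner_Integration.integrable_bound[OF integrable_tensor(1)[OF
          lborel.sigma_finite_measure_axioms lborel.sigma_finite_measure_axioms G cb]])
      (measurable, simp add: \<Phi>_def norm_mult split_beta)
  have inner: "(\<integral>z. \<Phi> \<xi> z \<partial>lborel) = G \<xi> * cis (- (\<xi> \<bullet> w)) * (\<integral>z. b z * cis (\<xi> \<bullet> z) \<partial>lborel)" for \<xi>
  proof -
    have "\<Phi> \<xi> z = (G \<xi> * cis (- (\<xi> \<bullet> w))) * (b z * cis (\<xi> \<bullet> z))" for z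
    proof -
      have "cis (\<xi> \<bullet> (z - w)) = cis (- (\<xi> \<bullet> w)) * cis (\<xi> \<bullet> z)"
        by (simp add: inner_diff_right cis_mult)
      then show ?thesis
        by (simp only: \<Phi>_def mult_ac)
    qed
    then show ?thesis
      by simp
  qed
  have gauss: "(\<integral>\<xi>. \<Phi> \<xi> z \<partial>lborel) = complex_of_real (sqrt (2 * pi / r\<^sup>2) ^ DIM('a) *
      (b z * exp (- (norm (z - w))\<^sup>2 / (2 * r\<^sup>2))))" for z
  proof -
    have "(\<integral>\<xi>. \<Phi> \<xi> z \<partial>lborel) = (\<integral>\<xi>. G \<xi> * cis (\<xi> \<bullet> (z - w)) \<partial>lborel) * complex_of_real (b z)"
      unfolding \<Phi>_def by simp
    also have "(\<integral>\<xi>. G \<xi> * cis (\<xi> \<bullet> (z - w)) \<partial>lborel) =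
        complex_of_real (sqrt (2 * pi / r\<^sup>2) ^ DIM('a) * exp (- (norm (z - w))\<^sup>2 / (2 * r\<^sup>2)))"
      unfolding G_def by (rule has_bochner_integral_integral_eq[OF gaussian_fourier[OF r2]])
    finally show ?thesis
      by simp
  qed
  show "integrable lborel (\<lambda>\<xi>. complex_of_real (exp (- r\<^sup>2 * (norm \<xi>)\<^sup>2 / 2)) * cis (- (\<xi> \<bullet> w)) *
             (\<integral>z. b z * cis (\<xi> \<bullet> z) \<partial>lborel))"
    using lborel_pair.integrable_fst'[OF \<Phi>] by (simp only: prod.case inner G_def)
  have "(\<integral>\<xi>. G \<xi> * cis (- (\<xi> \<bullet> w)) * (\<integral>z. b z * cis (\<xi> \<bullet> z) \<partial>lborel) \<partial>lborel)
      = (\<integral>z. (\<integral>\<xi>. \<Phi> \<xi> z \<partial>lborel) \<partial>lborel)"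
    unfolding inner[symmetric] by (rule lborel_pair.Fubini_integral[symmetric, OF \<Phi>])
  also have "\<dots> = complex_of_real (sqrt (2 * pi / r\<^sup>2) ^ DIM('a) *
      (\<integral>z. b z * exp (- (norm (z - w))\<^sup>2 / (2 * r\<^sup>2)) \<partial>lborel))"
    unfolding gauss integral_complex_of_real by simp
  also have "(\<integral>z. b z * exp (- (norm (z - w))\<^sup>2 / (2 * r\<^sup>2)) \<partial>lborel)
      = r ^ DIM('a) * (\<integral>u. b (w + r *\<^sub>R u) * exp (- (norm u)\<^sup>2 / 2) \<partial>lborel)"
    using r by (subst integral_lborel_scale[of _ r w]) (simp_all add: power_mult_distrib)
  also have "sqrt (2 * pi / r\<^sup>2) ^ DIM('a) * (r ^ DIM('a) * (\<integral>u. b (w + r *\<^sub>R u) * exp (- (norm u)\<^sup>2 / 2) \<partial>lborel))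
      = sqrt (2 * pi) ^ DIM('a) * (\<integral>u. b (w + r *\<^sub>R u) * exp (- (norm u)\<^sup>2 / 2) \<partial>lborel)"
    using r by (simp add: real_sqrt_divide power_divide)
  finally show "(\<integral>\<xi>. complex_of_real (exp (- r\<^sup>2 * (norm \<xi>)\<^sup>2 / 2)) * cis (- (\<xi> \<bullet> w)) *
             (\<integral>z. b z * cis (\<xi> \<bullet> z) \<partial>lborel) \<partial>lborel)
       = complex_of_real (sqrt (2 * pi) ^ DIM('a) * (\<integral>u. b (w + r *\<^sub>R u) * exp (- (norm u)\<^sup>2 / 2) \<partial>lborel))"
    by (simp only: G_def)
qed

text \<open>In this scaling the Gaussian is fixed and only the argument of \<open>b\<close> moves,
  so \<open>B\<close> times the Gaussian is a common integrable bound.\<close>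

lemma gaussian_smoothing_tendsto:
  fixes b :: "'a::euclidean_space \<Rightarrow> real"
  assumes [measurable]: "b \<in> borel_measurable borel" and bound: "\<And>z. \<bar>b z\<bar> \<le> B"
    and cont: "isCont b w" and r: "r \<longlonglongrightarrow> 0"
  shows "(\<lambda>n. \<integral>u. b (w + r n *\<^sub>R u) * exp (- (norm u)\<^sup>2 / 2) \<partial>lborel)
           \<longlonglongrightarrow> b w * sqrt (2 * pi) ^ DIM('a)"
proof -
  have g: "has_bochner_integral lborel (\<lambda>u::'a. exp (- (norm u)\<^sup>2 / 2)) (sqrt (2 * pi) ^ DIM('a))"
    using gaussian_integral[of 1, where 'a='a] by simp
  have "(\<lambda>n. \<integral>u. b (w + r n *\<^sub>R u) * exp (- (norm u)\<^sup>2 / 2) \<partial>lborel)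
      \<longlonglongrightarrow> (\<integral>u. b w * exp (- (norm (u::'a))\<^sup>2 / 2) \<partial>lborel)"
  proof (rule integral_dominated_convergence[where w="\<lambda>u. B * exp (- (norm u)\<^sup>2 / 2)"])
    show "integrable lborel (\<lambda>u::'a. B * exp (- (norm u)\<^sup>2 / 2))"
      using g by (auto simp: has_bochner_integral_iff)
    show "AE u in lborel. (\<lambda>n. b (w + r n *\<^sub>R u) * exp (- (norm u)\<^sup>2 / 2))
        \<longlonglongrightarrow> b w * exp (- (norm (u::'a))\<^sup>2 / 2)"
    proof (intro AE_I2 tendsto_mult tendsto_const)
      fix u :: 'a
      have "(\<lambda>n. w + r n *\<^sub>R u) \<longlonglongrightarrow> w + 0 *\<^sub>R u"
        by (intro tendsto_intros r)
      then show "(\<lambda>n. b (w + r n *\<^sub>R u)) \<longlonglongrightarrow> b w"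
        using isCont_tendsto_compose[OF cont] by simp
    qed
  qed (auto simp: abs_mult bound mult_right_mono)
  then show ?thesis
    using g by (simp add: has_bochner_integral_iff)
qed

text \<open>Taking the second difference in direction \<open>s\<close> multiplies the Fourier
  transform by \<open>2 * cos (\<xi> \<bullet> s) - 2\<close>, whose absolute value is at most the
  square of \<open>\<xi> \<bullet> s\<close>. The constant \<open>K\<close> bounds the damped
  integrals uniformly in the damping, so the estimate survives the limit in the smoothed inversion
  formula.\<close>

lemma second_difference_fourier:
  fixes b :: "'a::euclidean_space \<Rightarrow> real"
  assumes b: "integrable lborel b" and bound: "\<And>z. \<bar>b z\<bar> \<le> B" and cont: "\<And>z. isCont b z"
    and K: "0 \<le> K" "\<And>\<delta>. \<delta> > 0 \<Longrightarrow> (\<integral>\<^sup>+\<xi>. ennreal (exp (- \<delta> * (norm \<xi>)\<^sup>2 / 2) *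
         ((\<xi> \<bullet> s)\<^sup>2 * cmod (\<integral>z. b z * cis (\<xi> \<bullet> z) \<partial>lborel))) \<partial>lborel) \<le> ennreal K"
  shows "\<bar>b s + b (- s) - 2 * b 0\<bar> \<le> K / (2 * pi) ^ DIM('a)"
proof -
  have [measurable]: "b \<in> borel_measurable borel"
    using b by auto
  define q where "q = (\<lambda>n w. sqrt (2 * pi) ^ DIM('a) *
      (\<integral>u. b (w + (1 / Suc n) *\<^sub>R u) * exp (- (norm u)\<^sup>2 / 2) \<partial>lborel))"
  have lim: "(\<lambda>n. q n w) \<longlonglongrightarrow> sqrt (2 * pi) ^ DIM('a) * (b w * sqrt (2 * pi) ^ DIM('a))" for w
    unfolding q_def
    by (intro tendsto_intros gaussian_smoothing_tendsto[where B=B] bound cont LIMSEQ_Suc[OF lim_1_over_n]) simp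
  \<comment> \<open>One factor stems from the damped inversion formula, the other from the total
    mass of the Gaussian; together they form the usual inversion constant.\<close>
  have pi2: "sqrt (2 * pi) ^ DIM('a) * (y * sqrt (2 * pi) ^ DIM('a)) = (2 * pi) ^ DIM('a) * y" for y
  proof -
    have "sqrt (2 * pi) ^ DIM('a) * sqrt (2 * pi) ^ DIM('a) = (2 * pi) ^ DIM('a)"
      by (simp only: power_mult_distrib[symmetric] real_sqrt_mult_self) simp
    moreover have "a * (y * a) = (a * a) * y" for a :: real
      by simp
    ultimately show ?thesis
      by simp
  qed
  have *: "\<bar>q n s + q n (- s) - 2 * q n 0\<bar> \<le> K" for n
  proof -
    define r where "r = 1 / real (Suc n)"
    have r: "r > 0" "r\<^sup>2 > 0"
      by (auto simp: r_def)
    define bh where "bh = (\<lambda>\<xi>. \<integral>z. b z * cis (\<xi> \<bullet> z) \<partial>lborel)"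
    define I where "I = (\<lambda>w \<xi>. complex_of_real (exp (- r\<^sup>2 * (norm \<xi>)\<^sup>2 / 2)) * cis (- (\<xi> \<bullet> w)) * bh \<xi>)"
    have q: "complex_of_real (q n w) = integral\<^sup>L lborel (I w)" and int: "integrable lborel (I w)" for w
      using gaussian_smoothing[OF b r(1), of w] by (auto simp: q_def I_def bh_def r_def)
    have "complex_of_real (q n s + q n (- s) - 2 * q n 0)
        = (\<integral>\<xi>. I s \<xi> + I (- s) \<xi> - 2 * I 0 \<xi> \<partial>lborel)"
      using int by (simp add: q)
    moreover have "integrable lborel (\<lambda>\<xi>. I s \<xi> + I (- s) \<xi> - 2 * I 0 \<xi>)"
      using int by simp
    ultimately have "ennreal (cmod (complex_of_real (q n s + q n (- s) - 2 * q n 0)))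
        \<le> (\<integral>\<^sup>+\<xi>. ennreal (cmod (I s \<xi> + I (- s) \<xi> - 2 * I 0 \<xi>)) \<partial>lborel)"
      using integral_norm_bound_ennreal[of lborel "\<lambda>\<xi>. I s \<xi> + I (- s) \<xi> - 2 * I 0 \<xi>"] by simp
    also have "\<dots> \<le> (\<integral>\<^sup>+\<xi>. ennreal (exp (- r\<^sup>2 * (norm \<xi>)\<^sup>2 / 2) * ((\<xi> \<bullet> s)\<^sup>2 * cmod (bh \<xi>))) \<partial>lborel)"
    proof (intro nn_integral_mono ennreal_leI)
      fix \<xi> :: 'a
      define t where "t = \<xi> \<bullet> s"
      have "cis (- t) + cis t - 2 = complex_of_real (2 * cos t - 2)"
        by (simp add: complex_eq_iff)
      moreover have "I s \<xi> + I (- s) \<xi> - 2 * I 0 \<xi>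
          = complex_of_real (exp (- r\<^sup>2 * (norm \<xi>)\<^sup>2 / 2)) * (cis (- t) + cis t - 2) * bh \<xi>"
        unfolding I_def t_def by (simp only: inner_minus_right inner_zero_right minus_minus minus_zero cis_zero) (simp only: ring_distribs mult_1_right mult_1_left mult_ac)
      ultimately have "cmod (I s \<xi> + I (- s) \<xi> - 2 * I 0 \<xi>)
          = exp (- r\<^sup>2 * (norm \<xi>)\<^sup>2 / 2) * (\<bar>2 * cos t - 2\<bar> * cmod (bh \<xi>))"
        by (simp only: norm_mult norm_of_real) simp
      also have "\<bar>2 * cos t - 2\<bar> \<le> t\<^sup>2"
      proof -
        have "\<bar>2 * cos t - 2\<bar> = 4 * (sin (t / 2))\<^sup>2"
          using cos_double_sin[of "t / 2"] by (simp add: abs_if)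
        also have "(sin (t / 2))\<^sup>2 \<le> (t / 2)\<^sup>2"
          using abs_sin_x_le_abs_x[of "t / 2"] by (simp only: abs_le_square_iff)
        finally show ?thesis
          by (simp add: power_divide)
      qed
      finally show "cmod (I s \<xi> + I (- s) \<xi> - 2 * I 0 \<xi>)
          \<le> exp (- r\<^sup>2 * (norm \<xi>)\<^sup>2 / 2) * ((\<xi> \<bullet> s)\<^sup>2 * cmod (bh \<xi>))"
        by (simp add: t_def mult_right_mono)
    qed
    also have "\<dots> \<le> ennreal K"
      unfolding bh_def by (rule K(2)[OF r(2)])
    finally show ?thesis
      using K(1) by (simp only: norm_of_real ennreal_le_iff)
  qed
  have "(\<lambda>n. \<bar>q n s + q n (- s) - 2 * q n 0\<bar>) \<longlonglongrightarrow>
      \<bar>(2 * pi) ^ DIM('a) * b s + (2 * pi) ^ DIM('a) * b (- s) - 2 * ((2 * pi) ^ DIM('a) * b 0)\<bar>"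
    using lim[of s] lim[of "- s"] lim[of 0] unfolding pi2 by (intro tendsto_intros)
  then have "\<bar>(2 * pi) ^ DIM('a) * b s + (2 * pi) ^ DIM('a) * b (- s) - 2 * ((2 * pi) ^ DIM('a) * b 0)\<bar> \<le> K"
    using * by (intro LIMSEQ_le_const2) auto
  also have "(2 * pi) ^ DIM('a) * b s + (2 * pi) ^ DIM('a) * b (- s) - 2 * ((2 * pi) ^ DIM('a) * b 0)
      = (2 * pi) ^ DIM('a) * (b s + b (- s) - 2 * b 0)"
    by (simp add: algebra_simps)
  finally have "\<bar>(2 * pi) ^ DIM('a) * (b s + b (- s) - 2 * b 0)\<bar> \<le> K" .
  moreover have "\<bar>y\<bar> \<le> K / p" if "\<bar>p * y\<bar> \<le> K" "p > 0" for p y :: real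
    using that by (simp add: abs_mult pos_le_divide_eq mult.commute)
  ultimately show ?thesis
    by simp
qed

text \<open>By outer regularity of \<open>E\<close> and of its complement, \<open>E\<close> lies in
  an open \<open>U\<close> and contains the compact set \<open>- V\<close>, both up to small
  measure. A short translation keeps \<open>- V\<close> inside \<open>U\<close>. So a point of
  \<open>E\<close> that leaves \<open>E\<close> either lies in the small set
  \<open>V - (- E)\<close> or lands in the small set \<open>U - E\<close>.\<close>

lemma bounded_set_translate_small:
  fixes E :: "'a::euclidean_space set"
  assumes E: "E \<in> sets borel" "bounded E" and e: "e > 0"
  obtains d where "d > 0" "\<And>h. norm h < d \<Longrightarrow> emeasure lborel {x \<in> E. x + h \<notin> E} < ennreal e"
proof -
  have [measurable]: "E \<in> sets borel"
    by fact
  obtain U where U: "open U" "E \<subseteq> U" "emeasure lborel (U - E) < ennreal (e / 2)"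
    using outer_regular_lborel[OF E(1), of "e / 2"] e by auto
  obtain V where V: "open V" "- E \<subseteq> V" "emeasure lborel (V - (- E)) < ennreal (e / 2)"
    using outer_regular_lborel[of "- E" "e / 2"] E(1) e by auto
  have [measurable]: "U \<in> sets borel" "V \<in> sets borel"
    using U(1) V(1) by auto
  have "compact (- V)"
    unfolding compact_eq_bounded_closed using V(1,2) by (auto intro!: bounded_subset[OF E(2)])
  moreover have "- V \<subseteq> U"
    using U(2) V(2) by auto
  ultimately obtain d where d: "d > 0" "(\<Union>x\<in>- V. ball x d) \<subseteq> U"
    by (metis compact_subset_open_imp_ball_epsilon_subset U(1))
  have "emeasure lborel {x \<in> E. x + h \<notin> E} < ennreal e" if h: "norm h < d" for h
  proof -
    have "{x \<in> E. x + h \<notin> E} \<subseteq> (V - (- E)) \<union> {x. h + x \<in> U - E}"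
    proof
      fix x assume x: "x \<in> {x \<in> E. x + h \<notin> E}"
      have "x + h \<in> ball x d"
        using h by (simp add: dist_norm)
      then have "x \<in> V \<or> x + h \<in> U"
        using d(2) by blast
      then show "x \<in> (V - (- E)) \<union> {x. h + x \<in> U - E}"
        using x by (auto simp: add.commute)
    qed
    then have "emeasure lborel {x \<in> E. x + h \<notin> E} \<le> emeasure lborel ((V - (- E)) \<union> {x. h + x \<in> U - E})"
      by (rule emeasure_mono) auto
    also have "\<dots> \<le> emeasure lborel (V - (- E)) + emeasure lborel {x. h + x \<in> U - E}"
      by (rule emeasure_subadditive) auto
    also have "emeasure lborel {x. h + x \<in> U - E} = emeasure lborel (U - E)"
    proof -
      have "emeasure lborel {x. h + x \<in> U - E} = (\<integral>\<^sup>+x. indicator (U - E) (h + x) \<partial>lborel)"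
        by (subst nn_integral_indicator[symmetric]) (measurable, rule nn_integral_cong, simp only: indicator_def mem_Collect_eq)
      then show ?thesis
        by (subst (asm) nn_integral_lborel_shift) auto
    qed
    also have "emeasure lborel (V - (- E)) + emeasure lborel (U - E) < ennreal (e / 2) + ennreal (e / 2)"
      by (rule add_strict_mono[OF V(3) U(3)])
    also have "\<dots> = ennreal e"
      using e by (simp add: ennreal_plus[symmetric] del: ennreal_plus)
    finally show ?thesis .
  qed
  then show ?thesis
    using that d(1) by blast
qed

section \<open>Fourier transform in the last coordinate\<close>

definition partial_fourier :: "('a::euclidean_space \<times> 'b::euclidean_space \<Rightarrow> real) \<Rightarrow> 'a \<Rightarrow> 'b \<Rightarrow> complex" where
  "partial_fourier f v \<xi> = (\<integral>c. complex_of_real (f (v, c)) * cis (\<xi> \<bullet> c) \<partial>lborel)"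

lemma borel_measurable_partial_fourier [measurable]:
  fixes f :: "'a::euclidean_space \<times> 'b::euclidean_space \<Rightarrow> real"
  assumes [measurable]: "f \<in> borel_measurable borel"
  shows "(\<lambda>p. partial_fourier f (fst p) (snd p)) \<in> borel_measurable borel"
proof -
  have [measurable]: "f \<in> borel_measurable (borel \<Otimes>\<^sub>M borel)"
    by (simp add: borel_prod)
  have "(\<lambda>(p::'a \<times> 'b, c). complex_of_real (f (fst p, c)) * cis (snd p \<bullet> c))
      \<in> borel_measurable ((lborel \<Otimes>\<^sub>M lborel) \<Otimes>\<^sub>M lborel)"
    unfolding split_beta by measurable
  then have "(\<lambda>p::'a \<times> 'b. \<integral>c. complex_of_real (f (fst p, c)) * cis (snd p \<bullet> c) \<partial>lborel)
      \<in> borel_measurable (lborel \<Otimes>\<^sub>M lborel)"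
    by (rule lborel.borel_measurable_lebesgue_integral)
  then show ?thesis
    by (simp add: partial_fourier_def lborel_prod)
qed

lemma integrable_bounded_support:
  fixes f :: "'a::euclidean_space \<Rightarrow> 'b::{banach, second_countable_topology}"
  assumes [measurable]: "f \<in> borel_measurable borel" and "\<And>x. norm (f x) \<le> B"
    and "\<And>x. x \<notin> S \<Longrightarrow> f x = 0" and "bounded S"
  shows "integrable lborel f"
proof -
  obtain R where "\<And>x. x \<in> S \<Longrightarrow> norm x \<le> R"
    using assms(4) bounded_iff by metis
  then have R: "S \<subseteq> cball 0 R"
    by auto
  have "integrable lborel (indicator (cball 0 R) :: 'a \<Rightarrow> real)"
    using emeasure_bounded_finite[OF bounded_cball, of 0 R]
    by (intro integrable_real_indicator) auto
  then have "integrable lborel (\<lambda>x::'a. indicator (cball 0 R) x * B)"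
    by simp
  then show ?thesis
  proof (rule Bochner_Integration.integrable_bound)
    show "AE x in lborel. norm (f x) \<le> norm (indicator (cball 0 R) x * B)"
    proof (rule AE_I2)
      fix x :: 'a
      show "norm (f x) \<le> norm (indicator (cball 0 R) x * B)"
      proof (cases "x \<in> cball 0 R")
        case True
        then show ?thesis
          using order_trans[OF assms(2)[of x] abs_ge_self] by simp
      next
        case False
        then have "f x = 0"
          using R assms(3) by blast
        then show ?thesis
          by simp
      qed
    qed
  qed simp
qed

text \<open>For fixed \<open>v\<close> this is \<open>bessel_gaussian\<close> with \<open>T\<close>
  the identity and ratio 1; Tonelli then integrates over \<open>v\<close>. The second bound keeps
  the square integral, which is small for Alice's reduced set. The first, cruder bound serves for
  Bob's function.\<close>

lemma partial_fourier_bessel: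
  fixes f :: "'a::euclidean_space \<times> 'b::euclidean_space \<Rightarrow> real"
  assumes f[measurable]: "f \<in> borel_measurable borel" and bound: "\<And>x. \<bar>f x\<bar> \<le> 1"
    and supp: "\<And>x. x \<notin> cball 0 R \<Longrightarrow> f x = 0" and \<delta>: "\<delta> > 0"
  shows "(\<integral>\<^sup>+\<xi>. ennreal (exp (- \<delta> * (norm \<xi>)\<^sup>2 / 2)) *
            (\<integral>\<^sup>+v. ennreal ((cmod (partial_fourier f v \<xi>))\<^sup>2) \<partial>lborel) \<partial>lborel)
      \<le> ennreal ((2 * pi) ^ DIM('b)) * emeasure lborel (cball (0 :: 'a \<times> 'b) R)"
    and "(\<integral>\<^sup>+\<xi>. ennreal (exp (- \<delta> * (norm \<xi>)\<^sup>2 / 2)) *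
            (\<integral>\<^sup>+v. ennreal ((cmod (partial_fourier f v \<xi>))\<^sup>2) \<partial>lborel) \<partial>lborel)
      \<le> ennreal ((2 * pi) ^ DIM('b)) * (\<integral>\<^sup>+x. ennreal ((f x)\<^sup>2) \<partial>lborel)"
proof -
  have [measurable]: "f \<in> borel_measurable (borel \<Otimes>\<^sub>M borel)"
    "(\<lambda>p. partial_fourier f (fst p) (snd p)) \<in> borel_measurable (borel \<Otimes>\<^sub>M borel)"
    using borel_measurable_partial_fourier[OF f] by (simp_all add: borel_prod)
  have fib: "integrable lborel (\<lambda>c. complex_of_real (f (v, c)))" for v
  proof (rule integrable_bounded_support[where B=1 and S="cball 0 R"])
    fix c :: 'b assume "c \<notin> cball 0 R"
    then have "(v, c) \<notin> cball 0 R"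
      using norm_snd_le[of c v] by auto
    then show "complex_of_real (f (v, c)) = 0"
      using supp by simp
  qed (auto simp: bound)
  let ?g = "\<lambda>\<xi>::'b. exp (- \<delta> * (norm \<xi>)\<^sup>2 / 2)"
  have "(\<integral>\<^sup>+\<xi>. ennreal (?g \<xi>) * (\<integral>\<^sup>+v. ennreal ((cmod (partial_fourier f v \<xi>))\<^sup>2) \<partial>lborel) \<partial>lborel)
      = (\<integral>\<^sup>+\<xi>. (\<integral>\<^sup>+v. ennreal (?g \<xi> * (cmod (partial_fourier f v \<xi>))\<^sup>2) \<partial>lborel) \<partial>lborel)"
  proof (intro nn_integral_cong)
    fix \<xi> :: 'b
    have "(\<lambda>v. partial_fourier f v \<xi>) \<in> borel_measurable borel"
      using measurable_compose[of "\<lambda>v. (v, \<xi>)" borel borel "\<lambda>p. partial_fourier f (fst p) (snd p)"]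
        borel_measurable_partial_fourier[OF f] by (simp add: borel_prod[symmetric])
    then show "ennreal (?g \<xi>) * (\<integral>\<^sup>+v. ennreal ((cmod (partial_fourier f v \<xi>))\<^sup>2) \<partial>lborel)
      = (\<integral>\<^sup>+v. ennreal (?g \<xi> * (cmod (partial_fourier f v \<xi>))\<^sup>2) \<partial>lborel)"
      by (simp add: nn_integral_cmult[symmetric] ennreal_mult)
  qed
  also have "\<dots> = (\<integral>\<^sup>+v. (\<integral>\<^sup>+\<xi>. ennreal (?g \<xi> * (cmod (partial_fourier f v \<xi>))\<^sup>2) \<partial>lborel) \<partial>lborel)"
  proof (rule lborel_pair.Fubini')
    show "(\<lambda>(v, \<xi>). ennreal (?g \<xi> * (cmod (partial_fourier f v \<xi>))\<^sup>2)) \<in> borel_measurable (lborel \<Otimes>\<^sub>M lborel)"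
      unfolding split_beta by measurable
  qed
  also have "\<dots> \<le> (\<integral>\<^sup>+v. ennreal ((2 * pi) ^ DIM('b)) * (\<integral>\<^sup>+c. ennreal ((f (v, c))\<^sup>2) \<partial>lborel) \<partial>lborel)"
  proof (rule nn_integral_mono)
    fix v :: 'a
    show "(\<integral>\<^sup>+\<xi>. ennreal (?g \<xi> * (cmod (partial_fourier f v \<xi>))\<^sup>2) \<partial>lborel)
        \<le> ennreal ((2 * pi) ^ DIM('b)) * (\<integral>\<^sup>+c. ennreal ((f (v, c))\<^sup>2) \<partial>lborel)"
      using bessel_gaussian[OF fib[of v], of "\<lambda>x. x" 1 \<delta>] \<delta> by (simp add: partial_fourier_def)
  qed
  also have "\<dots> = ennreal ((2 * pi) ^ DIM('b)) * (\<integral>\<^sup>+v. (\<integral>\<^sup>+c. ennreal ((f (v, c))\<^sup>2) \<partial>lborel) \<partial>lborel)"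
    by (intro nn_integral_cmult lborel.borel_measurable_nn_integral) measurable
  also have "(\<integral>\<^sup>+v. (\<integral>\<^sup>+c. ennreal ((f (v, c))\<^sup>2) \<partial>lborel) \<partial>lborel) = (\<integral>\<^sup>+x. ennreal ((f x)\<^sup>2) \<partial>lborel)"
    using lborel.nn_integral_fst[of "\<lambda>x. ennreal ((f x)\<^sup>2)" lborel] by (simp add: lborel_prod)
  finally show *: "(\<integral>\<^sup>+\<xi>. ennreal (exp (- \<delta> * (norm \<xi>)\<^sup>2 / 2)) *
            (\<integral>\<^sup>+v. ennreal ((cmod (partial_fourier f v \<xi>))\<^sup>2) \<partial>lborel) \<partial>lborel)
      \<le> ennreal ((2 * pi) ^ DIM('b)) * (\<integral>\<^sup>+x. ennreal ((f x)\<^sup>2) \<partial>lborel)" .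
  have "(\<integral>\<^sup>+x. ennreal ((f x)\<^sup>2) \<partial>lborel) \<le> (\<integral>\<^sup>+x. indicator (cball (0 :: 'a \<times> 'b) R) x \<partial>lborel)"
  proof (rule nn_integral_mono)
    fix x :: "'a \<times> 'b"
    show "ennreal ((f x)\<^sup>2) \<le> indicator (cball 0 R) x"
      using supp[of x] bound[of x] by (cases "x \<in> cball 0 R") (auto simp: abs_square_le_1)
  qed
  then show "(\<integral>\<^sup>+\<xi>. ennreal (exp (- \<delta> * (norm \<xi>)\<^sup>2 / 2)) *
            (\<integral>\<^sup>+v. ennreal ((cmod (partial_fourier f v \<xi>))\<^sup>2) \<partial>lborel) \<partial>lborel)
      \<le> ennreal ((2 * pi) ^ DIM('b)) * emeasure lborel (cball (0 :: 'a \<times> 'b) R)"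
    by (intro order_trans[OF *] mult_left_mono) simp_all
qed

section \<open>The overlap of two response functions\<close>

text \<open>The affine chart of \<open>\<complex>P\<^sup>3\<close> on which one of the four coordinates is 1.\<close>

type_synonym affine_point = "(complex \<times> complex) \<times> complex"

text \<open>There is no complex conjugation: the maximally entangled state pairs vectors
  bilinearly.\<close>

definition cdot :: "complex \<times> complex \<Rightarrow> complex \<times> complex \<Rightarrow> complex" where
  "cdot v w = fst v * fst w + snd v * snd w"

text \<open>The adjoint of \<open>cdot\<close> with respect to the real inner products, see \<open>inner_cdot\<close>.\<close>

definition ctwist :: "complex \<Rightarrow> complex \<times> complex \<Rightarrow> complex \<times> complex" where
  "ctwist \<xi> w = (\<xi> * cnj (fst w), \<xi> * cnj (snd w))"

lemma inner_cdot: "\<xi> \<bullet> cdot v w = v \<bullet> ctwist \<xi> w"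
  by (simp add: cdot_def ctwist_def inner_complex_def inner_prod_def algebra_simps)

text \<open>So \<open>ctwist \<xi>\<close> is a similarity of ratio \<open>norm \<xi>\<close>, the
  property required of the map \<open>T\<close> in \<open>bessel_gaussian\<close>; the ratio is the
  source of the decay in \<open>\<xi>\<close>.\<close>

lemma norm_ctwist_diff: "norm (ctwist \<xi> x - ctwist \<xi> y) = norm \<xi> * norm (x - y)"
proof -
  have "ctwist \<xi> x - ctwist \<xi> y = (\<xi> * cnj (fst x - fst y), \<xi> * cnj (snd x - snd y))"
    by (simp add: ctwist_def algebra_simps)
  then show ?thesis
    by (simp add: norm_prod_def norm_mult power_mult_distrib distrib_left[symmetric]
        real_sqrt_mult del: complex_cnj_diff)
qed

lemma continuous_on_ctwist: "continuous_on UNIV (ctwist \<xi>)"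
  unfolding ctwist_def by (intro continuous_intros)

lemma norm_cdot_le: "norm (cdot v w) \<le> 2 * (norm v * norm w)"
proof -
  have "norm (cdot v w) \<le> norm (fst v) * norm (fst w) + norm (snd v) * norm (snd w)"
    unfolding cdot_def by (metis norm_mult norm_triangle_ineq)
  also have "\<dots> \<le> norm v * norm w + norm v * norm w"
    using norm_fst_le[of "fst v" "snd v"] norm_snd_le[of "snd v" "fst v"]
      norm_fst_le[of "fst w" "snd w"] norm_snd_le[of "snd w" "fst w"]
    by (intro add_mono mult_mono) auto
  finally show ?thesis
    by simp
qed

section \<open>The overlap function and its integrability\<close>

lemma integral_lborel_shift:
  fixes g :: "'a::euclidean_space \<Rightarrow> 'b::{banach, second_countable_topology}"
  assumes [measurable]: "g \<in> borel_measurable borel"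
  shows "(\<integral>x. g (k + x) \<partial>lborel) = (\<integral>x. g x \<partial>lborel)"
  by (subst (2) lborel_distr_plus[of k, symmetric]) (simp add: integral_distr)

text \<open>
  The parameters \<open>(z, v, w, c')\<close> are mapped to Alice's point \<open>(v, c)\<close> with \<open>c + v \<bullet> w + c' = z\<close>,
  where \<open>(w, c')\<close> is Bob's point.
\<close>

definition overlap_point :: "complex \<times> ((complex \<times> complex) \<times> affine_point) \<Rightarrow>
    affine_point" where
  "overlap_point q = (fst (snd q), fst q - cdot (fst (snd q)) (fst (snd (snd q))) - snd (snd (snd q)))"

lemma measurable_overlap_point [measurable]: "overlap_point \<in> borel_measurable borel"
  unfolding overlap_point_def cdot_def
  by (intro borel_measurable_continuous_onI continuous_intros)

text \<open>This is the function b of the overview. Alice's last coordinate is solved for, with unit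
  Jacobian, so the overlap is the density in \<open>z\<close> of the bilinear product of two points
  weighted by \<open>f\<close> and \<open>h\<close>.\<close>

definition overlap :: "(affine_point \<Rightarrow> real) \<Rightarrow> (affine_point \<Rightarrow> real) \<Rightarrow>
    complex \<Rightarrow> real" where
  "overlap f h z = (\<integral>p. f (overlap_point (z, p)) * h (snd p) \<partial>lborel)"

lemma measurable_overlap_integrand:
  fixes f h :: "affine_point \<Rightarrow> real"
  assumes [measurable]: "f \<in> borel_measurable borel" "h \<in> borel_measurable borel"
  shows "(\<lambda>q. f (overlap_point q) * h (snd (snd q))) \<in> borel_measurable borel"
    "(\<lambda>p. f (overlap_point (z, p)) * h (snd p)) \<in> borel_measurable borel"
proof -
  have [measurable]: "(\<lambda>q::complex \<times> ((complex \<times> complex) \<times> affine_point). snd (snd q)) \<in> borel_measurable borel"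
    "(\<lambda>q::(complex \<times> complex) \<times> affine_point. snd q) \<in> borel_measurable borel"
    "(\<lambda>q::(complex \<times> complex) \<times> affine_point. (z, q)) \<in> borel_measurable borel"
    by (intro borel_measurable_continuous_onI continuous_intros)+
  show "(\<lambda>q. f (overlap_point q) * h (snd (snd q))) \<in> borel_measurable borel"
    "(\<lambda>p. f (overlap_point (z, p)) * h (snd p)) \<in> borel_measurable borel"
    by measurable
qed

context
  fixes f :: "affine_point \<Rightarrow> real" and R :: real
  assumes f: "f \<in> borel_measurable borel" "\<And>x. 0 \<le> f x" "\<And>x. f x \<le> 1" "\<And>x. x \<notin> cball 0 R \<Longrightarrow> f x = 0"
begin

lemma integrable_fibre: "integrable lborel (\<lambda>c. f (v, c))" 
proof (rule integrable_bounded_support[where B=1 and S="cball 0 R"])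
  show "(\<lambda>c. f (v, c)) \<in> borel_measurable borel"
    by (rule measurable_compose[OF _ f(1)]) (intro borel_measurable_continuous_onI continuous_intros)
  fix c :: complex assume "c \<notin> cball 0 R"
  then have "(v, c) \<notin> cball 0 R"
    using norm_snd_le[of c v] by auto
  then show "f (v, c) = 0"
    using f(4) by simp
next
  fix c :: complex
  show "norm (f (v, c)) \<le> 1"
    using f(2,3)[of "(v, c)"] by simp
qed simp

text \<open>This confines \<open>v\<close> to a ball, on which a Gaussian weight is bounded from
  below.\<close>

lemma partial_fourier_support: "norm v > R \<Longrightarrow> partial_fourier f v \<xi> = 0"
proof -
  assume "norm v > R"
  then have "f (v, c) = 0" for c
    using f(4)[of "(v, c)"] norm_fst_le[of v c] by force
  then show ?thesis
    by (simp add: partial_fourier_def)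
qed

lemma partial_fourier_bounded: "norm (partial_fourier f v \<xi>) \<le> measure lborel (cball (0::complex) R)"
proof -
  have "norm (partial_fourier f v \<xi>) \<le> (\<integral>c. norm (complex_of_real (f (v, c)) * cis (\<xi> \<bullet> c)) \<partial>lborel)"
    unfolding partial_fourier_def by (rule integral_norm_bound)
  also have "\<dots> = (\<integral>c. f (v, c) \<partial>lborel)"
    using f(2) by (simp add: norm_mult)
  also have "\<dots> \<le> (\<integral>c. indicator (cball (0::complex) R) c \<partial>lborel)"
  proof (rule integral_mono[OF integrable_fibre])
    show "integrable lborel (indicator (cball 0 R) :: complex \<Rightarrow> real)"
      using emeasure_bounded_finite[OF bounded_cball, of 0 R] by (intro integrable_real_indicator) auto
    fix c :: complex
    show "f (v, c) \<le> indicator (cball 0 R) c"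
      using f(3)[of "(v, c)"] f(4)[of "(v, c)"] norm_snd_le[of c v] by (cases "c \<in> cball 0 R") auto
  qed
  finally show ?thesis
    by simp
qed

lemma integrable_partial_fourier: "integrable lborel (\<lambda>v. partial_fourier f v \<xi>)"
proof (rule integrable_bounded_support[where B="measure lborel (cball (0::complex) R)" and S="cball 0 R"])
  have "(\<lambda>v. (v, \<xi>)) \<in> borel_measurable borel"
    by (intro borel_measurable_continuous_onI continuous_intros)
  from measurable_compose[OF this borel_measurable_partial_fourier[OF f(1)]]
  show "(\<lambda>v. partial_fourier f v \<xi>) \<in> borel_measurable borel"
    by simp
qed (auto simp: partial_fourier_bounded intro: partial_fourier_support)

end

context
  fixes f h :: "affine_point \<Rightarrow> real" and R :: real
  assumes f: "f \<in> borel_measurable borel" "\<And>x. 0 \<le> f x" "\<And>x. f x \<le> 1" "\<And>x. x \<notin> cball 0 R \<Longrightarrow> f x = 0"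
    and h: "h \<in> borel_measurable borel" "\<And>x. 0 \<le> h x" "\<And>x. h x \<le> 1" "\<And>x. x \<notin> cball 0 R \<Longrightarrow> h x = 0"
begin

lemma overlap_integrand_bound: "\<bar>f x * h y\<bar> \<le> 1"
  using f(2,3)[of x] h(2,3)[of y] mult_mono[of "f x" 1 "h y" 1] by simp

lemma overlap_integrand_support:
  assumes "(fst p, snd p) \<notin> cball 0 R \<times> cball 0 R"
  shows "f (overlap_point (z, p)) * h (snd p) = 0"
proof (cases "snd p \<in> cball 0 R")
  case True
  then have "overlap_point (z, p) \<notin> cball 0 R"
    using assms norm_fst_le[of "fst (overlap_point (z, p))" "snd (overlap_point (z, p))"]
    by (cases p) (auto simp: overlap_point_def)
  then show ?thesis
    using f(4) by simp
qed (use h(4) in simp)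

lemma integrable_overlap_integrand:
  "integrable lborel (\<lambda>p. f (overlap_point (z, p)) * h (snd p))"
proof (rule integrable_bounded_support[where B=1 and S="cball 0 R \<times> cball 0 R"])
  show "(\<lambda>p. f (overlap_point (z, p)) * h (snd p)) \<in> borel_measurable borel"
    by (rule measurable_overlap_integrand) (fact f(1) h(1))+
next
  fix p :: "(complex \<times> complex) \<times> affine_point"
  assume "p \<notin> cball 0 R \<times> cball 0 R"
  then show "f (overlap_point (z, p)) * h (snd p) = 0"
    by (intro overlap_integrand_support) simp
qed (auto simp: overlap_integrand_bound intro!: bounded_Times)

lemma overlap_nonneg: "0 \<le> overlap f h z"
  unfolding overlap_def using f(2) h(2) by (intro Bochner_Integration.integral_nonneg) simp

lemma ennreal_overlap:
  "ennreal (overlap f h z) = (\<integral>\<^sup>+p. ennreal (f (overlap_point (z, p)) * h (snd p)) \<partial>lborel)"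
  unfolding overlap_def using integrable_overlap_integrand f(2) h(2)
  by (intro nn_integral_eq_integral[symmetric]) auto

lemma overlap_le: "overlap f h z \<le> measure lborel (cball (0::complex \<times> complex) R \<times> cball (0::affine_point) R)"
proof -
  let ?S = "cball (0::complex \<times> complex) R \<times> cball (0::affine_point) R"
  have S: "emeasure lborel ?S < \<infinity>"
    by (intro emeasure_bounded_finite bounded_Times bounded_cball)
  have "closed ?S"
    by (intro closed_Times closed_cball)
  then have [measurable]: "?S \<in> sets borel"
    by simp
  have "overlap f h z \<le> (\<integral>p. indicator ?S p \<partial>lborel)"
    unfolding overlap_def
  proof (rule integral_mono[OF integrable_overlap_integrand])
    show "integrable lborel (indicator ?S :: _ \<Rightarrow> real)"
      using S by (intro integrable_real_indicator) auto
    fix p :: "(complex \<times> complex) \<times> affine_point"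
    show "f (overlap_point (z, p)) * h (snd p) \<le> indicator ?S p"
    proof (cases "p \<in> ?S")
      case True
      then show ?thesis
        using overlap_integrand_bound[of "overlap_point (z, p)" "snd p"] by simp
    next
      case False
      then show ?thesis
        using overlap_integrand_support[of p z] by auto
    qed
  qed
  then show ?thesis
    by simp
qed

lemma integrable_overlap_joint:
  "integrable (lborel \<Otimes>\<^sub>M lborel) (\<lambda>q. f (overlap_point q) * h (snd (snd q)))"
  unfolding lborel_prod
\<comment> \<open>The radius for \<open>z\<close> is the sum of the bounds \<open>R\<close> on both
  last coordinates and the bound from \<open>norm_cdot_le\<close> on the middle term.\<close>
proof (rule integrable_bounded_support[where B=1 and S="cball 0 (2 * (R * R) + 2 * R) \<times> (cball 0 R \<times> cball 0 R)"])
  show "(\<lambda>q. f (overlap_point q) * h (snd (snd q))) \<in> borel_measurable borel"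
    by (rule measurable_overlap_integrand) (fact f(1) h(1))+
  fix q :: "complex \<times> ((complex \<times> complex) \<times> affine_point)"
  assume q: "q \<notin> cball 0 (2 * (R * R) + 2 * R) \<times> (cball 0 R \<times> cball 0 R)"
  show "f (overlap_point q) * h (snd (snd q)) = 0"
  proof (rule ccontr)
    assume nz: "f (overlap_point q) * h (snd (snd q)) \<noteq> 0"
    obtain z p where zp: "q = (z, p)"
      by (cases q) auto
    have p: "(fst p, snd p) \<in> cball 0 R \<times> cball 0 R"
      using nz overlap_integrand_support[of p z] zp by auto
    have "overlap_point (z, p) \<in> cball 0 R"
      using nz f(4) zp by fastforce
    then have "norm (snd (overlap_point (z, p))) \<le> R"
      using norm_snd_le[of "snd (overlap_point (z, p))" "fst (overlap_point (z, p))"] by simp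
    then have 1: "norm (z - cdot (fst p) (fst (snd p)) - snd (snd p)) \<le> R"
      by (simp add: overlap_point_def)
    have 2: "norm (fst p) \<le> R" "norm (fst (snd p)) \<le> R" "norm (snd (snd p)) \<le> R"
      using p norm_fst_le[of "fst (snd p)" "snd (snd p)"] norm_snd_le[of "snd (snd p)" "fst (snd p)"] by auto
    have 3: "norm (cdot (fst p) (fst (snd p))) \<le> 2 * (R * R)"
      by (rule order_trans[OF norm_cdot_le])
        (use 2 order_trans[OF norm_ge_zero 2(1)] in \<open>auto intro!: mult_mono\<close>)
    have "norm z \<le> norm (z - cdot (fst p) (fst (snd p)) - snd (snd p)) + norm (cdot (fst p) (fst (snd p))) + norm (snd (snd p))"
      using norm_triangle_ineq[of "z - cdot (fst p) (fst (snd p)) - snd (snd p)" "cdot (fst p) (fst (snd p)) + snd (snd p)"]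
        norm_triangle_ineq[of "cdot (fst p) (fst (snd p))" "snd (snd p)"] by simp
    then have "norm z \<le> 2 * (R * R) + 2 * R"
      using 1 2 3 by linarith
    then show False
      using q p zp by (cases p) auto
  qed
qed (auto simp: overlap_integrand_bound intro!: bounded_Times)

lemma integrable_overlap: "integrable lborel (overlap f h)"
  using lborel_pair.integrable_fst'[OF integrable_overlap_joint]
  by (simp add: overlap_def[abs_def])

end

section \<open>The Fourier transform of the overlap and its second difference\<close>

lemma ennreal_lincomb:
  "0 \<le> a \<Longrightarrow> 0 \<le> x \<Longrightarrow> 0 \<le> c \<Longrightarrow> 0 \<le> y \<Longrightarrow>
    ennreal (a * x + c * y) = ennreal a * ennreal x + ennreal c * ennreal y"
  by (simp add: ennreal_plus ennreal_mult)

context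
  fixes f h :: "affine_point \<Rightarrow> real" and R :: real
  assumes f: "f \<in> borel_measurable borel" "\<And>x. 0 \<le> f x" "\<And>x. f x \<le> 1" "\<And>x. x \<notin> cball 0 R \<Longrightarrow> f x = 0"
    and h: "h \<in> borel_measurable borel" "\<And>x. 0 \<le> h x" "\<And>x. h x \<le> 1" "\<And>x. x \<notin> cball 0 R \<Longrightarrow> h x = 0"
begin

text \<open>The bilinear product contains both last coordinates with coefficient 1, so its
  exponential splits into three factors. Integrating out the last coordinates gives the two partial
  transforms; the remaining factor, the exponential of \<open>\<xi> \<bullet> cdot v w\<close>, is
  rewritten by \<open>inner_cdot\<close>.\<close>

lemma fourier_overlap:
  "(\<integral>z. overlap f h z * cis (\<xi> \<bullet> z) \<partial>lborel) =
     (\<integral>v. partial_fourier f v \<xi> *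
        (\<integral>w. partial_fourier h w \<xi> * cis (v \<bullet> ctwist \<xi> w) \<partial>lborel) \<partial>lborel)"
proof -
  define \<Phi> where "\<Phi> = (\<lambda>z p. complex_of_real (f (overlap_point (z, p)) * h (snd p)) * cis (\<xi> \<bullet> z))"
  let ?k = "\<lambda>p. cdot (fst p) (fst (snd p)) + snd (snd p)"
  have cisz: "(\<lambda>q::complex \<times> ((complex \<times> complex) \<times> affine_point). cis (\<xi> \<bullet> fst q))
      \<in> borel_measurable (lborel \<Otimes>\<^sub>M lborel)"
    by measurable
  have int: "integrable (lborel \<Otimes>\<^sub>M lborel) (case_prod \<Phi>)"
  proof (rule Bochner_Integration.integrable_bound)
    show "integrable (lborel \<Otimes>\<^sub>M lborel) (\<lambda>q. f (overlap_point q) * h (snd (snd q)))"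
      by (rule integrable_overlap_joint[OF f h])
    from borel_measurable_times[OF measurable_compose[OF borel_measurable_integrable[OF this] borel_measurable_of_real] cisz]
    show "case_prod \<Phi> \<in> borel_measurable (lborel \<Otimes>\<^sub>M lborel)"
      unfolding \<Phi>_def split_beta prod.collapse .
  qed (simp add: \<Phi>_def split_beta norm_mult)
  have "(\<integral>z. overlap f h z * cis (\<xi> \<bullet> z) \<partial>lborel) = (\<integral>z. (\<integral>p. \<Phi> z p \<partial>lborel) \<partial>lborel)"
    unfolding \<Phi>_def overlap_def by (simp del: of_real_mult)
  also have "\<dots> = (\<integral>p. (\<integral>z. \<Phi> z p \<partial>lborel) \<partial>lborel)"
    by (rule lborel_pair.Fubini_integral[symmetric, OF int])
  also have "(\<lambda>p. \<integral>z. \<Phi> z p \<partial>lborel) =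
      (\<lambda>p. partial_fourier f (fst p) \<xi> * (h (snd p) * cis (\<xi> \<bullet> ?k p)))"
  proof
    fix p :: "(complex \<times> complex) \<times> affine_point"
    have "(\<lambda>c. (fst p, c)) \<in> borel_measurable (borel :: complex measure)"
      by (intro borel_measurable_continuous_onI continuous_intros)
    from measurable_compose[OF this f(1)]
    have [measurable]: "(\<lambda>c. f (fst p, c)) \<in> borel_measurable borel" .
    \<comment> \<open>After this shift the integration variable is Alice's last coordinate
      itself.\<close>
    have "(\<integral>z. \<Phi> z p \<partial>lborel) = (\<integral>z. \<Phi> (?k p + z) p \<partial>lborel)"
      by (rule integral_lborel_shift[symmetric]) (simp add: \<Phi>_def overlap_point_def)
    also have "\<dots> = (\<integral>z. (complex_of_real (f (fst p, z)) * cis (\<xi> \<bullet> z)) * (h (snd p) * cis (\<xi> \<bullet> ?k p)) \<partial>lborel)"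
    proof (rule Bochner_Integration.integral_cong[OF refl])
      fix z :: complex
      have "cis (\<xi> \<bullet> (?k p + z)) = cis (\<xi> \<bullet> z) * cis (\<xi> \<bullet> ?k p)"
        by (simp only: inner_add_right cis_mult ac_simps)
      moreover have "overlap_point (?k p + z, p) = (fst p, z)"
        by (simp add: overlap_point_def)
      ultimately show "\<Phi> (?k p + z) p = (complex_of_real (f (fst p, z)) * cis (\<xi> \<bullet> z)) * (h (snd p) * cis (\<xi> \<bullet> ?k p))"
        by (simp only: \<Phi>_def of_real_mult mult_ac)
    qed
    also have "\<dots> = partial_fourier f (fst p) \<xi> * (h (snd p) * cis (\<xi> \<bullet> ?k p))"
      by (simp add: partial_fourier_def)
    finally show "(\<integral>z. \<Phi> z p \<partial>lborel) = partial_fourier f (fst p) \<xi> * (h (snd p) * cis (\<xi> \<bullet> ?k p))" .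
  qed
  finally have 1: "(\<integral>z. overlap f h z * cis (\<xi> \<bullet> z) \<partial>lborel) =
      (\<integral>p. partial_fourier f (fst p) \<xi> * (h (snd p) * cis (\<xi> \<bullet> ?k p)) \<partial>lborel)" .
  have hint: "integrable lborel (\<lambda>y. complex_of_real (h y))"
    by (intro integrable_of_real integrable_bounded_support[OF h(1), where B=1 and S="cball 0 R"])
      (use h in auto)
  have cont: "(\<lambda>p. cis (\<xi> \<bullet> (cdot (fst p) (fst (snd p)) + snd (snd p)))) \<in> borel_measurable borel"
    unfolding cdot_def cis_conv_exp by (intro borel_measurable_continuous_onI continuous_intros)
  have int2: "integrable (lborel \<Otimes>\<^sub>M lborel) (\<lambda>p. partial_fourier f (fst p) \<xi> * (h (snd p) * cis (\<xi> \<bullet> ?k p)))"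
  proof (rule Bochner_Integration.integrable_bound)
    show I: "integrable (lborel \<Otimes>\<^sub>M lborel) (\<lambda>p. partial_fourier f (fst p) \<xi> * complex_of_real (h (snd p)))"
      by (rule integrable_tensor(1)[OF lborel.sigma_finite_measure_axioms lborel.sigma_finite_measure_axioms
          integrable_partial_fourier[OF f] hint])
    have "(\<lambda>p. (partial_fourier f (fst p) \<xi> * complex_of_real (h (snd p))) * cis (\<xi> \<bullet> ?k p)) \<in> borel_measurable (lborel \<Otimes>\<^sub>M lborel)"
    proof (rule borel_measurable_times[OF borel_measurable_integrable[OF I]])
      show "(\<lambda>p. cis (\<xi> \<bullet> ?k p)) \<in> borel_measurable (lborel \<Otimes>\<^sub>M lborel)"
        using cont by (simp add: lborel_prod)
    qed
    then show "(\<lambda>p. partial_fourier f (fst p) \<xi> * (h (snd p) * cis (\<xi> \<bullet> ?k p))) \<in> borel_measurable (lborel \<Otimes>\<^sub>M lborel)"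
      by (simp only: mult.assoc)
  qed (simp add: norm_mult)
  have "(\<integral>p. partial_fourier f (fst p) \<xi> * (h (snd p) * cis (\<xi> \<bullet> ?k p)) \<partial>lborel)
      = (\<integral>v. (\<integral>y. partial_fourier f v \<xi> * (h y * cis (\<xi> \<bullet> (cdot v (fst y) + snd y))) \<partial>lborel) \<partial>lborel)"
    using lborel_pair.integral_fst'[OF int2] by (simp add: lborel_prod)
  also have "\<dots> = (\<integral>v. partial_fourier f v \<xi> * (\<integral>y. h y * cis (\<xi> \<bullet> (cdot v (fst y) + snd y)) \<partial>lborel) \<partial>lborel)"
    by simp
  also have "(\<lambda>v. \<integral>y. h y * cis (\<xi> \<bullet> (cdot v (fst y) + snd y)) \<partial>lborel) =
      (\<lambda>v. \<integral>w. partial_fourier h w \<xi> * cis (v \<bullet> ctwist \<xi> w) \<partial>lborel)"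
  proof
    fix v :: "complex \<times> complex"
    have cont': "(\<lambda>y. cis (\<xi> \<bullet> (cdot v (fst y) + snd y))) \<in> borel_measurable borel"
      unfolding cdot_def cis_conv_exp by (intro borel_measurable_continuous_onI continuous_intros)
    have int3: "integrable (lborel \<Otimes>\<^sub>M lborel) (\<lambda>y. h y * cis (\<xi> \<bullet> (cdot v (fst y) + snd y)))"
      unfolding lborel_prod
      by (rule Bochner_Integration.integrable_bound[OF hint])
        (use borel_measurable_integrable[OF hint] cont' in \<open>auto simp: norm_mult\<close>)
    have "(\<integral>y. h y * cis (\<xi> \<bullet> (cdot v (fst y) + snd y)) \<partial>lborel)
        = (\<integral>w. (\<integral>c. h (w, c) * cis (\<xi> \<bullet> (cdot v w + c)) \<partial>lborel) \<partial>lborel)"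
      using lborel_pair.integral_fst'[OF int3] by (simp add: lborel_prod)
    also have "\<dots> = (\<integral>w. (\<integral>c. (h (w, c) * cis (\<xi> \<bullet> c)) * cis (v \<bullet> ctwist \<xi> w) \<partial>lborel) \<partial>lborel)"
    proof (intro Bochner_Integration.integral_cong refl)
      fix w :: "complex \<times> complex" and c :: complex
      have "cis (\<xi> \<bullet> (cdot v w + c)) = cis (\<xi> \<bullet> c) * cis (v \<bullet> ctwist \<xi> w)"
        by (simp only: inner_add_right cis_mult inner_cdot ac_simps)
      then show "h (w, c) * cis (\<xi> \<bullet> (cdot v w + c)) = (h (w, c) * cis (\<xi> \<bullet> c)) * cis (v \<bullet> ctwist \<xi> w)"
        by (simp only: mult.assoc)
    qed
    finally show "(\<integral>y. h y * cis (\<xi> \<bullet> (cdot v (fst y) + snd y)) \<partial>lborel) =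
        (\<integral>w. partial_fourier h w \<xi> * cis (v \<bullet> ctwist \<xi> w) \<partial>lborel)"
      by (simp add: partial_fourier_def)
  qed
  finally show ?thesis
    unfolding 1 .
qed

text \<open>The bilinear form of \<open>fourier_overlap\<close> is split by a weighted inequality of
  the arithmetic and geometric mean, with a free weight \<open>\<tau>\<close>. The part with
  \<open>h\<close> is bounded by \<open>bessel_gaussian\<close> with ratio
  \<open>norm \<xi>\<close>, so that all powers of \<open>norm \<xi>\<close> cancel. At
  \<open>\<xi> = 0\<close> the left side vanishes.\<close>

lemma fourier_overlap_bound:
  assumes \<tau>: "\<tau> > 0"
  shows "ennreal ((norm \<xi>)\<^sup>2 * cmod (\<integral>z. overlap f h z * cis (\<xi> \<bullet> z) \<partial>lborel)) \<le>
    ennreal (\<tau> / 2) * (\<integral>\<^sup>+v. ennreal ((cmod (partial_fourier f v \<xi>))\<^sup>2) \<partial>lborel) +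
    ennreal (exp (R\<^sup>2 / 2) * (2 * pi) ^ 4 / (2 * \<tau>)) * (\<integral>\<^sup>+w. ennreal ((cmod (partial_fourier h w \<xi>))\<^sup>2) \<partial>lborel)"
proof (cases "\<xi> = 0")
  case False
  then have n: "norm \<xi> > 0"
    by simp
  define A where "A = (\<lambda>v. \<integral>w. partial_fourier h w \<xi> * cis (v \<bullet> ctwist \<xi> w) \<partial>lborel)"
  define C where "C = (norm \<xi>) ^ 4 * exp (R\<^sup>2 / 2) / (2 * \<tau>)"
  have C: "C \<ge> 0"
    using \<tau> by (simp add: C_def)
  have [measurable]: "ctwist \<xi> \<in> borel_measurable borel"
    by (rule borel_measurable_continuous_onI[OF continuous_on_ctwist])
  have pfm[measurable]: "(\<lambda>w. partial_fourier h w \<xi>) \<in> borel_measurable borel"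
    "(\<lambda>w. partial_fourier f w \<xi>) \<in> borel_measurable borel"
    using borel_measurable_integrable[OF integrable_partial_fourier[OF h]]
      borel_measurable_integrable[OF integrable_partial_fourier[OF f]] by simp_all
  have Am[measurable]: "A \<in> borel_measurable borel"
  proof -
    have "(\<lambda>(v, w). partial_fourier h w \<xi> * cis (v \<bullet> ctwist \<xi> w)) \<in> borel_measurable (lborel \<Otimes>\<^sub>M lborel)"
      unfolding split_beta by measurable
    then have "A \<in> borel_measurable lborel"
      unfolding A_def by (rule lborel.borel_measurable_lebesgue_integral)
    then show ?thesis
      by simp
  qed
  have pw: "(norm \<xi>)\<^sup>2 * cmod (partial_fourier f v \<xi> * A v) \<le>
      \<tau> / 2 * (cmod (partial_fourier f v \<xi>))\<^sup>2 + C * (exp (- 1 * (norm v)\<^sup>2 / 2) * (cmod (A v))\<^sup>2)" for v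
  proof (cases "norm v > R")
    case True
    then show ?thesis
      using partial_fourier_support[OF f True] C \<tau> by simp
  next
    case False
    define x where "x = cmod (partial_fourier f v \<xi>)"
    define y where "y = (norm \<xi>)\<^sup>2 * cmod (A v)"
    have "(norm v)\<^sup>2 \<le> R\<^sup>2"
      using False by (intro power_mono) auto
    \<comment> \<open>On the support of the transform of \<open>f\<close> the Gaussian weight that
      \<open>bessel_gaussian\<close> asks for, with parameter 1, can be inserted at the cost of this
      constant factor.\<close>
    then have e: "1 \<le> exp (R\<^sup>2 / 2) * exp (- 1 * (norm v)\<^sup>2 / 2)"
      by (simp add: mult_exp_exp)
    have "0 \<le> (\<tau> * x - y)\<^sup>2 / (2 * \<tau>)"
      using \<tau> by simp
    also have "\<dots> = \<tau> / 2 * x\<^sup>2 + y\<^sup>2 / (2 * \<tau>) - x * y"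
      using \<tau> by (simp add: power2_eq_square field_simps)
    finally have "x * y \<le> \<tau> / 2 * x\<^sup>2 + y\<^sup>2 / (2 * \<tau>) * 1"
      by simp
    also have "\<dots> \<le> \<tau> / 2 * x\<^sup>2 + y\<^sup>2 / (2 * \<tau>) * (exp (R\<^sup>2 / 2) * exp (- 1 * (norm v)\<^sup>2 / 2))"
      using \<tau> by (intro add_left_mono mult_left_mono e) simp
    also have "y\<^sup>2 / (2 * \<tau>) * (exp (R\<^sup>2 / 2) * exp (- 1 * (norm v)\<^sup>2 / 2)) =
        C * (exp (- 1 * (norm v)\<^sup>2 / 2) * (cmod (A v))\<^sup>2)"
      by (simp add: y_def C_def power_mult_distrib power_mult[symmetric])
    also have "x * y = (norm \<xi>)\<^sup>2 * cmod (partial_fourier f v \<xi> * A v)"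
      by (simp add: x_def y_def norm_mult)
    finally show ?thesis
      by (simp add: x_def)
  qed
  have "ennreal ((norm \<xi>)\<^sup>2 * cmod (\<integral>z. overlap f h z * cis (\<xi> \<bullet> z) \<partial>lborel))
      = ennreal (cmod (\<integral>v. (norm \<xi>)\<^sup>2 * (partial_fourier f v \<xi> * A v) \<partial>lborel))"
    unfolding fourier_overlap by (simp add: A_def norm_mult norm_power)
  also have "\<dots> \<le> (\<integral>\<^sup>+v. ennreal (cmod ((norm \<xi>)\<^sup>2 * (partial_fourier f v \<xi> * A v))) \<partial>lborel)"
  proof (cases "integrable lborel (\<lambda>v. complex_of_real ((norm \<xi>)\<^sup>2) * (partial_fourier f v \<xi> * A v))")
    case True
    then show ?thesis
      by (rule integral_norm_bound_ennreal)
  next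
    \<comment> \<open>The Bochner integral of a function that is not integrable is 0 by
      convention.\<close>
    case False
    show ?thesis
      unfolding not_integrable_integral_eq[OF False] by simp
  qed
  also have "\<dots> \<le> (\<integral>\<^sup>+v. ennreal (\<tau> / 2) * ennreal ((cmod (partial_fourier f v \<xi>))\<^sup>2) +
      ennreal C * ennreal (exp (- 1 * (norm v)\<^sup>2 / 2) * (cmod (A v))\<^sup>2) \<partial>lborel)"
  proof (rule nn_integral_mono)
    fix v
    have "ennreal (cmod ((norm \<xi>)\<^sup>2 * (partial_fourier f v \<xi> * A v))) = ennreal ((norm \<xi>)\<^sup>2 * cmod (partial_fourier f v \<xi> * A v))"
      by (simp add: norm_mult norm_power)
    also have "\<dots> \<le> ennreal (\<tau> / 2 * (cmod (partial_fourier f v \<xi>))\<^sup>2 + C * (exp (- 1 * (norm v)\<^sup>2 / 2) * (cmod (A v))\<^sup>2))"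
      by (rule ennreal_leI[OF pw])
    also have "\<dots> = ennreal (\<tau> / 2) * ennreal ((cmod (partial_fourier f v \<xi>))\<^sup>2) +
      ennreal C * ennreal (exp (- 1 * (norm v)\<^sup>2 / 2) * (cmod (A v))\<^sup>2)"
      using \<tau> C by (intro ennreal_lincomb) auto
    finally show "ennreal (cmod ((norm \<xi>)\<^sup>2 * (partial_fourier f v \<xi> * A v))) \<le> \<dots>" .
  qed
  also have "\<dots> = ennreal (\<tau> / 2) * (\<integral>\<^sup>+v. ennreal ((cmod (partial_fourier f v \<xi>))\<^sup>2) \<partial>lborel) +
      ennreal C * (\<integral>\<^sup>+v. ennreal (exp (- 1 * (norm v)\<^sup>2 / 2) * (cmod (A v))\<^sup>2) \<partial>lborel)"
    by (simp add: nn_integral_add nn_integral_cmult)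
  also have "\<dots> \<le> ennreal (\<tau> / 2) * (\<integral>\<^sup>+v. ennreal ((cmod (partial_fourier f v \<xi>))\<^sup>2) \<partial>lborel) +
      ennreal C * (ennreal ((2 * pi / norm \<xi>) ^ DIM(complex \<times> complex)) * (\<integral>\<^sup>+w. ennreal ((cmod (partial_fourier h w \<xi>))\<^sup>2) \<partial>lborel))"
    unfolding A_def
    by (intro add_left_mono mult_left_mono bessel_gaussian[OF integrable_partial_fourier[OF h]] n norm_ctwist_diff) simp_all
  also have "ennreal C * (ennreal ((2 * pi / norm \<xi>) ^ DIM(complex \<times> complex)) * (\<integral>\<^sup>+w. ennreal ((cmod (partial_fourier h w \<xi>))\<^sup>2) \<partial>lborel))
    = ennreal (exp (R\<^sup>2 / 2) * (2 * pi) ^ 4 / (2 * \<tau>)) * (\<integral>\<^sup>+w. ennreal ((cmod (partial_fourier h w \<xi>))\<^sup>2) \<partial>lborel)"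
  proof -
    \<comment> \<open>The real dimension of \<open>complex \<times> complex\<close> is 4, which
      matches the fourth power of \<open>norm \<xi>\<close> in \<open>C\<close>.\<close>
    have "C * (2 * pi / norm \<xi>) ^ DIM(complex \<times> complex) = exp (R\<^sup>2 / 2) * (2 * pi) ^ 4 / (2 * \<tau>)"
      using n by (simp add: C_def power_divide)
    then show ?thesis
      using C by (simp add: mult.assoc[symmetric] ennreal_mult[symmetric])
  qed
  finally show ?thesis .
qed simp

end

text \<open>By Cauchy-Schwarz the square of \<open>\<xi> \<bullet> s\<close> yields the factor
  \<open>(norm s)\<^sup>2\<close> and the factor \<open>(norm \<xi>)\<^sup>2\<close> that
  \<open>fourier_overlap_bound\<close> absorbs. The pointwise bound is then integrated over
  \<open>\<xi>\<close> by \<open>partial_fourier_bessel\<close>. Since \<open>\<tau>\<close> stays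
  free, a small \<open>m\<close> can make the whole bound small compared to
  \<open>(norm s)\<^sup>2\<close>.\<close>

lemma second_difference_overlap:
  fixes f h :: "affine_point \<Rightarrow> real" and R :: real
  assumes f: "f \<in> borel_measurable borel" "\<And>x. 0 \<le> f x" "\<And>x. f x \<le> 1" "\<And>x. x \<notin> cball 0 R \<Longrightarrow> f x = 0"
    and h: "h \<in> borel_measurable borel" "\<And>x. 0 \<le> h x" "\<And>x. h x \<le> 1" "\<And>x. x \<notin> cball 0 R \<Longrightarrow> h x = 0"
    and cont: "\<And>z. isCont (overlap f h) z" and \<tau>: "\<tau> > 0"
    and m: "(\<integral>\<^sup>+x. ennreal ((f x)\<^sup>2) \<partial>lborel) \<le> ennreal m" "0 \<le> m"
  shows "\<bar>overlap f h s + overlap f h (- s) - 2 * overlap f h 0\<bar> \<le>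
    (norm s)\<^sup>2 * (\<tau> / 2 * m + exp (R\<^sup>2 / 2) * (2 * pi) ^ 4 / (2 * \<tau>) *
      measure lborel (cball (0::affine_point) R))"
proof -
  define C where "C = exp (R\<^sup>2 / 2) * (2 * pi) ^ 4 / (2 * \<tau>)"
  define vol where "vol = measure lborel (cball (0::affine_point) R)"
  have vol: "emeasure lborel (cball (0::affine_point) R) = ennreal vol"
    unfolding vol_def using emeasure_bounded_finite[OF bounded_cball, of "0::affine_point" R]
    by (intro emeasure_eq_ennreal_measure) auto
  have C: "C \<ge> 0"
    using \<tau> by (simp add: C_def)
  have vol0: "vol \<ge> 0"
    by (simp add: vol_def)
  have fb: "\<bar>f x\<bar> \<le> 1" for x
    using f(2,3)[of x] by simp
  have hb: "\<bar>h x\<bar> \<le> 1" for x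
    using h(2,3)[of x] by simp
  \<comment> \<open>The factor \<open>(2 * pi)\<^sup>2\<close> comes from
    \<open>partial_fourier_bessel\<close> in the complex plane and is divided out again by the
    inversion constant of \<open>second_difference_fourier\<close>.\<close>
  define K where "K = (2 * pi)\<^sup>2 * ((norm s)\<^sup>2 * (\<tau> / 2 * m + C * vol))"
  have K: "K \<ge> 0"
    using \<tau> C m(2) vol0 by (simp add: K_def)
  let ?N = "\<lambda>g \<xi>. \<integral>\<^sup>+v. ennreal ((cmod (partial_fourier g v \<xi>))\<^sup>2) \<partial>lborel"
  have Nm[measurable]: "?N g \<in> borel_measurable borel" if g: "g \<in> borel_measurable borel" for g :: "affine_point \<Rightarrow> real"
  proof -
    have [measurable]: "(\<lambda>p. partial_fourier g (fst p) (snd p)) \<in> borel_measurable (borel \<Otimes>\<^sub>M borel)"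
      using borel_measurable_partial_fourier[OF g] by (simp add: borel_prod)
    have "(\<lambda>p. (snd p, fst p)) \<in> measurable (borel \<Otimes>\<^sub>M borel) ((borel :: (complex \<times> complex) measure) \<Otimes>\<^sub>M (borel :: complex measure))"
      by measurable
    from measurable_compose[OF this, of "\<lambda>p. partial_fourier g (fst p) (snd p)" borel]
    have [measurable]: "(\<lambda>p. partial_fourier g (snd p) (fst p)) \<in> borel_measurable (borel \<Otimes>\<^sub>M borel)"
      by simp
    have "(\<lambda>(\<xi>, v). ennreal ((cmod (partial_fourier g v \<xi>))\<^sup>2)) \<in> borel_measurable (lborel \<Otimes>\<^sub>M lborel)"
      unfolding split_beta by measurable
    then have "?N g \<in> borel_measurable lborel"
      by (rule lborel.borel_measurable_nn_integral)
    then show ?thesis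
      by simp
  qed
  have main: "(\<integral>\<^sup>+\<xi>. ennreal (exp (- \<delta> * (norm \<xi>)\<^sup>2 / 2) *
         ((\<xi> \<bullet> s)\<^sup>2 * cmod (\<integral>z. overlap f h z * cis (\<xi> \<bullet> z) \<partial>lborel))) \<partial>lborel) \<le> ennreal K"
    if \<delta>: "\<delta> > 0" for \<delta>
  proof -
    let ?g = "\<lambda>\<xi>::complex. exp (- \<delta> * (norm \<xi>)\<^sup>2 / 2)"
    let ?b = "\<lambda>\<xi>. cmod (\<integral>z. overlap f h z * cis (\<xi> \<bullet> z) \<partial>lborel)"
    have "(\<integral>\<^sup>+\<xi>. ennreal (?g \<xi> * ((\<xi> \<bullet> s)\<^sup>2 * ?b \<xi>)) \<partial>lborel) \<le>
      (\<integral>\<^sup>+\<xi>. ennreal ((norm s)\<^sup>2) * (ennreal (\<tau> / 2) * (ennreal (?g \<xi>) * ?N f \<xi>)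
         + ennreal C * (ennreal (?g \<xi>) * ?N h \<xi>)) \<partial>lborel)"
    proof (rule nn_integral_mono)
      fix \<xi> :: complex
      have "\<bar>\<xi> \<bullet> s\<bar> \<le> norm \<xi> * norm s"
        by (rule Cauchy_Schwarz_ineq2)
      then have "(\<xi> \<bullet> s)\<^sup>2 \<le> (norm \<xi> * norm s)\<^sup>2"
        by (intro abs_le_square_iff[THEN iffD1]) simp
      then have "?g \<xi> * ((\<xi> \<bullet> s)\<^sup>2 * ?b \<xi>) \<le> ?g \<xi> * ((norm \<xi> * norm s)\<^sup>2 * ?b \<xi>)"
        by (intro mult_left_mono mult_right_mono) auto
      also have "\<dots> = (norm s)\<^sup>2 * ?g \<xi> * ((norm \<xi>)\<^sup>2 * ?b \<xi>)"
        by (simp add: power_mult_distrib mult_ac)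
      finally have "ennreal (?g \<xi> * ((\<xi> \<bullet> s)\<^sup>2 * ?b \<xi>)) \<le> ennreal ((norm s)\<^sup>2 * ?g \<xi> * ((norm \<xi>)\<^sup>2 * ?b \<xi>))"
        by (rule ennreal_leI)
      also have "\<dots> = ennreal ((norm s)\<^sup>2) * ennreal (?g \<xi>) * ennreal ((norm \<xi>)\<^sup>2 * ?b \<xi>)"
        by (simp add: ennreal_mult)
      also have "\<dots> \<le> ennreal ((norm s)\<^sup>2) * ennreal (?g \<xi>) *
          (ennreal (\<tau> / 2) * ?N f \<xi> + ennreal C * ?N h \<xi>)"
        unfolding C_def by (intro mult_left_mono fourier_overlap_bound[OF f h \<tau>] zero_le)
      also have "\<dots> = ennreal ((norm s)\<^sup>2) * (ennreal (\<tau> / 2) * (ennreal (?g \<xi>) * ?N f \<xi>)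
         + ennreal C * (ennreal (?g \<xi>) * ?N h \<xi>))"
        by (simp only: distrib_left mult_ac)
      finally show "ennreal (?g \<xi> * ((\<xi> \<bullet> s)\<^sup>2 * ?b \<xi>)) \<le> \<dots>" .
    qed
    also have "\<dots> = ennreal ((norm s)\<^sup>2) * (ennreal (\<tau> / 2) * (\<integral>\<^sup>+\<xi>. ennreal (?g \<xi>) * ?N f \<xi> \<partial>lborel)
         + ennreal C * (\<integral>\<^sup>+\<xi>. ennreal (?g \<xi>) * ?N h \<xi> \<partial>lborel))"
      using Nm[OF f(1)] Nm[OF h(1)] by (simp add: nn_integral_cmult nn_integral_add)
    also have "\<dots> \<le> ennreal ((norm s)\<^sup>2) * (ennreal (\<tau> / 2) * (ennreal ((2 * pi) ^ DIM(complex)) * ennreal m)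
         + ennreal C * (ennreal ((2 * pi) ^ DIM(complex)) * ennreal vol))"
      unfolding vol[symmetric]
      by (intro mult_left_mono add_mono partial_fourier_bessel(1)[OF h(1) hb h(4) \<delta>]
          order_trans[OF partial_fourier_bessel(2)[OF f(1) fb f(4) \<delta>]] m(1)) simp_all
    also have "\<dots> = ennreal K"
      using \<tau> C m(2) vol0 unfolding K_def
      by (simp add: ennreal_mult[symmetric] ennreal_plus[symmetric] algebra_simps del: ennreal_plus)
    finally show ?thesis .
  qed
  have "\<bar>overlap f h s + overlap f h (- s) - 2 * overlap f h 0\<bar> \<le> K / (2 * pi) ^ DIM(complex)"
  proof (rule second_difference_fourier[OF integrable_overlap[OF f h] _ cont K main])
    fix z
    show "\<bar>overlap f h z\<bar> \<le> measure lborel (cball (0::complex \<times> complex) R \<times> cball (0::affine_point) R)"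
      using overlap_le[OF f h, where z=z] overlap_nonneg[OF f h, where z=z] by simp
  qed
  also have "\<dots> = (norm s)\<^sup>2 * (\<tau> / 2 * m + C * vol)"
    by (simp add: K_def)
  finally show ?thesis
    by (simp add: C_def vol_def)
qed

text \<open>For fixed \<open>v\<close> and \<open>w\<close>, Bob's last coordinate is sent to
  Alice's by a reflection and a translation, which preserve Lebesgue measure. So the measure of the
  parameters that put Alice's point into a given set is known and does not depend on
  \<open>z\<close>.\<close>

lemma nn_integral_overlap_point:
  fixes g :: "complex \<times> complex \<Rightarrow> ennreal" and F :: "affine_point \<Rightarrow> ennreal"
  assumes [measurable]: "g \<in> borel_measurable borel" and F[measurable]: "F \<in> borel_measurable borel"
  shows "(\<integral>\<^sup>+p. g (fst (snd p)) * F (overlap_point (z, p)) \<partial>lborel) = (\<integral>\<^sup>+w. g w \<partial>lborel) * (\<integral>\<^sup>+x. F x \<partial>lborel)"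
proof -
  have m1: "(\<lambda>p. (z, p)) \<in> borel_measurable borel" "(\<lambda>p. fst (snd p)) \<in> borel_measurable borel"
    for z :: complex and p :: "(complex \<times> complex) \<times> affine_point"
    by (intro borel_measurable_continuous_onI continuous_intros)+
  have Fm: "(\<lambda>p. F (overlap_point (z, p))) \<in> borel_measurable borel"
    by (rule measurable_compose[OF measurable_compose[OF m1(1) measurable_overlap_point] F])
  have gm: "(\<lambda>p::(complex \<times> complex) \<times> affine_point. g (fst (snd p))) \<in> borel_measurable borel"
    by (rule measurable_compose[OF m1(2)]) simp
  have gFm: "(\<lambda>p. g (fst (snd p)) * F (overlap_point (z, p))) \<in> borel_measurable borel"
    by (intro borel_measurable_times_ennreal gm Fm)
  have slice: "(\<lambda>y. g (fst y) * F (overlap_point (z, (v, y)))) \<in> borel_measurable borel" for v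
  proof -
    have "(\<lambda>y::affine_point. (v, y)) \<in> borel_measurable borel"
      by (intro borel_measurable_continuous_onI continuous_intros)
    from measurable_compose[OF this gFm] show ?thesis
      by simp
  qed
  have Fv[measurable]: "(\<lambda>c. F (v, c)) \<in> borel_measurable borel" for v
    by (rule measurable_compose[OF _ F]) (intro borel_measurable_continuous_onI continuous_intros)
  have FP: "F \<in> borel_measurable (lborel \<Otimes>\<^sub>M lborel)"
    by (simp add: lborel_prod)
  have [measurable]: "(\<lambda>v. \<integral>\<^sup>+c. F (v, c) \<partial>lborel) \<in> borel_measurable borel"
    using lborel.borel_measurable_nn_integral_fst[OF FP] by simp
  have flip: "(\<integral>\<^sup>+c. F (v, k - c) \<partial>lborel) = (\<integral>\<^sup>+c. F (v, c) \<partial>lborel)" for v k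
    using nn_integral_lborel_uminus[of "\<lambda>c. F (v, k + c)"] nn_integral_lborel_shift[of "\<lambda>c. F (v, c)" k]
    by simp
  have "(\<integral>\<^sup>+p. g (fst (snd p)) * F (overlap_point (z, p)) \<partial>lborel)
      = (\<integral>\<^sup>+v. \<integral>\<^sup>+y. g (fst y) * F (overlap_point (z, (v, y))) \<partial>lborel \<partial>lborel)"
    using lborel.nn_integral_fst[of "\<lambda>p. g (fst (snd p)) * F (overlap_point (z, p))" lborel] gFm
    by (simp add: lborel_prod)
  also have "\<dots> = (\<integral>\<^sup>+v. \<integral>\<^sup>+w. \<integral>\<^sup>+c. g w * F (v, z - cdot v w - c) \<partial>lborel \<partial>lborel \<partial>lborel)"
  proof (rule nn_integral_cong)
    fix v :: "complex \<times> complex"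
    show "(\<integral>\<^sup>+y. g (fst y) * F (overlap_point (z, (v, y))) \<partial>lborel)
      = (\<integral>\<^sup>+w. \<integral>\<^sup>+c. g w * F (v, z - cdot v w - c) \<partial>lborel \<partial>lborel)"
      using lborel.nn_integral_fst[of "\<lambda>y. g (fst y) * F (overlap_point (z, (v, y)))" lborel] slice[of v]
      by (simp add: lborel_prod overlap_point_def)
  qed
  also have "\<dots> = (\<integral>\<^sup>+v. \<integral>\<^sup>+w. g w * (\<integral>\<^sup>+c. F (v, c) \<partial>lborel) \<partial>lborel \<partial>lborel)"
  proof (intro nn_integral_cong)
    fix v w :: "complex \<times> complex"
    have "(\<lambda>c. F (v, z - cdot v w - c)) \<in> borel_measurable borel"
      by measurable
    then show "(\<integral>\<^sup>+c. g w * F (v, z - cdot v w - c) \<partial>lborel) = g w * (\<integral>\<^sup>+c. F (v, c) \<partial>lborel)"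
      by (simp add: nn_integral_cmult flip)
  qed
  also have "\<dots> = (\<integral>\<^sup>+w. g w \<partial>lborel) * (\<integral>\<^sup>+v. \<integral>\<^sup>+c. F (v, c) \<partial>lborel \<partial>lborel)"
    by (simp add: nn_integral_multc nn_integral_cmult)
  also have "(\<integral>\<^sup>+v. \<integral>\<^sup>+c. F (v, c) \<partial>lborel \<partial>lborel) = (\<integral>\<^sup>+x. F x \<partial>lborel)"
    using lborel.nn_integral_fst[OF FP] by (simp add: lborel_prod)
  finally show ?thesis .
qed

text \<open>Changing \<open>z\<close> translates Alice's point in its last coordinate. The overlap
  therefore changes by at most the measure of the points whose membership in \<open>E\<close> is
  altered, times the volume available to \<open>w\<close>.\<close>

lemma isCont_overlap_indicator:
  fixes h :: "affine_point \<Rightarrow> real"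
  assumes E: "E \<in> sets borel" "E \<subseteq> cball 0 R"
    and h: "h \<in> borel_measurable borel" "\<And>x. 0 \<le> h x" "\<And>x. h x \<le> 1" "\<And>x. x \<notin> cball 0 R \<Longrightarrow> h x = 0"
  shows "isCont (overlap (indicator E) h) z"
proof -
  let ?f = "indicator E :: affine_point \<Rightarrow> real"
  let ?b = "overlap ?f h"
  have [measurable]: "E \<in> sets borel"
    by (rule E(1))
  have f: "?f \<in> borel_measurable borel" "\<And>x. 0 \<le> ?f x" "\<And>x. ?f x \<le> 1" "\<And>x. x \<notin> cball 0 R \<Longrightarrow> ?f x = 0"
    using E by (auto simp: indicator_def)
  define V where "V = measure lborel (cball (0::complex \<times> complex) R)"
  have V: "emeasure lborel (cball (0::complex \<times> complex) R) = ennreal V" "V \<ge> 0"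
    unfolding V_def using emeasure_bounded_finite[OF bounded_cball, of "0::complex \<times> complex" R]
    by (auto intro: emeasure_eq_ennreal_measure)
  have "bounded E"
    by (rule bounded_subset[OF bounded_cball E(2)])
  show ?thesis
  proof (rule continuous_at_eps_delta[THEN iffD2], intro allI impI)
    fix e :: real assume e: "e > 0"
    \<comment> \<open>The final bound is \<open>V * (2 * e')\<close>; adding 1 to \<open>V\<close>
      makes it strictly smaller than \<open>e\<close> and avoids division by zero.\<close>
    define e' where "e' = e / (2 * (V + 1))"
    have e': "e' > 0"
      using e V(2) by (simp add: e'_def)
    obtain d where d: "d > 0" "\<And>k. norm k < d \<Longrightarrow> emeasure lborel {x \<in> E. x + k \<notin> E} < ennreal e'"
      using bounded_set_translate_small[OF E(1) \<open>bounded E\<close> e'] by blast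
    have "dist (?b z') (?b z) < e" if z': "dist z' z < d" for z'
    proof -
      define k where "k = ((0, z' - z) :: affine_point)"
      have k: "norm k < d" "norm (- k) < d"
        using z' by (auto simp: k_def norm_Pair dist_norm norm_minus_commute)
      define D where "D = {x \<in> E. x + k \<notin> E} \<union> {x. x \<notin> E \<and> x + k \<in> E}"
      have [measurable]: "{x \<in> E. x + k \<notin> E} \<in> sets borel" "{x. x \<notin> E \<and> x + k \<in> E} \<in> sets borel"
        by measurable
      have D: "emeasure lborel D \<le> ennreal (2 * e')"
      proof -
        \<comment> \<open>The points that enter \<open>E\<close> under the shift by \<open>k\<close>
          are a translate of the points that leave \<open>E\<close> under the shift by
          \<open>- k\<close>.\<close>
        have "emeasure lborel {x. x \<notin> E \<and> x + k \<in> E} = (\<integral>\<^sup>+x. indicator {x \<in> E. x + (- k) \<notin> E} (k + x) \<partial>lborel)"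
          by (subst nn_integral_indicator[symmetric])
            (measurable, rule nn_integral_cong, auto simp: indicator_def add.commute)
        also have "\<dots> = emeasure lborel {x \<in> E. x + (- k) \<notin> E}"
        proof -
          have [measurable]: "{x \<in> E. x + (- k) \<notin> E} \<in> sets borel"
            by measurable
          show ?thesis
            by (subst nn_integral_lborel_shift) simp_all
        qed
        finally have "emeasure lborel {x. x \<notin> E \<and> x + k \<in> E} \<le> ennreal e'"
          using d(2)[OF k(2)] by simp
        moreover have "emeasure lborel D \<le> emeasure lborel {x \<in> E. x + k \<notin> E} + emeasure lborel {x. x \<notin> E \<and> x + k \<in> E}"
          unfolding D_def by (rule emeasure_subadditive) simp_all
        ultimately have "emeasure lborel D \<le> ennreal e' + ennreal e'"
          using d(2)[OF k(1)] by (meson add_mono less_imp_le order_trans)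
        then show ?thesis
          using e' by (simp add: ennreal_plus[symmetric] del: ennreal_plus)
      qed
      have Dm: "D \<in> sets borel"
        unfolding D_def by simp
      have diff: "?b z' - ?b z = (\<integral>p. ?f (overlap_point (z', p)) * h (snd p) - ?f (overlap_point (z, p)) * h (snd p) \<partial>lborel)"
        unfolding overlap_def
        by (intro Bochner_Integration.integral_diff[symmetric] integrable_overlap_integrand[where R=R, OF f h])
      have "ennreal (norm (?b z' - ?b z)) \<le> (\<integral>\<^sup>+p. ennreal (norm (?f (overlap_point (z', p)) * h (snd p) - ?f (overlap_point (z, p)) * h (snd p))) \<partial>lborel)"
        unfolding diff
        by (rule integral_norm_bound_ennreal)
          (intro Bochner_Integration.integrable_diff integrable_overlap_integrand[where R=R, OF f h])
      also have "\<dots> \<le> (\<integral>\<^sup>+p. indicator (cball 0 R) (fst (snd p)) * indicator D (overlap_point (z, p)) \<partial>lborel)"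
      proof (rule nn_integral_mono)
        fix p :: "(complex \<times> complex) \<times> affine_point"
        have pt: "overlap_point (z', p) = overlap_point (z, p) + k"
          by (simp add: overlap_point_def k_def)
        show "ennreal (norm (?f (overlap_point (z', p)) * h (snd p) - ?f (overlap_point (z, p)) * h (snd p)))
            \<le> indicator (cball 0 R) (fst (snd p)) * indicator D (overlap_point (z, p))"
        proof (cases "snd p \<in> cball 0 R \<and> overlap_point (z, p) \<in> D")
          case True
          then have "fst (snd p) \<in> cball 0 R"
            using norm_fst_le[of "fst (snd p)" "snd (snd p)"] by auto
          moreover have "norm (?f (overlap_point (z', p)) * h (snd p) - ?f (overlap_point (z, p)) * h (snd p)) \<le> 1"
            using h(2,3)[of "snd p"] by (auto simp: indicator_def)
          ultimately show ?thesis
            using True by simp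
        next
          case False
          then have "?f (overlap_point (z', p)) * h (snd p) - ?f (overlap_point (z, p)) * h (snd p) = 0"
            unfolding pt using h(4)[of "snd p"] by (auto simp: D_def indicator_def)
          then show ?thesis
            by (simp only: norm_zero ennreal_0 zero_le)
        qed
      qed
      also have "\<dots> = emeasure lborel (cball (0::complex \<times> complex) R) * emeasure lborel D"
      proof (subst nn_integral_overlap_point)
        show "indicator (cball 0 R) \<in> borel_measurable (borel :: (complex \<times> complex) measure)"
          by (intro borel_measurable_indicator borel_closed closed_cball)
      qed (use Dm in simp_all)
      also have "\<dots> \<le> ennreal V * ennreal (2 * e')"
        unfolding V(1) by (intro mult_left_mono D zero_le)
      also have "\<dots> = ennreal (V * (2 * e'))"
        using V(2) e' by (simp add: ennreal_mult)
      finally have "norm (?b z' - ?b z) \<le> V * (2 * e')"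
        using V(2) e' by (simp add: ennreal_le_iff)
      also have "\<dots> < e"
      proof -
        have "V * (2 * e') = e * (V / (V + 1))"
          using V(2) by (simp add: e'_def divide_simps)
        also have "\<dots> < e * 1"
          using V(2) by (intro mult_strict_left_mono e) simp
        finally show ?thesis
          by simp
      qed
      finally show ?thesis
        by (simp add: dist_norm)
    qed
    then show "\<exists>d>0. \<forall>x'. dist x' z < d \<longrightarrow> dist (?b x') (?b z) < e"
      using d(1) by blast
  qed
qed

text \<open>
  A point of \<open>E\<close> that contributes to the overlap at \<open>s\<close> leaves \<open>E\<close> when it is moved by \<open>s\<close>,
  because there is no overlap at 0. Only these few points matter, and for them
  the overlap at \<open>s\<close> is at most the second difference.
\<close>

lemma overlap_indicator_le:
  fixes h :: "affine_point \<Rightarrow> real"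
  assumes E: "E \<in> sets borel" "E \<subseteq> cball 0 R"
    and h: "h \<in> borel_measurable borel" "\<And>x. 0 \<le> h x" "\<And>x. h x \<le> 1" "\<And>x. x \<notin> cball 0 R \<Longrightarrow> h x = 0"
    and zero: "overlap (indicator E) h 0 = 0" and \<tau>: "\<tau> > 0"
    and m: "emeasure lborel {x \<in> E. x + (0, - s) \<notin> E} \<le> ennreal m" "0 \<le> m"
  shows "overlap (indicator E) h s \<le>
    (norm s)\<^sup>2 * (\<tau> / 2 * m + exp (R\<^sup>2 / 2) * (2 * pi) ^ 4 / (2 * \<tau>) *
      measure lborel (cball (0::affine_point) R))"
proof -
  define E' where "E' = {x \<in> E. x + (0, - s) \<notin> E}"
  let ?f = "indicator E :: affine_point \<Rightarrow> real"
  let ?f' = "indicator E' :: affine_point \<Rightarrow> real"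
  have [measurable]: "E \<in> sets borel"
    by (rule E(1))
  have E': "E' \<in> sets borel" "E' \<subseteq> cball 0 R"
    unfolding E'_def using E(2) by auto
  have f: "?f \<in> borel_measurable borel" "\<And>x. 0 \<le> ?f x" "\<And>x. ?f x \<le> 1" "\<And>x. x \<notin> cball 0 R \<Longrightarrow> ?f x = 0"
    using E by (auto simp: indicator_def)
  have f': "?f' \<in> borel_measurable borel" "\<And>x. 0 \<le> ?f' x" "\<And>x. ?f' x \<le> 1" "\<And>x. x \<notin> cball 0 R \<Longrightarrow> ?f' x = 0"
    using E' by (auto simp: indicator_def)
  have "(\<integral>\<^sup>+p. ennreal (?f (overlap_point (0, p)) * h (snd p)) \<partial>lborel) = 0"
    using ennreal_overlap[where R=R and z=0, OF f h] zero by simp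
  then have AE0: "AE p in lborel. ?f (overlap_point (0, p)) * h (snd p) = 0"
    using measurable_overlap_integrand(2)[OF f(1) h(1), of 0] f(2) h(2)
    by (subst (asm) nn_integral_0_iff_AE) (auto simp: ennreal_eq_0_iff mult_le_0_iff elim!: eventually_mono intro: antisym)
  have "overlap ?f h s \<le> overlap ?f' h s"
    unfolding overlap_def
  proof (rule integral_mono_AE[OF integrable_overlap_integrand[OF f h] integrable_overlap_integrand[OF f' h]])
    show "AE p in lborel. ?f (overlap_point (s, p)) * h (snd p) \<le> ?f' (overlap_point (s, p)) * h (snd p)"
      using AE0
    proof eventually_elim
      fix p assume p: "?f (overlap_point (0, p)) * h (snd p) = 0"
      \<comment> \<open>If the point at parameter \<open>s\<close> lies in \<open>E\<close> and
        \<open>h\<close> is nonzero at \<open>snd p\<close>, then the point at parameter 0 is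
        outside \<open>E\<close>, so the former already belongs to \<open>E'\<close>.\<close>
      have "overlap_point (0, p) = overlap_point (s, p) + (0, - s)"
        by (simp add: overlap_point_def)
      then show "?f (overlap_point (s, p)) * h (snd p) \<le> ?f' (overlap_point (s, p)) * h (snd p)"
        using p h(2)[of "snd p"] by (auto simp: E'_def indicator_def)
    qed
  qed
  also have "overlap ?f' h s \<le> \<bar>overlap ?f' h s + overlap ?f' h (- s) - 2 * overlap ?f' h 0\<bar>"
  proof -
    \<comment> \<open>The reduced set inherits the vanishing overlap at 0, and its overlap at
      \<open>- s\<close> is nonnegative.\<close>
    have "overlap ?f' h 0 \<le> overlap ?f h 0"
      unfolding overlap_def
    proof (rule integral_mono[OF integrable_overlap_integrand[OF f' h] integrable_overlap_integrand[OF f h]])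
      fix p :: "(complex \<times> complex) \<times> affine_point"
      show "?f' (overlap_point (0, p)) * h (snd p) \<le> ?f (overlap_point (0, p)) * h (snd p)"
        using h(2)[of "snd p"] by (intro mult_right_mono) (auto simp: E'_def indicator_def)
    qed
    then show ?thesis
      using zero overlap_nonneg[where R=R and z="- s", OF f' h] overlap_nonneg[where R=R and z=0, OF f' h] by simp
  qed
  also have "\<dots> \<le> (norm s)\<^sup>2 * (\<tau> / 2 * m + exp (R\<^sup>2 / 2) * (2 * pi) ^ 4 / (2 * \<tau>) *
      measure lborel (cball (0::affine_point) R))"
  proof (rule second_difference_overlap[OF f' h isCont_overlap_indicator[OF E' h] \<tau> _ m(2)])
    have "(\<integral>\<^sup>+x. ennreal ((?f' x)\<^sup>2) \<partial>lborel) = (\<integral>\<^sup>+x. indicator E' x \<partial>lborel)"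
      by (intro nn_integral_cong) (simp add: indicator_def)
    also have "\<dots> = emeasure lborel E'"
      using E'(1) by simp
    finally show "(\<integral>\<^sup>+x. ennreal ((?f' x)\<^sup>2) \<partial>lborel) \<le> ennreal m"
      using m(1) by (simp add: E'_def)
  qed
  finally show ?thesis .
qed

text \<open>This is the preceding estimate with \<open>\<tau> = 1\<close> and \<open>m\<close> the
  volume of the ball. The constant depends on \<open>R\<close> alone, so it provides the bound for
  dominated convergence over the hidden variable.\<close>

lemma overlap_indicator_quadratic:
  fixes h :: "affine_point \<Rightarrow> real"
  assumes E: "E \<in> sets borel" "E \<subseteq> cball 0 R"
    and h: "h \<in> borel_measurable borel" "\<And>x. 0 \<le> h x" "\<And>x. h x \<le> 1" "\<And>x. x \<notin> cball 0 R \<Longrightarrow> h x = 0"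
    and zero: "overlap (indicator E) h 0 = 0"
  shows "overlap (indicator E) h s \<le> (1 + exp (R\<^sup>2 / 2) * (2 * pi) ^ 4) / 2 *
    measure lborel (cball (0::affine_point) R) * (norm s)\<^sup>2"
proof -
  define vol where "vol = measure lborel (cball (0::affine_point) R)"
  have vol: "emeasure lborel (cball (0::affine_point) R) = ennreal vol"
    unfolding vol_def using emeasure_bounded_finite[OF bounded_cball, of "0::affine_point" R]
    by (intro emeasure_eq_ennreal_measure) auto
  have "emeasure lborel {x \<in> E. x + (0, - s) \<notin> E} \<le> ennreal vol"
    unfolding vol[symmetric] using E by (intro emeasure_mono) auto
  from overlap_indicator_le[OF E h zero zero_less_one this]
  have "overlap (indicator E) h s \<le>
      (norm s)\<^sup>2 * (1 / 2 * vol + exp (R\<^sup>2 / 2) * (2 * pi) ^ 4 / (2 * 1) * vol)"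
    by (simp add: vol_def)
  also have "\<dots> = (1 + exp (R\<^sup>2 / 2) * (2 * pi) ^ 4) / 2 * vol * (norm s)\<^sup>2"
    by (simp add: algebra_simps)
  finally show ?thesis
    by (simp only: vol_def)
qed

text \<open>First \<open>\<tau>\<close> is taken so large that Bob's term is small; then, with
  \<open>\<tau>\<close> fixed, the measure of the points leaving \<open>E\<close> tends to 0 with
  \<open>s\<close> and makes Alice's term small.\<close>

lemma overlap_indicator_small:
  fixes h :: "affine_point \<Rightarrow> real"
  assumes E: "E \<in> sets borel" "E \<subseteq> cball 0 R"
    and h: "h \<in> borel_measurable borel" "\<And>x. 0 \<le> h x" "\<And>x. h x \<le> 1" "\<And>x. x \<notin> cball 0 R \<Longrightarrow> h x = 0"
    and zero: "overlap (indicator E) h 0 = 0"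
    and s: "s \<longlonglongrightarrow> 0" "\<And>n. s n \<noteq> 0"
  shows "(\<lambda>n. overlap (indicator E) h (s n) / (norm (s n))\<^sup>2) \<longlonglongrightarrow> 0"
proof (rule LIMSEQ_I)
  let ?f = "indicator E :: affine_point \<Rightarrow> real"
  fix e :: real assume e: "e > 0"
  define B where "B = exp (R\<^sup>2 / 2) * (2 * pi) ^ 4 * measure lborel (cball (0::affine_point) R)"
  have B: "B \<ge> 0"
    by (simp add: B_def)
  \<comment> \<open>With this choice \<open>B / (2 * \<tau>)\<close> is below \<open>e / 2\<close>;
    the summand 1 gives strictness and keeps \<open>\<tau>\<close> positive if
    \<open>B = 0\<close>.\<close>
  define \<tau> where "\<tau> = (B + 1) / e"
  have \<tau>: "\<tau> > 0"
    using B e by (simp add: \<tau>_def)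
  have f: "?f \<in> borel_measurable borel" "\<And>x. 0 \<le> ?f x" "\<And>x. ?f x \<le> 1" "\<And>x. x \<notin> cball 0 R \<Longrightarrow> ?f x = 0"
    using E by (auto simp: indicator_def)
  \<comment> \<open>Alice's term \<open>\<tau> / 2 * m\<close> becomes exactly
    \<open>e / 2\<close>.\<close>
  define m where "m = e / \<tau>"
  have m: "m > 0"
    using e \<tau> by (simp add: m_def)
  obtain d where d: "d > 0" "\<And>k. norm k < d \<Longrightarrow> emeasure lborel {x \<in> E. x + k \<notin> E} < ennreal m"
    using bounded_set_translate_small[OF E(1) bounded_subset[OF bounded_cball E(2)] m] by blast
  obtain N where N: "\<And>n. n \<ge> N \<Longrightarrow> norm (s n) < d"
    using LIMSEQ_D[OF s(1) d(1)] by auto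
  have "norm (overlap ?f h (s n) / (norm (s n))\<^sup>2 - 0) < e" if n: "n \<ge> N" for n
  proof -
    have "norm ((0, - s n) :: affine_point) < d"
      using N[OF n] by (simp add: norm_Pair)
    from overlap_indicator_le[OF E h zero \<tau> less_imp_le[OF d(2)[OF this]] less_imp_le[OF m]]
    have "overlap ?f h (s n) \<le> (norm (s n))\<^sup>2 * (\<tau> / 2 * m + B / (2 * \<tau>))"
      by (simp add: B_def mult_ac)
    also have "\<dots> < (norm (s n))\<^sup>2 * e"
    proof (rule mult_strict_left_mono)
      have "B / (2 * \<tau>) = e / 2 * (B / (B + 1))"
        using e B by (simp add: \<tau>_def field_simps)
      also have "\<dots> < e / 2 * 1"
        using e B by (intro mult_strict_left_mono) auto
      finally show "\<tau> / 2 * m + B / (2 * \<tau>) < e"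
        using \<tau> by (simp add: m_def)
    qed (use s(2)[of n] in simp)
    finally have "overlap ?f h (s n) / (norm (s n))\<^sup>2 < e"
      using s(2)[of n] by (simp add: pos_divide_less_eq mult.commute)
    then show ?thesis
      using overlap_nonneg[where R=R and z="s n", OF f h] by simp
  qed
  then show "\<exists>N. \<forall>n\<ge>N. norm (overlap ?f h (s n) / (norm (s n))\<^sup>2 - 0) < e"
    by blast
qed

section \<open>From small overlaps to the impossibility of a simulation\<close>

text \<open>Here \<open>a c x l\<close> stands for the probability that Alice succeeds and sends
  \<open>c\<close>, and \<open>b c y l\<close> for Bob's success probability given \<open>c\<close>.
  The overlaps vanish at 0 for almost every hidden variable. Divided by
  \<open>(norm s)\<^sup>2\<close>, their sum over the messages tends to 0 in mean, whereas the
  prescribed statistics keep its mean above a positive constant.\<close>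

lemma bilinear_square_not_simulable:
  fixes \<mu> :: "'l measure" and C :: "'c set"
    and a b :: "'c \<Rightarrow> affine_point \<Rightarrow> 'l \<Rightarrow> real"
  assumes \<mu>: "prob_space \<mu>" and C: "finite C" and D: "D > 0"
    and am: "\<And>c. c \<in> C \<Longrightarrow> (\<lambda>(x, l). a c x l) \<in> borel_measurable (borel \<Otimes>\<^sub>M \<mu>)"
    and bm: "\<And>c. c \<in> C \<Longrightarrow> (\<lambda>(y, l). b c y l) \<in> borel_measurable (borel \<Otimes>\<^sub>M \<mu>)"
    and a: "\<And>c x l. c \<in> C \<Longrightarrow> l \<in> space \<mu> \<Longrightarrow> 0 \<le> a c x l \<and> a c x l \<le> 1"
    and b: "\<And>c y l. c \<in> C \<Longrightarrow> l \<in> space \<mu> \<Longrightarrow> 0 \<le> b c y l \<and> b c y l \<le> 1"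
    and sim: "\<And>x y. (\<integral>l. (\<Sum>c\<in>C. a c x l * b c y l) \<partial>\<mu>) =
        (norm (snd x + cdot (fst x) (fst y) + snd y))\<^sup>2 / (D * (1 + (norm x)\<^sup>2) * (1 + (norm y)\<^sup>2))"
  shows False
proof -
  interpret prob_space \<mu> by fact
  let ?B = "cball 0 1 :: (affine_point) set"
  let ?W = "cball 0 1 :: (complex \<times> complex) set"
  \<comment> \<open>Alice's point and \<open>w\<close> will be kept in unit balls. For
    \<open>norm z \<le> 1\<close> Bob's last coordinate then has norm at most 4, so his point lies
    well inside radius 6.\<close>
  let ?Y = "cball 0 6 :: (affine_point) set"
  have BY[measurable]: "?B \<in> sets borel" "?Y \<in> sets borel" "?W \<in> sets borel"
    by (intro borel_closed closed_cball)+
  \<comment> \<open>The translation argument is about sets, so \<open>a\<close> is replaced by the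
    indicator of its positivity set. This preserves the vanishing of products with \<open>b\<close>
    and, as \<open>a\<close> is at most 1, only enlarges the overlap.\<close>
  define E where "E = (\<lambda>c l. {x \<in> ?B. 0 < a c x l})"
  define h where "h = (\<lambda>c l y. indicator ?Y y * b c y l :: real)"
  have sec: "(\<lambda>x. (x, l)) \<in> measurable (borel :: (affine_point) measure) (borel \<Otimes>\<^sub>M \<mu>)"
    if "l \<in> space \<mu>" for l
    using that by measurable
  have EM: "E c l \<in> sets borel" "E c l \<subseteq> cball 0 6" if "c \<in> C" "l \<in> space \<mu>" for c l
  proof -
    have [measurable]: "(\<lambda>x. a c x l) \<in> borel_measurable borel"
      using measurable_compose[OF sec[OF that(2)] am[OF that(1)]] by simp
    show "E c l \<in> sets borel"
      unfolding E_def by measurable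
    show "E c l \<subseteq> cball 0 6"
      by (auto simp: E_def)
  qed
  have HM: "h c l \<in> borel_measurable borel" "0 \<le> h c l x" "h c l x \<le> 1" "x \<notin> cball 0 6 \<Longrightarrow> h c l x = 0"
    if "c \<in> C" "l \<in> space \<mu>" for c l x
  proof -
    have [measurable]: "(\<lambda>x. b c x l) \<in> borel_measurable borel"
      using measurable_compose[OF sec[OF that(2)] bm[OF that(1)]] by simp
    show "h c l \<in> borel_measurable borel"
      unfolding h_def by (intro borel_measurable_times borel_measurable_indicator BY) fact
  qed (use b[OF that] in \<open>auto simp: h_def indicator_def\<close>)
  have fM: "(indicator (E c l) :: _ \<Rightarrow> real) \<in> borel_measurable borel" "0 \<le> (indicator (E c l) x :: real)"
    "(indicator (E c l) x :: real) \<le> 1" "x \<notin> cball 0 6 \<Longrightarrow> (indicator (E c l) x :: real) = 0"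
    if "c \<in> C" "l \<in> space \<mu>" for c l x
    using EM[OF that] by (auto simp: indicator_def)
  define ov where "ov = (\<lambda>c z l. overlap (indicator (E c l)) (h c l) z)"
  define I where "I = (\<lambda>c z l p. (indicator (E c l) (overlap_point (z, p)) :: real) * h c l (snd p))"
  \<comment> \<open>Joint measurability is inherited from \<open>am\<close> and \<open>bm\<close>;
    Tonelli in \<open>swap\<close> rests on it.\<close>
  have I_meas: "(\<lambda>q. I c z (fst q) (snd q)) \<in> borel_measurable (\<mu> \<Otimes>\<^sub>M lborel)" if c: "c \<in> C" for c z
  proof -
    have "(\<lambda>p. overlap_point (z, p)) \<in> borel_measurable borel"
      by (rule measurable_compose[OF _ measurable_overlap_point]) (intro borel_measurable_continuous_onI continuous_intros)
    then have o[measurable]: "(\<lambda>q. overlap_point (z, snd q)) \<in> measurable (\<mu> \<Otimes>\<^sub>M lborel) borel"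
      using measurable_compose[OF measurable_snd[of \<mu> lborel], of "\<lambda>p. overlap_point (z, p)" borel] by simp
    have "(snd :: (complex \<times> complex) \<times> affine_point \<Rightarrow> _) \<in> borel_measurable borel"
      by (intro borel_measurable_continuous_onI continuous_intros)
    then have s[measurable]: "(\<lambda>q::'l \<times> (complex \<times> complex) \<times> affine_point. snd (snd q)) \<in> measurable (\<mu> \<Otimes>\<^sub>M lborel) borel"
      using measurable_compose[OF measurable_snd[of \<mu> lborel], of snd borel] by simp
    have [measurable]: "(\<lambda>q. a c (overlap_point (z, snd q)) (fst q)) \<in> borel_measurable (\<mu> \<Otimes>\<^sub>M lborel)"
      using measurable_compose[OF measurable_Pair[OF o measurable_fst] am[OF c]] by simp
    have [measurable]: "(\<lambda>q::'l \<times> (complex \<times> complex) \<times> affine_point. b c (snd (snd q)) (fst q)) \<in> borel_measurable (\<mu> \<Otimes>\<^sub>M lborel)"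
      using measurable_compose[OF measurable_Pair[OF s measurable_fst] bm[OF c]] by simp
    have [measurable]: "Measurable.pred (\<mu> \<Otimes>\<^sub>M lborel) (\<lambda>q. overlap_point (z, snd q) \<in> ?B)"
      "Measurable.pred (\<mu> \<Otimes>\<^sub>M lborel) (\<lambda>q::'l \<times> (complex \<times> complex) \<times> affine_point. snd (snd q) \<in> ?Y)"
      by measurable
    have "(\<lambda>q. (if overlap_point (z, snd q) \<in> ?B \<and> 0 < a c (overlap_point (z, snd q)) (fst q) then 1 else 0) *
        ((if snd (snd q) \<in> ?Y then 1 else 0) * b c (snd (snd q)) (fst q))) \<in> borel_measurable (\<mu> \<Otimes>\<^sub>M lborel)"
      by measurable
    then show ?thesis
      by (simp add: I_def E_def h_def indicator_def of_bool_def)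
  qed
  have I0: "0 \<le> I c z l p" if "c \<in> C" "l \<in> space \<mu>" for c z l p
    using HM(2)[OF that] by (simp add: I_def)
  have ov_I: "ov c z l = (\<integral>p. I c z l p \<partial>lborel)" for c z l
    by (simp add: ov_def I_def overlap_def)
  have ov_nn: "ennreal (ov c z l) = (\<integral>\<^sup>+p. ennreal (I c z l p) \<partial>lborel)" if "c \<in> C" "l \<in> space \<mu>" for c z l
    unfolding ov_def I_def
    by (rule ennreal_overlap[where R=6, OF fM[OF that] HM[OF that]])
  have ov0: "0 \<le> ov c z l" if "c \<in> C" "l \<in> space \<mu>" for c z l
    unfolding ov_def
    by (rule overlap_nonneg[where R=6, OF fM[OF that] HM[OF that]])
  have ov_meas[measurable]: "ov c z \<in> borel_measurable \<mu>" if "c \<in> C" for c z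
  proof -
    have "(\<lambda>l. \<integral>p. I c z l p \<partial>lborel) \<in> borel_measurable \<mu>"
      by (rule lborel.borel_measurable_lebesgue_integral) (use I_meas[OF that] in \<open>simp add: split_beta\<close>)
    then show ?thesis
      by (simp add: ov_I[abs_def])
  qed
  have swap: "(\<integral>\<^sup>+l. (\<Sum>c\<in>C. ennreal (ov c z l)) \<partial>\<mu>) = (\<integral>\<^sup>+p. (\<integral>\<^sup>+l. (\<Sum>c\<in>C. ennreal (I c z l p)) \<partial>\<mu>) \<partial>lborel)" for z
  proof -
    interpret pair_sigma_finite \<mu> "lborel :: ((complex \<times> complex) \<times> affine_point) measure"
      by (intro pair_sigma_finite.intro sigma_finite_measure_axioms lborel.sigma_finite_measure_axioms)
    have m: "(\<lambda>(l, p). (\<Sum>c\<in>C. ennreal (I c z l p))) \<in> borel_measurable (\<mu> \<Otimes>\<^sub>M lborel)"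
      unfolding split_beta using I_meas by (intro borel_measurable_sum measurable_compose[OF _ measurable_ennreal]) auto
    have Im: "I c z l \<in> borel_measurable lborel" if "c \<in> C" "l \<in> space \<mu>" for c l
      using measurable_compose[OF measurable_Pair1'[OF that(2)] I_meas[OF that(1)]] by simp
    have "(\<integral>\<^sup>+l. (\<Sum>c\<in>C. ennreal (ov c z l)) \<partial>\<mu>) = (\<integral>\<^sup>+l. (\<integral>\<^sup>+p. (\<Sum>c\<in>C. ennreal (I c z l p)) \<partial>lborel) \<partial>\<mu>)"
    proof (rule nn_integral_cong)
      fix l assume l: "l \<in> space \<mu>"
      show "(\<Sum>c\<in>C. ennreal (ov c z l)) = (\<integral>\<^sup>+p. (\<Sum>c\<in>C. ennreal (I c z l p)) \<partial>lborel)"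
        using Im l by (subst nn_integral_sum) (auto intro!: sum.cong simp: ov_nn)
    qed
    also have "\<dots> = (\<integral>\<^sup>+p. (\<integral>\<^sup>+l. (\<Sum>c\<in>C. ennreal (I c z l p)) \<partial>\<mu>) \<partial>lborel)"
      by (rule Fubini'[OF m, symmetric])
    finally show ?thesis .
  qed
  define q where "q = (\<lambda>x y. (norm (snd x + cdot (fst x) (fst y) + snd y))\<^sup>2 / (D * (1 + (norm x)\<^sup>2) * (1 + (norm y)\<^sup>2)))"
  have ab_meas: "(\<lambda>l. a c x l) \<in> borel_measurable \<mu>" "(\<lambda>l. b c x l) \<in> borel_measurable \<mu>" if "c \<in> C" for c x
    using measurable_compose[OF measurable_Pair1'[of x borel \<mu>] am[OF that]]
      measurable_compose[OF measurable_Pair1'[of x borel \<mu>] bm[OF that]] by simp_all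
  have ab_int: "integrable \<mu> (\<lambda>l. \<Sum>c\<in>C. a c x l * b c y l)" for x y
  proof (intro Bochner_Integration.integrable_sum)
    fix c assume c: "c \<in> C"
    show "integrable \<mu> (\<lambda>l. a c x l * b c y l)"
    proof (rule integrable_const_bound[where B=1])
      show "AE l in \<mu>. norm (a c x l * b c y l) \<le> 1"
      proof (rule AE_I2)
        fix l assume l: "l \<in> space \<mu>"
        show "norm (a c x l * b c y l) \<le> 1"
          using a[OF c l, of x] b[OF c l, of y] by (auto simp: abs_mult intro!: mult_le_one)
      qed
    qed (use ab_meas[OF c] in simp)
  qed
  have sum0: "0 \<le> (\<Sum>c\<in>C. a c x l * b c y l)" if "l \<in> space \<mu>" for x y l
    using a b that by (intro sum_nonneg mult_nonneg_nonneg) auto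
  have nn_sim: "(\<integral>\<^sup>+l. ennreal (\<Sum>c\<in>C. a c x l * b c y l) \<partial>\<mu>) = ennreal (q x y)" for x y
    using ab_int sum0 sim[of x y] by (subst nn_integral_eq_integral) (auto simp: q_def)
  have snd_point: "snd (overlap_point (z, p)) + cdot (fst (overlap_point (z, p))) (fst (snd p)) + snd (snd p) = z" for z p
    by (simp add: overlap_point_def)
  \<comment> \<open>For each parameter \<open>p\<close> separately the prescribed probability at
    bilinear product 0 is zero, so the integrand vanishes for almost every hidden variable, with a
    null set depending on \<open>p\<close>. Exchanging the integrals gives a single null set,
    outside of which the overlap is 0.\<close>
  have zero: "AE l in \<mu>. \<forall>c\<in>C. ov c 0 l = 0"
  proof -
    have "(\<integral>\<^sup>+l. (\<Sum>c\<in>C. ennreal (I c 0 l p)) \<partial>\<mu>) = 0" for p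
    proof -
      let ?x = "overlap_point (0, p)" and ?y = "snd p"
      have "q ?x ?y = 0"
        unfolding q_def snd_point by simp
      then have "(\<integral>\<^sup>+l. ennreal (\<Sum>c\<in>C. a c ?x l * b c ?y l) \<partial>\<mu>) = 0"
        using nn_sim[of ?x ?y] by simp
      then have "AE l in \<mu>. ennreal (\<Sum>c\<in>C. a c ?x l * b c ?y l) = 0"
        using measurable_compose[OF borel_measurable_integrable[OF ab_int[of ?x ?y]] measurable_ennreal]
        by (simp add: nn_integral_0_iff_AE)
      then have "AE l in \<mu>. (\<Sum>c\<in>C. ennreal (I c 0 l p)) = 0"
        using AE_space
      proof eventually_elim
        fix l assume l: "l \<in> space \<mu>" and "ennreal (\<Sum>c\<in>C. a c ?x l * b c ?y l) = 0"
        then have "(\<Sum>c\<in>C. a c ?x l * b c ?y l) = 0"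
          using sum0[OF l] by (simp add: antisym)
        then have "\<forall>c\<in>C. a c ?x l * b c ?y l = 0"
          using a b l C by (subst (asm) sum_nonneg_eq_0_iff) auto
        then show "(\<Sum>c\<in>C. ennreal (I c 0 l p)) = 0"
          by (intro sum.neutral ballI) (force simp: I_def E_def h_def indicator_def)
      qed
      then show ?thesis
        by (subst nn_integral_cong_AE[where v="\<lambda>_. 0"]) auto
    qed
    then have "(\<integral>\<^sup>+l. (\<Sum>c\<in>C. ennreal (ov c 0 l)) \<partial>\<mu>) = 0"
      by (simp add: swap)
    then have "AE l in \<mu>. (\<Sum>c\<in>C. ennreal (ov c 0 l)) = 0"
      by (subst (asm) nn_integral_0_iff_AE) auto
    then show ?thesis
      using AE_space
    proof eventually_elim
      fix l assume "(\<Sum>c\<in>C. ennreal (ov c 0 l)) = 0" and l: "l \<in> space \<mu>"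
      then have "\<forall>c\<in>C. ennreal (ov c 0 l) = 0"
        using C by (subst (asm) sum_eq_0_iff) auto
      then show "\<forall>c\<in>C. ov c 0 l = 0"
        using ov0 l by (auto intro!: antisym simp: ennreal_eq_0_iff)
    qed
  qed
  define V where "V = measure lborel ?W * measure lborel ?B"
  have V: "emeasure lborel ?W * emeasure lborel ?B = ennreal V" "V > 0"
  proof -
    have "emeasure lborel ?W = ennreal (measure lborel ?W)" "emeasure lborel ?B = ennreal (measure lborel ?B)"
      using emeasure_bounded_finite[OF bounded_cball, of "0::complex \<times> complex" 1]
        emeasure_bounded_finite[OF bounded_cball, of "0::affine_point" 1]
      by (auto intro!: emeasure_eq_ennreal_measure)
    then show "emeasure lborel ?W * emeasure lborel ?B = ennreal V"
      by (simp add: V_def ennreal_mult)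
    show "V > 0"
      unfolding V_def by (intro mult_pos_pos content_cball_pos) simp_all
  qed
  \<comment> \<open>\<open>V\<close> is the measure of the parameters with \<open>w\<close> and
    Alice's point in unit balls. The numbers 2 and 37 bound the factors
    \<open>1 + (norm x)\<^sup>2\<close> and \<open>1 + (norm y)\<^sup>2\<close> for radii 1 and
    6.\<close>
  define \<kappa> where "\<kappa> = V / (D * 2 * 37)"
  have \<kappa>: "\<kappa> > 0"
    using V(2) D by (simp add: \<kappa>_def)
  \<comment> \<open>On those parameters the prescribed probability is at least \<open>k\<close>, and
    \<open>I\<close> dominates the product of \<open>a\<close> and \<open>b\<close>.\<close>
  have lower: "ennreal (\<kappa> * (norm z)\<^sup>2) \<le> (\<integral>\<^sup>+l. (\<Sum>c\<in>C. ennreal (ov c z l)) \<partial>\<mu>)" if z: "norm z \<le> 1" for z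
  proof -
    define k where "k = (norm z)\<^sup>2 / (D * 2 * 37)"
    have k: "k \<ge> 0"
      using D by (simp add: k_def)
    have "ennreal (\<kappa> * (norm z)\<^sup>2) = ennreal k * (emeasure lborel ?W * emeasure lborel ?B)"
      unfolding V(1) using k V(2) by (simp add: ennreal_mult[symmetric] k_def \<kappa>_def mult_ac)
    also have "emeasure lborel ?W * emeasure lborel ?B =
        (\<integral>\<^sup>+p. indicator ?W (fst (snd p)) * indicator ?B (overlap_point (z, p)) \<partial>lborel)"
      by (subst nn_integral_overlap_point) (auto intro!: borel_measurable_indicator borel_closed closed_cball)
    also have "ennreal k * \<dots> = (\<integral>\<^sup>+p. ennreal k * (indicator ?W (fst (snd p)) * indicator ?B (overlap_point (z, p))) \<partial>lborel)"
    proof (rule nn_integral_cmult[symmetric])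
      have "(\<lambda>p. fst (snd p)) \<in> measurable lborel (borel :: (complex \<times> complex) measure)"
        "(\<lambda>p. overlap_point (z, p)) \<in> measurable lborel borel"
        by (simp_all, (intro borel_measurable_continuous_onI continuous_intros)?)
      from borel_measurable_times_ennreal[OF measurable_compose[OF this(1) borel_measurable_indicator[OF BY(3)]]
          measurable_compose[OF this(2) borel_measurable_indicator[OF BY(1)]]]
      show "(\<lambda>p. indicator ?W (fst (snd p)) * indicator ?B (overlap_point (z, p)) :: ennreal) \<in> borel_measurable lborel" .
    qed
    also have "\<dots> \<le> (\<integral>\<^sup>+p. (\<integral>\<^sup>+l. (\<Sum>c\<in>C. ennreal (I c z l p)) \<partial>\<mu>) \<partial>lborel)"
    proof (rule nn_integral_mono)
      fix p :: "(complex \<times> complex) \<times> affine_point"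
      let ?x = "overlap_point (z, p)" and ?y = "snd p"
      show "ennreal k * (indicator ?W (fst (snd p)) * indicator ?B ?x) \<le> (\<integral>\<^sup>+l. (\<Sum>c\<in>C. ennreal (I c z l p)) \<partial>\<mu>)"
      proof (cases "fst ?y \<in> ?W \<and> ?x \<in> ?B")
        case True
        then have w: "norm (fst ?y) \<le> 1" and x: "norm ?x \<le> 1"
          by auto
        have v: "norm (fst ?x) \<le> 1" "norm (snd ?x) \<le> 1"
          using x norm_fst_le[of "fst ?x" "snd ?x"] norm_snd_le[of "snd ?x" "fst ?x"] by auto
        have "norm (cdot (fst ?x) (fst ?y)) \<le> 2"
          using norm_cdot_le[of "fst ?x" "fst ?y"] mult_le_one[OF v(1) norm_ge_zero w] by linarith
        moreover have "snd ?y = z - snd ?x - cdot (fst ?x) (fst ?y)"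
          using snd_point[of z p] by (simp add: algebra_simps)
        then have "norm (snd ?y) = norm (z - snd ?x - cdot (fst ?x) (fst ?y))"
          by (rule arg_cong)
        ultimately have "norm (snd ?y) \<le> 4"
          using z v(2) norm_triangle_ineq4[of "z - snd ?x" "cdot (fst ?x) (fst ?y)"] norm_triangle_ineq4[of z "snd ?x"]
          by linarith
        then have y: "norm ?y \<le> 6"
          using w norm_Pair_le[of "fst ?y" "snd ?y"] by simp
        have "(norm ?x)\<^sup>2 \<le> 1\<^sup>2" "(norm ?y)\<^sup>2 \<le> 6\<^sup>2"
          using x y by (intro power_mono; simp)+
        then have "(1 + (norm ?x)\<^sup>2) * (1 + (norm ?y)\<^sup>2) \<le> 2 * 37"
          by (intro mult_mono) auto
        then have "D * (1 + (norm ?x)\<^sup>2) * (1 + (norm ?y)\<^sup>2) \<le> D * 2 * 37"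
          using D by simp
        moreover have "0 < D * (1 + (norm ?x)\<^sup>2) * (1 + (norm ?y)\<^sup>2)"
          using D by (intro mult_pos_pos) (auto intro: add_pos_nonneg)
        ultimately have "k \<le> q ?x ?y"
          unfolding k_def q_def snd_point by (intro divide_left_mono) (auto intro!: mult_pos_pos D)
        then have "ennreal k \<le> (\<integral>\<^sup>+l. ennreal (\<Sum>c\<in>C. a c ?x l * b c ?y l) \<partial>\<mu>)"
          unfolding nn_sim by (rule ennreal_leI)
        also have "\<dots> \<le> (\<integral>\<^sup>+l. (\<Sum>c\<in>C. ennreal (I c z l p)) \<partial>\<mu>)"
        proof (rule nn_integral_mono)
          fix l assume l: "l \<in> space \<mu>"
          have "a c ?x l * b c ?y l \<le> I c z l p" if c: "c \<in> C" for c
          proof (cases "0 < a c ?x l")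
            case True
            then have "I c z l p = b c ?y l"
              using x y by (simp add: I_def E_def h_def)
            then show ?thesis
              using a[OF c l, of ?x] b[OF c l, of ?y] mult_right_mono[of "a c ?x l" 1 "b c ?y l"] by simp
          next
            case False
            then have "a c ?x l = 0"
              using a[OF c l, of ?x] by auto
            then show ?thesis
              using I0[OF c l] by simp
          qed
          then have "(\<Sum>c\<in>C. a c ?x l * b c ?y l) \<le> (\<Sum>c\<in>C. I c z l p)"
            by (rule sum_mono)
          then show "ennreal (\<Sum>c\<in>C. a c ?x l * b c ?y l) \<le> (\<Sum>c\<in>C. ennreal (I c z l p))"
            using I0 l by (subst sum_ennreal) (auto intro: ennreal_leI)
        qed
        finally show ?thesis
          using True by simp
      next
        case False
        then have "indicator ?W (fst (snd p)) * indicator ?B ?x = (0 :: ennreal)"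
          by (auto simp: indicator_def)
        then show ?thesis
          by (simp only: mult_zero_right zero_le)
      qed
    qed
    also have "\<dots> = (\<integral>\<^sup>+l. (\<Sum>c\<in>C. ennreal (ov c z l)) \<partial>\<mu>)"
      by (rule swap[symmetric])
    finally show ?thesis .
  qed
  \<comment> \<open>This is the constant of \<open>overlap_indicator_quadratic\<close> for radius
    6.\<close>
  define M where "M = (1 + exp (6\<^sup>2 / 2) * (2 * pi) ^ 4) / 2 * measure lborel ?Y"
  define s where "s = (\<lambda>n. complex_of_real (1 / real (Suc n)))"
  have s: "s \<longlonglongrightarrow> 0" "s n \<noteq> 0" "norm (s n) \<le> 1" for n
  proof -
    have "(\<lambda>n. 1 / real (Suc n)) \<longlonglongrightarrow> 0"
      using LIMSEQ_Suc[OF lim_1_over_n] by simp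
    from tendsto_of_real[OF this, where 'a=complex] show "s \<longlonglongrightarrow> 0"
      by (simp add: s_def)
    have "norm (s n) = 1 / real (Suc n)"
      unfolding s_def norm_of_real by simp
    then show "s n \<noteq> 0" "norm (s n) \<le> 1"
      by auto
  qed
  define G where "G = (\<lambda>n l. \<Sum>c\<in>C. ov c (s n) l / (norm (s n))\<^sup>2)"
  have G_meas[measurable]: "G n \<in> borel_measurable \<mu>" for n
    unfolding G_def by (intro borel_measurable_sum borel_measurable_divide ov_meas) auto
  have G0: "0 \<le> G n l" if "l \<in> space \<mu>" for n l
    unfolding G_def using ov0 that by (intro sum_nonneg) auto
  have bound: "AE l in \<mu>. norm (G n l) \<le> card C * M" for n
    using zero AE_space
  proof eventually_elim
    fix l assume z: "\<forall>c\<in>C. ov c 0 l = 0" and l: "l \<in> space \<mu>"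
    have "G n l \<le> (\<Sum>c\<in>C. M)"
      unfolding G_def
    proof (rule sum_mono)
      fix c assume c: "c \<in> C"
      have "ov c (s n) l \<le> M * (norm (s n))\<^sup>2"
        unfolding ov_def M_def
        by (rule overlap_indicator_quadratic[OF EM[OF c l] HM[OF c l]]) (use z c in \<open>auto simp: ov_def\<close>)
      then show "ov c (s n) l / (norm (s n))\<^sup>2 \<le> M"
        using s(2)[of n] by (simp add: pos_divide_le_eq)
    qed
    then show "norm (G n l) \<le> card C * M"
      using G0[OF l, of n] by simp
  qed
  have "(\<lambda>n. \<integral>l. G n l \<partial>\<mu>) \<longlonglongrightarrow> (\<integral>l. 0 \<partial>\<mu>)"
  proof (rule integral_dominated_convergence[where w="\<lambda>_. card C * M"])
    show "AE l in \<mu>. (\<lambda>n. G n l) \<longlonglongrightarrow> 0"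
      using zero AE_space
    proof eventually_elim
      fix l assume z: "\<forall>c\<in>C. ov c 0 l = 0" and l: "l \<in> space \<mu>"
      have "(\<lambda>n. ov c (s n) l / (norm (s n))\<^sup>2) \<longlonglongrightarrow> 0" if c: "c \<in> C" for c
        unfolding ov_def
        by (rule overlap_indicator_small[OF EM[OF c l] HM[OF c l] _ s(1,2)]) (use z c in \<open>auto simp: ov_def\<close>)
      then show "(\<lambda>n. G n l) \<longlonglongrightarrow> 0"
        unfolding G_def by (rule tendsto_null_sum)
    qed
  qed (use bound in auto)
  \<comment> \<open>Dividing \<open>lower\<close> by \<open>(norm (s n))\<^sup>2\<close> bounds the
    mean of \<open>G n\<close> from below independently of \<open>n\<close>.\<close>
  moreover have "\<kappa> \<le> (\<integral>l. G n l \<partial>\<mu>)" for n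
  proof -
    have int: "integrable \<mu> (G n)"
      by (rule integrable_const_bound[OF bound G_meas])
    have "ennreal \<kappa> = ennreal (1 / (norm (s n))\<^sup>2) * ennreal (\<kappa> * (norm (s n))\<^sup>2)"
      using s(2)[of n] \<kappa> by (simp add: ennreal_mult[symmetric])
    also have "\<dots> \<le> ennreal (1 / (norm (s n))\<^sup>2) * (\<integral>\<^sup>+l. (\<Sum>c\<in>C. ennreal (ov c (s n) l)) \<partial>\<mu>)"
      by (intro mult_left_mono lower s(3) zero_le)
    also have "\<dots> = (\<integral>\<^sup>+l. ennreal (1 / (norm (s n))\<^sup>2) * (\<Sum>c\<in>C. ennreal (ov c (s n) l)) \<partial>\<mu>)"
      by (rule nn_integral_cmult[symmetric])
        (intro borel_measurable_sum measurable_compose[OF _ measurable_ennreal] ov_meas)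
    also have "\<dots> = (\<integral>\<^sup>+l. ennreal (G n l) \<partial>\<mu>)"
    proof (rule nn_integral_cong)
      fix l assume l: "l \<in> space \<mu>"
      have "(\<Sum>c\<in>C. ennreal (ov c (s n) l)) = ennreal (\<Sum>c\<in>C. ov c (s n) l)"
        using ov0 l by (intro sum_ennreal) auto
      then show "ennreal (1 / (norm (s n))\<^sup>2) * (\<Sum>c\<in>C. ennreal (ov c (s n) l)) = ennreal (G n l)"
        using ov0 l by (simp add: ennreal_mult[symmetric] sum_nonneg G_def sum_divide_distrib)
    qed
    also have "\<dots> = ennreal (\<integral>l. G n l \<partial>\<mu>)"
      using G0 by (intro nn_integral_eq_integral int) auto
    finally show ?thesis
      using G0 by (subst (asm) ennreal_le_iff) (auto intro!: Bochner_Integration.integral_nonneg_AE)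
  qed
  ultimately have "\<kappa> \<le> (\<integral>l. 0 \<partial>\<mu>)"
    by (intro LIMSEQ_le_const) auto
  then show False
    using \<kappa> by simp
qed

section \<open>Two-outcome measurements on the maximally entangled state\<close>

text \<open>Projection onto the line of \<open>\<psi>\<close> and its complement. Dividing by the
  norm admits the unnormalised vectors of an affine chart; the value 0 at other indices is the
  convention of \<open>povms\<close>.\<close>

definition binary_povm :: "complex^'d \<Rightarrow> nat \<Rightarrow> complex^'d^'d" where
  "binary_povm \<psi> n =
     (if n = 1 then (1 / (norm \<psi>)\<^sup>2) *\<^sub>R pure_state \<psi>
      else if n = 2 then mat 1 - (1 / (norm \<psi>)\<^sup>2) *\<^sub>R pure_state \<psi> else 0)"

text \<open>The complex Cauchy-Schwarz inequality, reduced to the real one for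
  \<open>L2_set\<close>.\<close>

lemma norm_inner_product_le:
  fixes u v :: "complex^'d"
  shows "cmod (\<Sum>i\<in>UNIV. cnj (u $ i) * v $ i) \<le> norm u * norm v"
proof -
  have "cmod (\<Sum>i\<in>UNIV. cnj (u $ i) * v $ i) \<le> (\<Sum>i\<in>UNIV. \<bar>cmod (u $ i)\<bar> * \<bar>cmod (v $ i)\<bar>)"
    by (rule order_trans[OF norm_sum]) (simp add: norm_mult)
  also have "\<dots> \<le> norm u * norm v"
    unfolding norm_vec_def by (rule L2_set_mult_ineq)
  finally show ?thesis .
qed

lemma quadratic_form_pure_state:
  "(\<Sum>i\<in>UNIV. cnj (v $ i) * (pure_state \<psi> *v v) $ i) =
     complex_of_real ((cmod (\<Sum>i\<in>UNIV. cnj (v $ i) * \<psi> $ i))\<^sup>2)"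
proof -
  have "(\<Sum>i\<in>UNIV. cnj (v $ i) * (pure_state \<psi> *v v) $ i) =
      (\<Sum>i\<in>UNIV. cnj (v $ i) * \<psi> $ i) * cnj (\<Sum>i\<in>UNIV. cnj (v $ i) * \<psi> $ i)"
    unfolding cnj_sum sum_product
    by (simp add: pure_state_def matrix_vector_mult_def sum_distrib_left mult_ac)
  then show ?thesis
    by (simp only: complex_norm_square)
qed

text \<open>Positivity of the second element is the Cauchy-Schwarz inequality for
  \<open>\<psi>\<close> and the test vector.\<close>

lemma binary_povm_in_povms:
  fixes \<psi> :: "complex^'d"
  assumes "\<psi> \<noteq> 0"
  shows "binary_povm \<psi> \<in> povms 2"
proof -
  define r where "r = 1 / (norm \<psi>)\<^sup>2"
  have r: "r \<ge> 0" "r * (norm \<psi>)\<^sup>2 = 1"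
    using assms by (auto simp: r_def)
  have herm: "hermitian (r *\<^sub>R pure_state \<psi>)" "hermitian (mat 1 - r *\<^sub>R pure_state \<psi>)"
    by (auto simp: hermitian_def conj_transpose_def pure_state_def vec_eq_iff mat_def)
  have quad: "(\<Sum>i\<in>UNIV. cnj (v $ i) * ((r *\<^sub>R pure_state \<psi>) *v v) $ i) =
      complex_of_real (r * (cmod (\<Sum>i\<in>UNIV. cnj (v $ i) * \<psi> $ i))\<^sup>2)" for v
  proof -
    have "((r *\<^sub>R pure_state \<psi>) *v v) $ i = of_real r * (pure_state \<psi> *v v) $ i" for i
      by (simp only: matrix_vector_mult_def vec_lambda_beta vector_scaleR_component)
        (simp add: scaleR_conv_of_real sum_distrib_left mult_ac)
    then have "(\<Sum>i\<in>UNIV. cnj (v $ i) * ((r *\<^sub>R pure_state \<psi>) *v v) $ i) =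
        of_real r * (\<Sum>i\<in>UNIV. cnj (v $ i) * (pure_state \<psi> *v v) $ i)"
      by (simp add: sum_distrib_left mult_ac)
    then show ?thesis
      by (simp only: quadratic_form_pure_state of_real_mult)
  qed
  have id: "(\<Sum>i\<in>UNIV. cnj (v $ i) * v $ i) = complex_of_real ((norm v)\<^sup>2)" for v :: "complex^'d"
  proof -
    have "(norm v)\<^sup>2 = (\<Sum>i\<in>UNIV. (cmod (v $ i))\<^sup>2)"
      unfolding norm_vec_def L2_set_def by (simp add: sum_nonneg)
    then show ?thesis
      by (simp add: complex_norm_square mult.commute del: of_real_power)
  qed
  have "0 \<le> Re (\<Sum>i\<in>UNIV. cnj (v $ i) * ((mat 1 - r *\<^sub>R pure_state \<psi>) *v v) $ i)" for v
  proof -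
    have "(\<Sum>i\<in>UNIV. cnj (v $ i) * ((mat 1 - r *\<^sub>R pure_state \<psi>) *v v) $ i)
        = complex_of_real ((norm v)\<^sup>2 - r * (cmod (\<Sum>i\<in>UNIV. cnj (v $ i) * \<psi> $ i))\<^sup>2)"
      unfolding matrix_vector_mult_diff_rdistrib vector_minus_component right_diff_distrib
        sum_subtractf quad matrix_vector_mul_lid id of_real_diff ..
    moreover have "r * (cmod (\<Sum>i\<in>UNIV. cnj (v $ i) * \<psi> $ i))\<^sup>2 \<le> r * (norm v * norm \<psi>)\<^sup>2"
      by (intro mult_left_mono power_mono norm_inner_product_le r(1)) simp
    moreover have "r * (norm v * norm \<psi>)\<^sup>2 = (norm v)\<^sup>2"
      using r(2) by (metis mult.commute mult.left_commute mult_1 power_mult_distrib)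
    ultimately show ?thesis
      by simp
  qed
  then have "pos_semidef (mat 1 - r *\<^sub>R pure_state \<psi>)"
    using herm by (simp add: pos_semidef_def)
  moreover have "pos_semidef (r *\<^sub>R pure_state \<psi>)"
    using herm r(1) unfolding pos_semidef_def quad by simp
  moreover have "{1..2::nat} = {1, 2}"
    by auto
  ultimately show ?thesis
    by (auto simp: povms_def binary_povm_def r_def[symmetric])
qed

text \<open>The density matrix is supported on pairs of equal indices. What remains is the trace of
  the transpose of \<open>A\<close> times \<open>B\<close>, divided by the dimension.\<close>

lemma trace_max_entangled_tensor:
  fixes A B :: "complex^'d^'d"
  shows "trace (pure_state max_entangled ** tensor_mat A B) =
    (\<Sum>i\<in>UNIV. \<Sum>j\<in>UNIV. A $ j $ i * B $ j $ i) / of_nat CARD('d)"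
proof -
  define s where "s = complex_of_real (1 / sqrt (real CARD('d)))"
  have nth: "(max_entangled :: complex^('d \<times> 'd)) $ p = (if fst p = snd p then s else 0)" for p
    by (simp only: max_entangled_nth s_def)
  have s: "s * cnj s = 1 / of_nat CARD('d)"
    by (simp add: s_def flip: of_real_mult)
  have diag: "(\<Sum>p\<in>(UNIV :: ('d \<times> 'd) set). if fst p = snd p then g (fst p) else 0) = (\<Sum>i\<in>UNIV. g i)"
    for g :: "'d \<Rightarrow> complex"
  proof -
    have "(\<Sum>p\<in>(UNIV :: ('d \<times> 'd) set). if fst p = snd p then g (fst p) else 0) =
        (\<Sum>i\<in>UNIV. \<Sum>j\<in>UNIV. if i = j then g i else 0)"
      unfolding sum.cartesian_product UNIV_Times_UNIV case_prod_unfold ..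
    then show ?thesis
      by simp
  qed
  have "trace (pure_state max_entangled ** tensor_mat A B) =
      (\<Sum>p\<in>UNIV. \<Sum>q\<in>UNIV. (if fst p = snd p then s else 0) * cnj (if fst q = snd q then s else 0) *
        (A $ fst q $ fst p * B $ snd q $ snd p))"
    by (simp add: trace_def matrix_matrix_mult_def pure_state_def tensor_mat_def nth)
  also have "\<dots> = (\<Sum>p\<in>UNIV. if fst p = snd p then
      (\<Sum>q\<in>UNIV. if fst q = snd q then s * cnj s * (A $ fst q $ fst p * B $ fst q $ fst p) else 0) else 0)"
    by (intro sum.cong refl) (auto intro!: sum.cong)
  also have "\<dots> = (\<Sum>p\<in>UNIV. if fst p = snd p then
      (\<Sum>j\<in>UNIV. s * cnj s * (A $ j $ fst p * B $ j $ fst p)) else 0)"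
    by (intro sum.cong refl if_cong) (rule diag[of "\<lambda>j. s * cnj s * (A $ j $ fst p * B $ j $ fst p)" for p])
  also have "\<dots> = (\<Sum>i\<in>UNIV. \<Sum>j\<in>UNIV. s * cnj s * (A $ j $ i * B $ j $ i))"
    by (rule diag)
  finally show ?thesis
    by (simp add: s sum_divide_distrib)
qed

text \<open>For two rank-one matrices the entrywise products factor, so the double sum is the
  squared modulus of the bilinear product of the vectors. The transpose is what removes the
  conjugation.\<close>

lemma trace_max_entangled_binary_povm:
  fixes \<psi> \<phi> :: "complex^'d"
  shows "trace (pure_state max_entangled ** tensor_mat (binary_povm \<psi> 1) (binary_povm \<phi> 1)) =
    complex_of_real ((cmod (\<Sum>i\<in>UNIV. \<psi> $ i * \<phi> $ i))\<^sup>2 / (real CARD('d) * (norm \<psi>)\<^sup>2 * (norm \<phi>)\<^sup>2))"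
proof -
  let ?S = "\<Sum>i\<in>UNIV. \<psi> $ i * \<phi> $ i"
  have "(\<Sum>i\<in>UNIV. \<Sum>j\<in>UNIV. binary_povm \<psi> 1 $ j $ i * binary_povm \<phi> 1 $ j $ i) =
      (\<Sum>i\<in>UNIV. \<Sum>j\<in>UNIV. of_real (1 / ((norm \<psi>)\<^sup>2 * (norm \<phi>)\<^sup>2)) * (cnj (\<psi> $ i * \<phi> $ i) * (\<psi> $ j * \<phi> $ j)))"
    by (intro sum.cong refl) (simp only: binary_povm_def pure_state_def if_True simp_thms vector_scaleR_component vec_lambda_beta,
        simp add: scaleR_conv_of_real)
  also have "\<dots> = of_real (1 / ((norm \<psi>)\<^sup>2 * (norm \<phi>)\<^sup>2)) * (cnj ?S * ?S)"
    unfolding cnj_sum sum_product by (simp only: sum_distrib_left)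
  also have "cnj ?S * ?S = of_real ((cmod ?S)\<^sup>2)"
    by (simp only: complex_norm_square mult.commute)
  finally show ?thesis
    unfolding trace_max_entangled_tensor by (simp add: mult.assoc)
qed

section \<open>Continuous families of vectors on four basis indices\<close>

lemma sum_four:
  fixes g :: "'d::finite \<Rightarrow> 'a::comm_monoid_add"
  assumes "distinct [i, j, k, l]" and "\<And>m. m \<notin> {i, j, k, l} \<Longrightarrow> g m = 0"
  shows "(\<Sum>m\<in>UNIV. g m) = g i + (g j + (g k + g l))"
proof -
  have "(\<Sum>m\<in>UNIV. g m) = (\<Sum>m\<in>{i, j, k, l}. g m)"
    using assms(2) by (intro sum.mono_neutral_right) auto
  then show ?thesis
    using assms(1) by simp
qed

definition four_vec :: "'d \<Rightarrow> 'd \<Rightarrow> 'd \<Rightarrow> 'd \<Rightarrow> complex \<times> complex \<Rightarrow> complex \<Rightarrow> complex \<Rightarrow> complex^'d" where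
  "four_vec i j k l v c d = (\<chi> m. if m = i then fst v else if m = j then snd v else if m = k then c
     else if m = l then d else 0)"

lemma continuous_four_vec:
  fixes v :: "'a::topological_space \<Rightarrow> complex \<times> complex"
  assumes "continuous_on UNIV v" "continuous_on UNIV c" "continuous_on UNIV d"
  shows "continuous_on UNIV (\<lambda>x. four_vec i j k l (v x) (c x) (d x))"
  unfolding four_vec_def
proof (rule continuous_on_vec_lambda)
  fix m
  show "continuous_on UNIV (\<lambda>x. if m = i then fst (v x) else if m = j then snd (v x) else if m = k then c x
     else if m = l then d x else 0)"
    using assms by (cases "m = i"; cases "m = j"; cases "m = k"; cases "m = l") (auto intro!: continuous_intros)
qed

lemma norm_four_vec:
  fixes i :: "'d::finite"
  assumes "distinct [i, j, k, l]"
  shows "(norm (four_vec i j k l v c d))\<^sup>2 = (norm v)\<^sup>2 + (cmod c)\<^sup>2 + (cmod d)\<^sup>2"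
proof -
  have "(norm (four_vec i j k l v c d))\<^sup>2 = (\<Sum>m\<in>UNIV. (cmod (four_vec i j k l v c d $ m))\<^sup>2)"
    unfolding norm_vec_def L2_set_def by (simp add: sum_nonneg)
  also have "\<dots> = (cmod (fst v))\<^sup>2 + ((cmod (snd v))\<^sup>2 + ((cmod c)\<^sup>2 + (cmod d)\<^sup>2))"
    using assms by (subst sum_four[OF assms]) (auto simp: four_vec_def)
  finally show ?thesis
    by (simp add: norm_prod_def)
qed

lemma continuous_pure_state:
  fixes \<psi> :: "'a::topological_space \<Rightarrow> complex^'d"
  assumes "continuous_on UNIV \<psi>"
  shows "continuous_on UNIV (\<lambda>x. pure_state (\<psi> x))"
  unfolding pure_state_def using assms by (intro continuous_on_vec_lambda continuous_intros)

lemma continuous_binary_povm: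
  fixes \<psi> :: "'a::topological_space \<Rightarrow> complex^'d"
  assumes "continuous_on UNIV \<psi>" "\<And>x. \<psi> x \<noteq> 0"
  shows "continuous_on UNIV (\<lambda>x. binary_povm (\<psi> x))"
proof (rule continuous_on_coordinatewise_then_product)
  fix n
  have "continuous_on UNIV (\<lambda>x. (1 / (norm (\<psi> x))\<^sup>2) *\<^sub>R pure_state (\<psi> x))"
    using assms by (intro continuous_intros continuous_pure_state) auto
  then show "continuous_on UNIV (\<lambda>x. binary_povm (\<psi> x) n)"
    by (cases "n = 1"; cases "n = 2") (simp_all add: binary_povm_def continuous_on_diff)
qed

text \<open>The response functions are measurable in the measurement; composed with this map they
  become measurable in the affine point, over which the overlaps integrate.\<close>

lemma measurable_binary_povm:
  fixes \<psi> :: "'a::topological_space \<Rightarrow> complex^'d"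
  assumes "continuous_on UNIV \<psi>" "\<And>x. \<psi> x \<noteq> 0"
  shows "(\<lambda>x. binary_povm (\<psi> x)) \<in> measurable borel (povm_borel 2)"
  unfolding povm_borel_def
  by (intro measurable_restrict_space2 borel_measurable_continuous_onI continuous_binary_povm assms)
    (simp add: binary_povm_in_povms assms(2))

text \<open>Restricted to \<open>binary_povm\<close> along two affine families of vectors, a
  simulation would have exactly the statistics excluded by
  \<open>bilinear_square_not_simulable\<close>. The bound on the dimension provides four distinct
  basis indices.\<close>

theorem corollaryC4:
  assumes "CARD('d::finite) \<ge> 4"
  shows "\<not> (\<exists>d\<^sub>C :: nat. admits_classical_simulation TYPE('l) d\<^sub>C
            (pure_state (max_entangled :: complex^('d \<times> 'd))))"
proof
  assume "\<exists>d\<^sub>C :: nat. admits_classical_simulation TYPE('l) d\<^sub>C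
            (pure_state (max_entangled :: complex^('d \<times> 'd)))"
  then obtain d\<^sub>C :: nat where "admits_classical_simulation TYPE('l) d\<^sub>C
            (pure_state (max_entangled :: complex^('d \<times> 'd)))"
    by blast
  then obtain \<mu> :: "'l measure"
    and p\<^sub>A :: "nat \<Rightarrow> (nat \<Rightarrow> complex^'d^'d) \<Rightarrow> 'l \<Rightarrow> nat \<Rightarrow> nat \<Rightarrow> real"
    and p\<^sub>B :: "nat \<Rightarrow> (nat \<Rightarrow> complex^'d^'d) \<Rightarrow> nat \<Rightarrow> 'l \<Rightarrow> nat \<Rightarrow> real"
    where \<mu>: "prob_space \<mu>"
    and A: "\<forall>n\<ge>1. \<forall>M\<in>povms n. \<forall>l\<in>space \<mu>.
         (\<forall>a\<in>{1..n}. \<forall>c\<in>{1..d\<^sub>C}. 0 \<le> p\<^sub>A n M l a c) \<and>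
         (\<Sum>a\<in>{1..n}. \<Sum>c\<in>{1..d\<^sub>C}. p\<^sub>A n M l a c) = 1"
    and B: "\<forall>n\<ge>1. \<forall>M\<in>povms n. \<forall>c\<in>{1..d\<^sub>C}. \<forall>l\<in>space \<mu>.
         (\<forall>b\<in>{1..n}. 0 \<le> p\<^sub>B n M c l b) \<and> (\<Sum>b\<in>{1..n}. p\<^sub>B n M c l b) = 1"
    and Am: "\<forall>n\<ge>1. \<forall>a\<in>{1..n}. \<forall>c\<in>{1..d\<^sub>C}.
         (\<lambda>(M, l). p\<^sub>A n M l a c) \<in> borel_measurable (povm_borel n \<Otimes>\<^sub>M \<mu>)"
    and Bm: "\<forall>n\<ge>1. \<forall>b\<in>{1..n}. \<forall>c\<in>{1..d\<^sub>C}.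
         (\<lambda>(M, l). p\<^sub>B n M c l b) \<in> borel_measurable (povm_borel n \<Otimes>\<^sub>M \<mu>)"
    and sim: "\<forall>n\<ge>1. \<forall>n'\<ge>1. \<forall>M\<in>povms n. \<forall>N\<in>povms n'. \<forall>a\<in>{1..n}. \<forall>b\<in>{1..n'}.
         trace (pure_state (max_entangled :: complex^('d \<times> 'd)) ** tensor_mat (M a) (N b)) =
         complex_of_real (\<integral>l. (\<Sum>c\<in>{1..d\<^sub>C}. p\<^sub>A n M l a c * p\<^sub>B n' N c l b) \<partial>\<mu>)"
    unfolding admits_classical_simulation_def by (elim exE conjE) (rule that)
  have A2: "0 \<le> p\<^sub>A 2 M l a c" "(\<Sum>a\<in>{1..2}. \<Sum>c\<in>{1..d\<^sub>C}. p\<^sub>A 2 M l a c) = 1"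
    if "M \<in> povms 2" "l \<in> space \<mu>" "a \<in> {1..2}" "c \<in> {1..d\<^sub>C}" for M l a c
    using A[rule_format, of 2 M l] that by auto
  have B2: "0 \<le> p\<^sub>B 2 M c l b" "(\<Sum>b\<in>{1..2}. p\<^sub>B 2 M c l b) = 1"
    if "M \<in> povms 2" "l \<in> space \<mu>" "b \<in> {1..2}" "c \<in> {1..d\<^sub>C}" for M l b c
    using B[rule_format, of 2 M c l] that by auto
  obtain S :: "'d set" where S: "card S = 4"
    using obtain_subset_with_card_n[OF assms] by blast
  obtain xs where "set xs = S" "distinct xs" "length xs = 4"
    using finite_distinct_list[of S] distinct_card S by (metis card.infinite zero_neq_numeral)
  then obtain i\<^sub>0 i\<^sub>1 i\<^sub>2 i\<^sub>3 :: 'd where idx: "distinct [i\<^sub>0, i\<^sub>1, i\<^sub>2, i\<^sub>3]"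
    by (auto simp: length_Suc_conv eval_nat_numeral)
  \<comment> \<open>Alice's constant coordinate 1 faces Bob's free last coordinate and vice versa,
    so that both last coordinates enter the bilinear product with coefficient 1.\<close>
  define \<psi> where "\<psi> = (\<lambda>x::affine_point. four_vec i\<^sub>0 i\<^sub>1 i\<^sub>2 i\<^sub>3 (fst x) (snd x) 1)"
  define \<phi> where "\<phi> = (\<lambda>y::affine_point. four_vec i\<^sub>0 i\<^sub>1 i\<^sub>2 i\<^sub>3 (fst y) 1 (snd y))"
  have norm2: "(norm (\<psi> x))\<^sup>2 = 1 + (norm x)\<^sup>2" "(norm (\<phi> x))\<^sup>2 = 1 + (norm x)\<^sup>2" for x
    by (simp_all add: \<psi>_def \<phi>_def norm_four_vec[OF idx] norm_prod_def[of x])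
  have nz: "\<psi> x \<noteq> 0" "\<phi> x \<noteq> 0" for x
    using norm2[of x] by (auto simp: add_nonneg_eq_0_iff)
  have cont: "continuous_on UNIV \<psi>" "continuous_on UNIV \<phi>"
    unfolding \<psi>_def \<phi>_def by (intro continuous_four_vec continuous_intros)+
  have prod: "(\<Sum>m\<in>UNIV. \<psi> x $ m * \<phi> y $ m) = snd x + cdot (fst x) (fst y) + snd y" for x y
    using idx by (subst sum_four[OF idx]) (auto simp: \<psi>_def \<phi>_def four_vec_def cdot_def)
  have povm: "binary_povm (\<psi> x) \<in> povms 2" "binary_povm (\<phi> x) \<in> povms 2" for x
    by (intro binary_povm_in_povms nz)+
  show False
  \<comment> \<open>Outcome 1 means success; the message is part of Alice's output and of Bob's
    input.\<close>
  proof (rule bilinear_square_not_simulable[OF \<mu>, where C="{1..d\<^sub>C}" and D="real CARD('d)"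
        and a="\<lambda>c x l. p\<^sub>A 2 (binary_povm (\<psi> x)) l 1 c" and b="\<lambda>c y l. p\<^sub>B 2 (binary_povm (\<phi> y)) c l 1"])
    show "0 < real CARD('d)"
      by simp
  next
    fix c assume c: "c \<in> {1..d\<^sub>C}"
    have "(\<lambda>(x, l). (binary_povm (\<psi> x), l)) \<in> measurable (borel \<Otimes>\<^sub>M \<mu>) (povm_borel 2 \<Otimes>\<^sub>M \<mu>)"
      "(\<lambda>(x, l). (binary_povm (\<phi> x), l)) \<in> measurable (borel \<Otimes>\<^sub>M \<mu>) (povm_borel 2 \<Otimes>\<^sub>M \<mu>)"
      unfolding split_beta
      by (intro measurable_Pair measurable_snd measurable_compose[OF measurable_fst] measurable_binary_povm cont nz)+
    from measurable_compose[OF this(1) Am[rule_format, of 2 1 c]] measurable_compose[OF this(2) Bm[rule_format, of 2 1 c]]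
    show "(\<lambda>(x, l). p\<^sub>A 2 (binary_povm (\<psi> x)) l 1 c) \<in> borel_measurable (borel \<Otimes>\<^sub>M \<mu>)"
      "(\<lambda>(y, l). p\<^sub>B 2 (binary_povm (\<phi> y)) c l 1) \<in> borel_measurable (borel \<Otimes>\<^sub>M \<mu>)"
      using c by (simp_all add: split_beta)
  next
    fix c x l assume c: "c \<in> {1..d\<^sub>C}" and l: "l \<in> space \<mu>"
    \<comment> \<open>Alice's probabilities are normalised over outcomes and messages jointly, hence
      the two stages.\<close>
    have "p\<^sub>A 2 (binary_povm (\<psi> x)) l 1 c \<le> (\<Sum>c\<in>{1..d\<^sub>C}. p\<^sub>A 2 (binary_povm (\<psi> x)) l 1 c)"
      using c A2(1) povm l by (intro member_le_sum) auto
    also have "\<dots> \<le> (\<Sum>a\<in>{1..2}. \<Sum>c\<in>{1..d\<^sub>C}. p\<^sub>A 2 (binary_povm (\<psi> x)) l a c)"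
      using A2(1) povm l
      by (intro member_le_sum[of 1 "{1..2}" "\<lambda>a. \<Sum>c\<in>{1..d\<^sub>C}. p\<^sub>A 2 (binary_povm (\<psi> x)) l a c"] sum_nonneg) auto
    finally show "0 \<le> p\<^sub>A 2 (binary_povm (\<psi> x)) l 1 c \<and> p\<^sub>A 2 (binary_povm (\<psi> x)) l 1 c \<le> 1"
      using A2[OF povm(1) l _ c, of 1 x] by simp
    have "p\<^sub>B 2 (binary_povm (\<phi> x)) c l 1 \<le> (\<Sum>b\<in>{1..2}. p\<^sub>B 2 (binary_povm (\<phi> x)) c l b)"
      using c B2(1) povm l by (intro member_le_sum) auto
    then show "0 \<le> p\<^sub>B 2 (binary_povm (\<phi> x)) c l 1 \<and> p\<^sub>B 2 (binary_povm (\<phi> x)) c l 1 \<le> 1"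
      using B2[OF povm(2) l _ c, of 1 x] by simp
  next
    fix x y
    have "complex_of_real (\<integral>l. (\<Sum>c\<in>{1..d\<^sub>C}. p\<^sub>A 2 (binary_povm (\<psi> x)) l 1 c * p\<^sub>B 2 (binary_povm (\<phi> y)) c l 1) \<partial>\<mu>) =
      trace (pure_state (max_entangled :: complex^('d \<times> 'd)) ** tensor_mat (binary_povm (\<psi> x) 1) (binary_povm (\<phi> y) 1))"
      by (rule sim[rule_format, symmetric]) (simp_all add: povm)
    then show "(\<integral>l. (\<Sum>c\<in>{1..d\<^sub>C}. p\<^sub>A 2 (binary_povm (\<psi> x)) l 1 c * p\<^sub>B 2 (binary_povm (\<phi> y)) c l 1) \<partial>\<mu>) =
      (norm (snd x + cdot (fst x) (fst y) + snd y))\<^sup>2 / (real CARD('d) * (1 + (norm x)\<^sup>2) * (1 + (norm y)\<^sup>2))"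
      unfolding trace_max_entangled_binary_povm prod norm2 of_real_eq_iff .
  qed simp
qed

end
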